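(* Let $p\in[0,1)$ and $0\le k<1$. Let $f\in\Sigma_k(p)$ have the expansion $f(z)=\frac1{z-p}+\sum_{n=0}^\infty b_nz^n$ in $\mathbb{D}$. Then $$\left|f'(z)+\frac1{(z-p)^2}\right|\le\frac{k}{(1-p^2)(1-|z|^2)},\qquad z\in\mathbb{D}.$$
   Context: $\mathbb{D}=\{|z|<1\}$, $\widehat{\mathbb{C}}=\mathbb{C}\cup\{\infty\}$, $\partial f=\partial f/\partial z$, $\bar\partial f=\partial f/\partial\bar z$. $\Sigma(p)$ is the class of univalent meromorphic functions $f$ on $\mathbb{D}$ with a simple pole at $z=p$ of residue $1$. $\Sigma_k(p)$ is the class of those $f\in\Sigma(p)$ having a $k$-quasiconformal extension to $\widehat{\mathbb{C}}$. A map $f:\widehat{\mathbb{C}}\to\widehat{\mathbb{C}}$ is $k$-quasiconformal if it is a homeomorphism with locally $L^2$ distributional derivatives on $\mathbb{C}\setminus\{f^{-1}(\infty)\}$ satisfying $|\bar\partial f|\le k|\partial f|$ a.e. At $z=p$ the expression $f'(z)+\frac1{(z-p)^2}$ is understood by its removable-singularity value. *)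

theory Defs
  imports "HOL-Complex_Analysis.Complex_Analysis"
begin

text \<open>The Riemann sphere is the one-point compactification of \<open>\<complex>\<close>; \<open>None\<close> is the point at infinity.\<close>

abbreviation riemann_sphere :: "complex option topology" where
  "riemann_sphere \<equiv> Alexandroff_compactification euclidean"

text \<open>The Frechet derivative is real-linear; its values in the directions \<open>1\<close> and \<open>\<i>\<close> are the partial
  derivatives with respect to the real and imaginary part.\<close>

definition dz :: "(complex \<Rightarrow> complex) \<Rightarrow> complex \<Rightarrow> complex" where
  "dz \<phi> z = (frechet_derivative \<phi> (at z) 1 - \<i> * frechet_derivative \<phi> (at z) \<i>) / 2"

definition dzbar :: "(complex \<Rightarrow> complex) \<Rightarrow> complex \<Rightarrow> complex" where
  "dzbar \<phi> z = (frechet_derivative \<phi> (at z) 1 + \<i> * frechet_derivative \<phi> (at z) \<i>) / 2"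

primrec C_class :: "nat \<Rightarrow> (complex \<Rightarrow> complex) \<Rightarrow> bool" where
  "C_class 0 \<phi> \<longleftrightarrow> continuous_on UNIV \<phi>"
| "C_class (Suc n) \<phi> \<longleftrightarrow> (\<forall>z. \<phi> differentiable (at z)) \<and>
     C_class n (\<lambda>z. frechet_derivative \<phi> (at z) 1) \<and>
     C_class n (\<lambda>z. frechet_derivative \<phi> (at z) \<i>)"

definition test_function_on :: "complex set \<Rightarrow> (complex \<Rightarrow> complex) \<Rightarrow> bool" where
  "test_function_on U \<phi> \<longleftrightarrow> (\<forall>n. C_class n \<phi>) \<and>
     compact (closure {z. \<phi> z \<noteq> 0}) \<and> closure {z. \<phi> z \<noteq> 0} \<subseteq> U"

definition locally_L2_on :: "complex set \<Rightarrow> (complex \<Rightarrow> complex) \<Rightarrow> bool" where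
  "locally_L2_on U g \<longleftrightarrow> set_borel_measurable lebesgue U g \<and>
     (\<forall>K. compact K \<and> K \<subseteq> U \<longrightarrow> set_integrable lebesgue K (\<lambda>z. (norm (g z))\<^sup>2))"

text \<open>The operator \<open>L\<close> is \<open>dz\<close> or \<open>dzbar\<close>; \<open>g\<close> is \<open>L f\<close> in the sense of distributions on \<open>U\<close>.\<close>

definition has_distrib_deriv_on ::
  "((complex \<Rightarrow> complex) \<Rightarrow> complex \<Rightarrow> complex) \<Rightarrow> complex set \<Rightarrow>
   (complex \<Rightarrow> complex) \<Rightarrow> (complex \<Rightarrow> complex) \<Rightarrow> bool" where
  "has_distrib_deriv_on L U f g \<longleftrightarrow> (\<forall>\<phi>. test_function_on U \<phi> \<longrightarrow>
     set_lebesgue_integral lebesgue U (\<lambda>z. f z * L \<phi> z) =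
     - set_lebesgue_integral lebesgue U (\<lambda>z. g z * \<phi> z))"

definition quasiconformal :: "real \<Rightarrow> (complex option \<Rightarrow> complex option) \<Rightarrow> bool" where
  "quasiconformal k F \<longleftrightarrow> homeomorphic_map riemann_sphere riemann_sphere F \<and>
     (let U = {z. F (Some z) \<noteq> None}; f = (\<lambda>z. the (F (Some z))) in
       \<exists>g h. locally_L2_on U g \<and> locally_L2_on U h \<and>
         has_distrib_deriv_on dz U f g \<and> has_distrib_deriv_on dzbar U f h \<and>
         (AE z in lebesgue. z \<in> U \<longrightarrow> norm (h z) \<le> k * norm (g z)))"

text \<open>A meromorphic function is given by a complex-valued function, whose values at the poles
  carry no information; this is the induced map into the Riemann sphere.\<close>

definition sphere_map :: "(complex \<Rightarrow> complex) \<Rightarrow> complex \<Rightarrow> complex option" where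
  "sphere_map f z = (if is_pole f z then None else Some (f z))"

definition Sigma_class :: "real \<Rightarrow> (complex \<Rightarrow> complex) set" where
  "Sigma_class p = {f. f nicely_meromorphic_on ball 0 1 \<and> inj_on (sphere_map f) (ball 0 1) \<and>
     is_pole f (of_real p) \<and> zorder f (of_real p) = -1 \<and> residue f (of_real p) = 1}"

definition Sigma_qc :: "real \<Rightarrow> real \<Rightarrow> (complex \<Rightarrow> complex) set" where
  "Sigma_qc k p = {f \<in> Sigma_class p.
     \<exists>F. quasiconformal k F \<and> (\<forall>z \<in> ball 0 1. F (Some z) = sphere_map f z)}"

text \<open>The function \<open>f' + 1 / (z - p)\<^sup>2\<close> does have a limit at every point of the disc, so that
  \<^const>\<open>remove_sings\<close> never takes its default value there, and away from \<open>p\<close> it changes nothing.\<close>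

lemma
  fixes f :: "complex \<Rightarrow> complex" and p z :: complex and b :: "nat \<Rightarrow> complex"
  assumes expansion: "\<And>w. w \<in> ball 0 1 - {p} \<Longrightarrow> (\<lambda>n. b n * w ^ n) sums (f w - 1 / (w - p))"
    and z: "z \<in> ball 0 1"
  shows regular_part_tendsto:
      "(\<lambda>w. deriv f w + 1 / (w - p)\<^sup>2) \<midarrow>z\<rightarrow> remove_sings (\<lambda>w. deriv f w + 1 / (w - p)\<^sup>2) z"
    and regular_part_eq:
      "z \<noteq> p \<Longrightarrow> remove_sings (\<lambda>w. deriv f w + 1 / (w - p)\<^sup>2) z = deriv f z + 1 / (z - p)\<^sup>2"
proof -
  define h where "h = (\<lambda>w. deriv f w + 1 / (w - p)\<^sup>2)"
  define S where "S = (\<lambda>w. \<Sum>n. b n * w ^ n)"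
  have summ: "summable (\<lambda>n. b n * w ^ n)" if w: "norm w < 1" for w
  proof -
    obtain r where r: "norm w < r" "r < 1" using dense[OF w] by blast
    have "infinite {r<..<1::real}" using r by simp
    hence "\<not> {r<..<1} \<subseteq> {Re p}" by (meson finite.emptyI finite.insertI finite_subset)
    then obtain s where s: "s \<in> {r<..<1}" "complex_of_real s \<noteq> p" by force
    have "0 \<le> s" using s r le_less_trans[OF norm_ge_zero[of w] r(1)] by simp
    hence ns: "norm (complex_of_real s) = s" by simp
    hence "complex_of_real s \<in> ball 0 1 - {p}" using s by simp
    hence "summable (\<lambda>n. b n * complex_of_real s ^ n)" using expansion sums_summable by blast
    thus ?thesis by (rule powser_inside) (use r s ns in auto)
  qed
  have S_hol: "S holomorphic_on ball 0 1"
    by (rule power_series_holomorphic[where a = b])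
       (use summ in \<open>simp add: S_def summable_sums\<close>)
  have fS: "f w = 1 / (w - p) + S w" if "w \<in> ball 0 1 - {p}" for w
    using sums_unique[OF expansion[OF that]] by (simp add: S_def diff_eq_eq add.commute)
  have h_eq: "h w = deriv S w" if w: "w \<in> ball 0 1 - {p}" for w
  proof -
    have "(S has_field_derivative deriv S w) (at w)"
      using S_hol w by (auto intro: holomorphic_derivI)
    hence "((\<lambda>w. 1 / (w - p) + S w) has_field_derivative (- 1 / (w - p)\<^sup>2 + deriv S w)) (at w)"
      using w by (auto intro!: derivative_eq_intros simp: power2_eq_square)
    hence "(f has_field_derivative (- 1 / (w - p)\<^sup>2 + deriv S w)) (at w)"
      by (rule has_field_derivative_transform_within_open[where S = "ball 0 1 - {p}"])
         (use w fS in auto)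
    thus ?thesis by (simp add: h_def DERIV_imp_deriv)
  qed
  have "continuous_on (ball 0 1) (deriv S)"
    using S_hol by (intro holomorphic_on_imp_continuous_on holomorphic_deriv) auto
  hence "deriv S \<midarrow>z\<rightarrow> deriv S z"
    using z by (simp add: continuous_on_eq_continuous_at isCont_def)
  moreover have "eventually (\<lambda>w. deriv S w = h w) (at z)"
  proof -
    have "eventually (\<lambda>w. w \<in> ball 0 1 - {p}) (at z)"
    proof (cases "z = p")
      case True
      thus ?thesis using z eventually_at_in_open[of "ball 0 1" z] by simp
    next
      case False
      have "open (ball 0 1 - {p})" by (intro open_Diff) auto
      thus ?thesis using z False eventually_at_in_open'[of "ball 0 1 - {p}" z] by blast
    qed
    thus ?thesis by eventually_elim (simp add: h_eq)
  qed
  ultimately have lim: "h \<midarrow>z\<rightarrow> deriv S z" by (rule Lim_transform_eventually)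
  hence rs: "remove_sings h z = deriv S z" by (rule remove_sings_eqI)
  show "(\<lambda>w. deriv f w + 1 / (w - p)\<^sup>2) \<midarrow>z\<rightarrow> remove_sings (\<lambda>w. deriv f w + 1 / (w - p)\<^sup>2) z"
    using lim rs by (simp add: h_def)
  show "remove_sings (\<lambda>w. deriv f w + 1 / (w - p)\<^sup>2) z = deriv f z + 1 / (z - p)\<^sup>2"
    if "z \<noteq> p" using rs h_eq[of z] z that by (simp add: h_def)
qed

end

theory Submission
  imports Defs
begin

text \<open>
  Put \<open>\<phi> z = f z - 1 / (z - p)\<close>, which is holomorphic in the unit disc \<open>D\<close>, and
  \<open>A = \<integral>\<^bsub>D\<^esub> \<bar>\<phi>'\<bar>\<^sup>2 = \<pi> (\<Sum>n. n \<bar>b n\<bar>\<^sup>2)\<close>. The statement follows from an area theorem,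
  \<open>A \<le> k\<^sup>2 \<pi> / (1 - p\<^sup>2)\<^sup>2\<close>, and from the Bergman inequality
  \<open>\<bar>\<phi>' z\<bar> \<le> sqrt (A / \<pi>) / (1 - \<bar>z\<bar>\<^sup>2)\<close> (lemma \<open>bergman_bound_unit_disc\<close>).

  The area theorem rests on one inequality. If a bounded continuous function \<open>\<Gamma>\<close> on the plane has
  a limit at infinity and weak derivatives \<open>u = \<partial>\<Gamma>\<close>, \<open>v = \<partial>bar \<Gamma>\<close> in \<open>L\<^sup>2\<close>, then
  \<open>\<integral>\<bar>u\<bar>\<^sup>2 \<le> \<integral>\<bar>v\<bar>\<^sup>2\<close>, because \<open>\<bar>u\<bar>\<^sup>2 - \<bar>v\<bar>\<^sup>2\<close> is a Jacobian, hence a divergence. Let \<open>F\<close> be the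
  quasiconformal extension of \<open>f\<close>, with \<open>g = \<partial>F\<close> and \<open>h = \<partial>bar F\<close>. The inequality is applied to
  two functions.
  \<^item> \<open>F - 1 / (z - p)\<close> has \<open>u = \<phi>'\<close>, \<open>v = 0\<close> in \<open>D\<close> and \<open>v = h\<close> outside. Hence \<open>A \<le> w\<close> for
    \<open>w = \<integral>\<bar>h\<bar>\<^sup>2\<close> over the exterior.
  \<^item> Adding the function that equals \<open>1 / (z - p)\<close> outside and its antiholomorphic counterpart
    \<open>cnj z / (1 - p cnj z)\<close> in \<open>D\<close> gives back \<open>F\<close> outside, leaves \<open>u = \<phi>'\<close> in \<open>D\<close>, and makes
    \<open>v = 1 / (1 - p cnj z)\<^sup>2\<close> there, a Bergman kernel with \<open>\<integral>\<^bsub>D\<^esub> \<bar>v\<bar>\<^sup>2 = Q = \<pi> / (1 - p\<^sup>2)\<^sup>2\<close>. Hence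
    \<open>A + s \<le> Q + w\<close> for \<open>s = \<integral>\<bar>g\<bar>\<^sup>2\<close> over the exterior.

  Quasiconformality gives \<open>w \<le> k\<^sup>2 s\<close>, and the three inequalities imply \<open>A \<le> k\<^sup>2 Q\<close>.

  It is not known beforehand that \<open>s\<close> and \<open>w\<close> are finite, so the inequality is proved with a cut-off
  of radius \<open>R\<close> and an error that vanishes as \<open>R\<close> tends to infinity (\<open>energy_inequality\<close>,
  \<open>cutoff_family_exists\<close>); finiteness then comes out of \<open>k < 1\<close> (\<open>area_arithmetic\<close>). The
  underlying identity for weak derivatives (\<open>energy_identity\<close>) is obtained by mollification.
\<close>

section \<open>Wirtinger derivatives and smooth functions\<close>

text \<open>Every real-linear map of \<open>\<complex>\<close> has the form \<open>h \<mapsto> a h + b cnj h\<close>, so this is the Frechet derivative,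
  written so that \<open>a\<close> and \<open>b\<close> are the values of \<open>dz\<close> and \<open>dzbar\<close>.\<close>

definition has_wirtinger :: "(complex \<Rightarrow> complex) \<Rightarrow> complex \<Rightarrow> complex \<Rightarrow> complex \<Rightarrow> bool" where
  "has_wirtinger f a b z \<longleftrightarrow> (f has_derivative (\<lambda>h. a * h + b * cnj h)) (at z)"

lemma frechet_derivative_wirtinger:
  "has_wirtinger f a b z \<Longrightarrow> frechet_derivative f (at z) = (\<lambda>h. a * h + b * cnj h)"
  unfolding has_wirtinger_def by (metis frechet_derivative_at)

lemma dz_wirtinger: "has_wirtinger f a b z \<Longrightarrow> dz f z = a"
  by (simp add: dz_def frechet_derivative_wirtinger algebra_simps)

lemma dzbar_wirtinger: "has_wirtinger f a b z \<Longrightarrow> dzbar f z = b"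
  by (simp add: dzbar_def frechet_derivative_wirtinger algebra_simps)

lemma has_wirtinger_dz_dzbar:
  assumes "f differentiable (at z)"
  shows "has_wirtinger f (dz f z) (dzbar f z) z"
proof -
  define D where "D = frechet_derivative f (at z)"
  have D: "(f has_derivative D) (at z)"
    using assms unfolding D_def frechet_derivative_works .
  then interpret bounded_linear D by (rule has_derivative_bounded_linear)
  have "D h = dz f z * h + dzbar f z * cnj h" for h
  proof -
    have "D h = D (Re h *\<^sub>R 1 + Im h *\<^sub>R \<i>)"
      by (rule arg_cong[of _ _ D]) (simp add: complex_eq_iff)
    also have "\<dots> = Re h *\<^sub>R D 1 + Im h *\<^sub>R D \<i>" by (simp add: add scaleR)
    also have "\<dots> = dz f z * h + dzbar f z * cnj h"
      unfolding dz_def dzbar_def D_def[symmetric]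
      by (simp add: complex_eq_iff field_simps)
    finally show ?thesis .
  qed
  then have "D = (\<lambda>h. dz f z * h + dzbar f z * cnj h)" by (rule ext)
  with D show ?thesis unfolding has_wirtinger_def by simp
qed

lemma has_wirtinger_imp_differentiable: "has_wirtinger f a b z \<Longrightarrow> f differentiable (at z)"
  unfolding has_wirtinger_def differentiable_def by blast

lemma has_wirtinger_imp_isCont: "has_wirtinger f a b z \<Longrightarrow> isCont f z"
  unfolding has_wirtinger_def by (rule has_derivative_continuous)

lemma has_wirtinger_const: "has_wirtinger (\<lambda>_. c) 0 0 z"
  unfolding has_wirtinger_def by simp

lemma has_wirtinger_add:
  "has_wirtinger f a b z \<Longrightarrow> has_wirtinger g c d z \<Longrightarrow> has_wirtinger (\<lambda>z. f z + g z) (a + c) (b + d) z"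
  unfolding has_wirtinger_def
  by (drule (1) has_derivative_add) (simp add: algebra_simps)

lemma has_wirtinger_mult:
  "has_wirtinger f a b z \<Longrightarrow> has_wirtinger g c d z \<Longrightarrow>
   has_wirtinger (\<lambda>z. f z * g z) (a * g z + f z * c) (b * g z + f z * d) z"
  unfolding has_wirtinger_def
  by (drule (1) has_derivative_mult) (simp add: algebra_simps)

lemma has_wirtinger_cnj:
  "has_wirtinger f a b z \<Longrightarrow> has_wirtinger (\<lambda>z. cnj (f z)) (cnj b) (cnj a) z"
  unfolding has_wirtinger_def
  by (drule has_derivative_cnj) (simp add: algebra_simps)

lemma has_wirtinger_field_derivative:
  "(f has_field_derivative a) (at z) \<Longrightarrow> has_wirtinger f a 0 z"
  unfolding has_wirtinger_def has_field_derivative_def by simp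

lemma has_wirtinger_affine:
  assumes "has_wirtinger f a b (\<alpha> * z + \<beta>)"
  shows "has_wirtinger (\<lambda>z. f (\<alpha> * z + \<beta>)) (\<alpha> * a) (cnj \<alpha> * b) z"
proof -
  have "((\<lambda>z. \<alpha> * z + \<beta>) has_derivative (\<lambda>h. \<alpha> * h)) (at z)"
    by (auto intro!: derivative_eq_intros)
  from has_derivative_compose[OF this assms[unfolded has_wirtinger_def]]
  show ?thesis unfolding has_wirtinger_def by (simp add: mult_ac)
qed

lemma has_wirtinger_transform:
  assumes "has_wirtinger f a b z" "open S" "z \<in> S" "\<And>w. w \<in> S \<Longrightarrow> f w = g w"
  shows "has_wirtinger g a b z"
  using assms unfolding has_wirtinger_def
  by (meson has_derivative_transform_within_open)

text \<open>Closure under complex-linear combinations is what allows the recursion of \<open>C_class\<close> to run through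
  \<open>dz\<close> and \<open>dzbar\<close> instead of the two real partial derivatives.\<close>

lemma C_class_linear:
  "C_class n f \<Longrightarrow> C_class n g \<Longrightarrow> C_class n (\<lambda>z. c * f z + d * g z)"
proof (induction n arbitrary: f g)
  case 0
  then show ?case by (auto intro!: continuous_intros)
next
  case (Suc n)
  have 1: "has_wirtinger (\<lambda>z. c * f z + d * g z) (c * dz f z + d * dz g z) (c * dzbar f z + d * dzbar g z) z" for z
  proof -
    have "has_wirtinger f (dz f z) (dzbar f z) z" "has_wirtinger g (dz g z) (dzbar g z) z"
      using Suc.prems by (auto intro: has_wirtinger_dz_dzbar)
    from this[THEN has_wirtinger_mult[OF has_wirtinger_const]]
    show ?thesis using has_wirtinger_add by fastforce
  qed
  have 2: "frechet_derivative (\<lambda>z. c * f z + d * g z) (at z) h =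
     c * frechet_derivative f (at z) h + d * frechet_derivative g (at z) h" for z h
  proof -
    have "has_wirtinger f (dz f z) (dzbar f z) z" "has_wirtinger g (dz g z) (dzbar g z) z"
      using Suc.prems by (auto intro: has_wirtinger_dz_dzbar)
    then show ?thesis
      by (simp add: frechet_derivative_wirtinger[OF 1] frechet_derivative_wirtinger algebra_simps)
  qed
  show ?case using 1 Suc.prems Suc.IH by (auto simp: 2 intro: has_wirtinger_imp_differentiable)
qed

lemma C_class_add: "C_class n f \<Longrightarrow> C_class n g \<Longrightarrow> C_class n (\<lambda>z. f z + g z)"
  using C_class_linear[of n f g 1 1] by simp

lemma C_class_cmult: "C_class n f \<Longrightarrow> C_class n (\<lambda>z. c * f z)"
  using C_class_linear[of n f f c 0] by simp

lemma C_class_SucI: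
  assumes "\<And>z. has_wirtinger f (a z) (b z) z" "C_class n a" "C_class n b"
  shows "C_class (Suc n) f"
proof -
  have "(\<lambda>z. frechet_derivative f (at z) 1) = (\<lambda>z. 1 * a z + 1 * b z)"
    "(\<lambda>z. frechet_derivative f (at z) \<i>) = (\<lambda>z. \<i> * a z + (- \<i>) * b z)"
    by (auto simp: frechet_derivative_wirtinger[OF assms(1)])
  then show ?thesis
    using assms C_class_linear[OF assms(2,3), of 1 1] C_class_linear[OF assms(2,3), of \<i> "- \<i>"]
    by (auto intro: has_wirtinger_imp_differentiable)
qed

lemma C_class_Suc_dz: "C_class (Suc n) f \<Longrightarrow> C_class n (dz f)"
  unfolding dz_def [abs_def]
  using C_class_linear[of n "\<lambda>z. frechet_derivative f (at z) 1" "\<lambda>z. frechet_derivative f (at z) \<i>" "1/2" "-\<i>/2"]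
  by (simp add: field_simps)

lemma C_class_Suc_dzbar: "C_class (Suc n) f \<Longrightarrow> C_class n (dzbar f)"
  unfolding dzbar_def [abs_def]
  using C_class_linear[of n "\<lambda>z. frechet_derivative f (at z) 1" "\<lambda>z. frechet_derivative f (at z) \<i>" "1/2" "\<i>/2"]
  by (simp add: field_simps)

lemma C_class_Suc_wirtinger: "C_class (Suc n) f \<Longrightarrow> has_wirtinger f (dz f z) (dzbar f z) z"
  by (auto intro: has_wirtinger_dz_dzbar)

lemma C_class_Suc_imp: "C_class (Suc n) f \<Longrightarrow> C_class n f"
proof (induction n arbitrary: f)
  case 0
  then have "isCont f z" for z
    using C_class_Suc_wirtinger has_wirtinger_imp_isCont by blast
  then show ?case by (simp add: continuous_at_imp_continuous_on)
next
  case (Suc n)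
  show ?case
    by (rule C_class_SucI[OF C_class_Suc_wirtinger[OF Suc.prems] Suc.IH Suc.IH])
       (use C_class_Suc_dz[OF Suc.prems] C_class_Suc_dzbar[OF Suc.prems] in auto)
qed

lemma C_class_mult: "C_class n f \<Longrightarrow> C_class n g \<Longrightarrow> C_class n (\<lambda>z. f z * g z)"
proof (induction n arbitrary: f g)
  case 0
  then show ?case by (auto intro!: continuous_intros)
next
  case (Suc n)
  note f = C_class_Suc_imp[OF Suc.prems(1)] C_class_Suc_dz[OF Suc.prems(1)] C_class_Suc_dzbar[OF Suc.prems(1)]
  note g = C_class_Suc_imp[OF Suc.prems(2)] C_class_Suc_dz[OF Suc.prems(2)] C_class_Suc_dzbar[OF Suc.prems(2)]
  show ?case
    by (rule C_class_SucI[OF has_wirtinger_mult[OF C_class_Suc_wirtinger[OF Suc.prems(1)] C_class_Suc_wirtinger[OF Suc.prems(2)]]])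
       (intro C_class_add Suc.IH f g)+
qed

lemma C_class_cnj: "C_class n f \<Longrightarrow> C_class n (\<lambda>z. cnj (f z))"
proof (induction n arbitrary: f)
  case 0
  then show ?case by (auto intro!: continuous_intros)
next
  case (Suc n)
  show ?case
    by (rule C_class_SucI[OF has_wirtinger_cnj[OF C_class_Suc_wirtinger[OF Suc.prems]]])
       (intro Suc.IH C_class_Suc_dz[OF Suc.prems] C_class_Suc_dzbar[OF Suc.prems])+
qed

lemma C_class_affine: "C_class n f \<Longrightarrow> C_class n (\<lambda>z. f (\<alpha> * z + \<beta>))"
proof (induction n arbitrary: f)
  case 0
  then show ?case by (auto intro!: continuous_intros elim: continuous_on_compose2)
next
  case (Suc n)
  show ?case
    by (rule C_class_SucI[OF has_wirtinger_affine[OF C_class_Suc_wirtinger[OF Suc.prems]]])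
       (intro Suc.IH C_class_Suc_dz[OF Suc.prems] C_class_Suc_dzbar[OF Suc.prems] C_class_cmult)+
qed

lemma C_class_const: "C_class n (\<lambda>_. c)"
proof (induction n arbitrary: c)
  case (Suc n)
  show ?case by (rule C_class_SucI[OF has_wirtinger_const]) (rule Suc)+
qed auto

lemma C_class_id: "C_class n (\<lambda>z. z)"
proof (cases n)
  case (Suc m)
  have "has_wirtinger (\<lambda>z. z) 1 0 z" for z by (simp add: has_wirtinger_def)
  then show ?thesis unfolding Suc by (rule C_class_SucI) (rule C_class_const)+
qed (auto intro: continuous_intros)

definition smooth :: "(complex \<Rightarrow> complex) \<Rightarrow> bool" where
  "smooth f \<longleftrightarrow> (\<forall>n. C_class n f)"

lemma smooth_intros:
  shows smooth_const: "smooth (\<lambda>_. c)"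
    and smooth_id: "smooth (\<lambda>z. z)"
    and smooth_add: "smooth f \<Longrightarrow> smooth g \<Longrightarrow> smooth (\<lambda>z. f z + g z)"
    and smooth_mult: "smooth f \<Longrightarrow> smooth g \<Longrightarrow> smooth (\<lambda>z. f z * g z)"
    and smooth_cnj: "smooth f \<Longrightarrow> smooth (\<lambda>z. cnj (f z))"
    and smooth_affine: "smooth f \<Longrightarrow> smooth (\<lambda>z. f (\<alpha> * z + \<beta>))"
    and smooth_dz: "smooth f \<Longrightarrow> smooth (dz f)"
    and smooth_dzbar: "smooth f \<Longrightarrow> smooth (dzbar f)"
  by (auto simp: smooth_def simp del: C_class.simps intro: C_class_const C_class_id C_class_add C_class_mult C_class_cnj
        C_class_affine C_class_Suc_dz C_class_Suc_dzbar)

lemma smooth_wirtinger: "smooth f \<Longrightarrow> has_wirtinger f (dz f z) (dzbar f z) z"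
  unfolding smooth_def using C_class_Suc_wirtinger by blast

lemma smooth_continuous: "smooth f \<Longrightarrow> continuous_on UNIV f"
  unfolding smooth_def by (metis C_class.simps(1))

section \<open>A smooth mollifier\<close>

text \<open>Up to linear combinations, the functions \<open>exp (- 1 / t) / t ^ m\<close> are closed under differentiation.
  Their smoothness can therefore be proved for all \<open>m\<close> at once, by induction on the order.\<close>

definition flat_exp :: "nat \<Rightarrow> real \<Rightarrow> real" where
  "flat_exp m t = (if t > 0 then exp (- 1 / t) / t ^ m else 0)"

lemma flat_exp_bound:
  assumes "t > 0"
  shows "flat_exp m t \<le> real (m + 2) ^ (m + 2) * t\<^sup>2"
proof -
  define n where "n = m + 2"
  have n: "n > 0" by (simp add: n_def)
  have "(1 / t / n) ^ n \<le> (1 + 1 / t / n) ^ n"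
    using assms by (intro power_mono) auto
  also have "\<dots> \<le> exp (1 / t)"
    by (rule exp_ge_one_plus_x_over_n_power_n) (use assms n in \<open>auto simp: less_imp_le order.trans[of _ 0]\<close>)
  finally have "1 / exp (1 / t) \<le> 1 / (1 / t / n) ^ n"
    using assms n by (intro divide_left_mono) auto
  then have "exp (- 1 / t) \<le> (real n * t) ^ n"
    by (simp add: exp_minus field_simps)
  then have "exp (- 1 / t) / t ^ m \<le> (real n * t) ^ n / t ^ m"
    using assms by (intro divide_right_mono) auto
  also have "\<dots> = real n ^ n * t\<^sup>2"
    using assms by (simp add: n_def power_mult_distrib power_add power2_eq_square)
  finally show ?thesis using assms by (simp add: flat_exp_def n_def)
qed

lemma flat_exp_nonneg: "flat_exp m t \<ge> 0"
  by (simp add: flat_exp_def)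

text \<open>At \<open>t = 0\<close> the derivative exists because the function is \<open>O(t\<^sup>2)\<close> by \<open>flat_exp_bound\<close>.\<close>

lemma DERIV_flat_exp:
  "(flat_exp m has_real_derivative (flat_exp (m + 2) t - real m * flat_exp (m + 1) t)) (at t)"
proof -
  consider "t > 0" | "t < 0" | "t = 0" by linarith
  then show ?thesis
  proof cases
    case 1
    have "((\<lambda>t. exp (- 1 / t) / t ^ m) has_real_derivative
        (exp (- 1 / t) * (1 / t\<^sup>2) * t ^ m - exp (- 1 / t) * (real m * t ^ (m - 1))) / (t ^ m * t ^ m)) (at t)"
      using 1 by (auto intro!: derivative_eq_intros simp: power2_eq_square field_simps)
    also have "(exp (- 1 / t) * (1 / t\<^sup>2) * t ^ m - exp (- 1 / t) * (real m * t ^ (m - 1))) / (t ^ m * t ^ m)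
      = flat_exp (m + 2) t - real m * flat_exp (m + 1) t"
      using 1 by (cases m) (simp_all add: flat_exp_def field_simps power2_eq_square)
    finally show ?thesis
      by (rule has_field_derivative_transform_within_open[where S = "{0<..}"])
         (use 1 in \<open>auto simp: flat_exp_def\<close>)
  next
    case 2
    have "((\<lambda>_. 0) has_real_derivative 0) (at t)" by simp
    then have "(flat_exp m has_real_derivative 0) (at t)"
      by (rule has_field_derivative_transform_within_open[where S = "{..<0}"])
         (use 2 in \<open>auto simp: flat_exp_def\<close>)
    then show ?thesis using 2 by (simp add: flat_exp_def)
  next
    case 3
    have "((\<lambda>h. (flat_exp m (0 + h) - flat_exp m 0) / h) \<longlongrightarrow> 0) (at 0)"
    proof (rule Lim_null_comparison)
      show "\<forall>\<^sub>F h in at 0. norm ((flat_exp m (0 + h) - flat_exp m 0) / h) \<le> real (m + 2) ^ (m + 2) * \<bar>h\<bar>"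
      proof (rule always_eventually, rule allI)
        fix h :: real
        show "norm ((flat_exp m (0 + h) - flat_exp m 0) / h) \<le> real (m + 2) ^ (m + 2) * \<bar>h\<bar>"
        proof (cases "h > 0")
          case True
          with flat_exp_bound[OF this, of m] flat_exp_nonneg[of m h] show ?thesis
            by (simp add: flat_exp_def[of _ 0] divide_le_eq power2_eq_square mult.assoc)
        next
          case False
          then have "flat_exp m (0 + h) - flat_exp m 0 = 0" by (simp add: flat_exp_def)
          then show ?thesis
            by (simp only: div_0 norm_zero)
               (intro mult_nonneg_nonneg zero_le_power abs_ge_zero of_nat_0_le_iff)
        qed
      qed
      show "((\<lambda>h. real (m + 2) ^ (m + 2) * \<bar>h\<bar>) \<longlongrightarrow> 0) (at 0)"
        by (auto intro!: tendsto_eq_intros)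
    qed
    then show ?thesis using 3 by (simp add: DERIV_def flat_exp_def[of _ 0])
  qed
qed

lemma has_wirtinger_radial:
  assumes "(g has_real_derivative d) (at (c - (norm z)\<^sup>2))"
  shows "has_wirtinger (\<lambda>z. of_real (g (c - (norm z)\<^sup>2))) (- of_real d * cnj z) (- of_real d * z) z"
proof -
  have 1: "((\<lambda>z. c - (norm z)\<^sup>2) has_derivative (\<lambda>h. - 2 * (z \<bullet> h))) (at z)"
    unfolding power2_norm_eq_inner
    by (auto intro!: derivative_eq_intros simp: inner_commute)
  from has_derivative_compose[OF this assms[unfolded has_field_derivative_def]]
  have "((\<lambda>z. complex_of_real (g (c - (norm z)\<^sup>2))) has_derivative (\<lambda>h. of_real (d * (- 2 * (z \<bullet> h))))) (at z)"
    by (rule has_derivative_of_real)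
  moreover have "complex_of_real (d * (- 2 * (z \<bullet> h))) = (- of_real d * cnj z) * h + (- of_real d * z) * cnj h" for h
    by (simp add: complex_eq_iff inner_complex_def algebra_simps)
  ultimately show ?thesis unfolding has_wirtinger_def by simp
qed

lemma C_class_radial_flat_exp: "C_class n (\<lambda>z. of_real (flat_exp m (c - (norm z)\<^sup>2)))"
proof (induction n arbitrary: m)
  case 0
  have "isCont (\<lambda>z. complex_of_real (flat_exp m (c - (norm z)\<^sup>2))) z" for z :: complex
    using has_wirtinger_radial[OF DERIV_flat_exp] by (rule has_wirtinger_imp_isCont)
  then show ?case unfolding C_class.simps by (intro continuous_at_imp_continuous_on) blast
next
  case (Suc n)
  have *: "C_class n (\<lambda>z. - complex_of_real (flat_exp (m + 2) (c - (norm z)\<^sup>2)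
      - real m * flat_exp (m + 1) (c - (norm z)\<^sup>2)))"
    using C_class_linear[OF Suc[of "m+2"] Suc[of "m+1"], of "-1" "of_nat m"]
    by (simp add: algebra_simps)
  show ?case
    by (rule C_class_SucI[OF has_wirtinger_radial[OF DERIV_flat_exp]])
       (intro C_class_mult * C_class_cnj C_class_id)+
qed

definition bump :: "real \<Rightarrow> complex \<Rightarrow> real" where
  "bump \<epsilon> z = flat_exp 0 (\<epsilon>\<^sup>2 - (norm z)\<^sup>2)"

lemma bump_pos: "norm z < \<epsilon> \<Longrightarrow> bump \<epsilon> z > 0"
  unfolding bump_def flat_exp_def by (simp add: power_strict_mono)

lemma bump_zero: "0 \<le> \<epsilon> \<Longrightarrow> \<epsilon> \<le> norm z \<Longrightarrow> bump \<epsilon> z = 0"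
  unfolding bump_def flat_exp_def by (auto dest: power_mono[of \<epsilon> "norm z" 2])

lemma smooth_bump: "smooth (\<lambda>z. of_real (bump \<epsilon> z))"
  unfolding smooth_def bump_def by (simp only: C_class_radial_flat_exp simp_thms)

lemma continuous_bump: "continuous_on A (bump \<epsilon>)"
proof -
  have "continuous_on A (\<lambda>z. Re (of_real (bump \<epsilon> z)))"
    by (intro continuous_intros continuous_on_subset[OF smooth_continuous[OF smooth_bump]]) auto
  then show ?thesis by simp
qed

lemma borel_measurable_lebesgue_continuous:
  fixes f :: "complex \<Rightarrow> 'b::euclidean_space"
  assumes "continuous_on UNIV f" shows "f \<in> borel_measurable lebesgue"
  using assms by (simp add: borel_measurable_continuous_onI measurable_completion)

lemma integrable_continuous_compact_support:
  fixes f :: "complex \<Rightarrow> 'b::euclidean_space"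
  assumes "continuous_on UNIV f" "\<And>z. norm z > R \<Longrightarrow> f z = 0"
  shows "integrable lborel f" "integrable lebesgue f"
proof -
  have "integrable lborel (\<lambda>x. indicator (cball 0 R) x *\<^sub>R f x)"
    by (rule borel_integrable_compact) (auto intro: continuous_on_subset assms)
  also have "(\<lambda>x. indicator (cball 0 R) x *\<^sub>R f x) = f"
    using assms(2) by (auto simp: fun_eq_iff indicator_def not_le)
  finally show "integrable lborel f" .
  then show "integrable lebesgue f"
    using assms(1) by (simp add: integrable_completion borel_measurable_continuous_onI)
qed

lemma integral_bump_pos:
  assumes "\<epsilon> > 0" shows "integral\<^sup>L lborel (bump \<epsilon>) > 0"
proof -
  have i: "integrable lborel (bump \<epsilon>)"
    by (rule integrable_continuous_compact_support[where R = \<epsilon>]) (use assms in \<open>auto intro: continuous_bump bump_zero\<close>)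
  have nn: "bump \<epsilon> z \<ge> 0" for z by (simp add: bump_def flat_exp_nonneg)
  have "integral\<^sup>L lborel (bump \<epsilon>) \<noteq> 0"
  proof
    assume "integral\<^sup>L lborel (bump \<epsilon>) = 0"
    then have "AE z in lborel. bump \<epsilon> z = 0"
      using integral_nonneg_eq_0_iff_AE[OF i] nn by simp
    then have "AE z in lborel. z \<notin> ball (0::complex) \<epsilon>"
      by eventually_elim (use bump_pos in \<open>force simp: dist_norm\<close>)
    then have "emeasure lborel (ball (0::complex) \<epsilon>) = 0"
      by (subst (asm) AE_iff_measurable[where N = "ball 0 \<epsilon>"]) auto
    then have "measure lebesgue (ball (0::complex) \<epsilon>) = 0"
      by (simp add: measure_def)
    then show False using assms content_ball_gt_0_iff[of "0::complex" \<epsilon>] by simp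
  qed
  moreover have "integral\<^sup>L lborel (bump \<epsilon>) \<ge> 0" using nn by simp
  ultimately show ?thesis by linarith
qed

definition mollifier :: "real \<Rightarrow> complex \<Rightarrow> real" where
  "mollifier \<epsilon> z = bump \<epsilon> z / integral\<^sup>L lborel (bump \<epsilon>)"

lemma continuous_mollifier: "continuous_on A (mollifier \<epsilon>)"
  unfolding mollifier_def[abs_def] divide_inverse by (intro continuous_intros continuous_bump)

lemma mollifier_nonneg: "\<epsilon> > 0 \<Longrightarrow> mollifier \<epsilon> z \<ge> 0"
  using integral_bump_pos[of \<epsilon>] by (simp add: mollifier_def bump_def flat_exp_nonneg)

lemma mollifier_zero: "0 < \<epsilon> \<Longrightarrow> \<epsilon> \<le> norm z \<Longrightarrow> mollifier \<epsilon> z = 0"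
  by (simp add: mollifier_def bump_zero)

lemma mollifier_minus: "mollifier \<epsilon> (x - y) = mollifier \<epsilon> (y - x)"
  by (simp add: mollifier_def bump_def norm_minus_commute)

lemma integrable_mollifier: "\<epsilon> > 0 \<Longrightarrow> integrable lborel (mollifier \<epsilon>)"
  by (rule integrable_continuous_compact_support[where R = \<epsilon>])
     (auto intro: continuous_mollifier mollifier_zero)

lemma integral_mollifier: "\<epsilon> > 0 \<Longrightarrow> integral\<^sup>L lborel (mollifier \<epsilon>) = 1"
  unfolding mollifier_def using integral_bump_pos[of \<epsilon>] by simp

lemma smooth_mollifier: "smooth (\<lambda>z. of_real (mollifier \<epsilon> z))"
  using smooth_mult[OF smooth_const smooth_bump, of "of_real (inverse (integral\<^sup>L lborel (bump \<epsilon>)))" \<epsilon>]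
  by (simp add: mollifier_def field_simps)

text \<open>The energy identity below needs the symmetry of second derivatives only for mollifications, and
  there it reduces to the mollifier, for which both mixed derivatives are explicit.\<close>

lemma dzbar_dz_mollifier:
  "dzbar (dz (\<lambda>z. of_real (mollifier \<epsilon> z))) = dz (dzbar (\<lambda>z. of_real (mollifier \<epsilon> z)))"
proof -
  define I where "I = integral\<^sup>L lborel (bump \<epsilon>)"
  define E where "E m z = complex_of_real (flat_exp m (\<epsilon>\<^sup>2 - (norm z)\<^sup>2))" for m and z :: complex
  have mo: "(\<lambda>z. of_real (mollifier \<epsilon> z)) = (\<lambda>z. of_real (1 / I) * E 0 z)"
    by (simp add: mollifier_def bump_def E_def I_def)
  have w: "has_wirtinger (E m) (- (E (m + 2) z - of_nat m * E (m + 1) z) * cnj z)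
     (- (E (m + 2) z - of_nat m * E (m + 1) z) * z) z" for m z
    using has_wirtinger_radial[OF DERIV_flat_exp, of m "\<epsilon>\<^sup>2" z] by (simp add: E_def[abs_def])
  have 1: "has_wirtinger (\<lambda>z. of_real (1 / I) * E 0 z) (of_real (-1 / I) * (E 2 z * cnj z)) (of_real (-1 / I) * (E 2 z * z)) z" for z
    using has_wirtinger_mult[OF has_wirtinger_const[of "of_real (1/I)"] w[of 0 z]] by (simp add: numeral_2_eq_2)
  have d: "dz (\<lambda>z. of_real (mollifier \<epsilon> z)) = (\<lambda>z. of_real (-1 / I) * (E 2 z * cnj z))"
    "dzbar (\<lambda>z. of_real (mollifier \<epsilon> z)) = (\<lambda>z. of_real (-1 / I) * (E 2 z * z))"
    unfolding mo by (rule ext, rule dz_wirtinger[OF 1], rule ext, rule dzbar_wirtinger[OF 1])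
  have z: "has_wirtinger (\<lambda>z. z) 1 0 z" "has_wirtinger cnj 0 1 z" for z
    by (auto simp: has_wirtinger_def intro!: derivative_eq_intros)
  show ?thesis
    unfolding d
    by (rule ext)
       (simp only: dzbar_wirtinger[OF has_wirtinger_mult[OF has_wirtinger_const has_wirtinger_mult[OF w z(2)]]]
        dz_wirtinger[OF has_wirtinger_mult[OF has_wirtinger_const has_wirtinger_mult[OF w z(1)]]], simp add: algebra_simps)
qed

section \<open>Square-integrable functions\<close>

definition square_integrable :: "(complex \<Rightarrow> complex) \<Rightarrow> bool" where
  "square_integrable a \<longleftrightarrow> a \<in> borel_measurable lebesgue \<and> integrable lebesgue (\<lambda>z. (norm (a z))\<^sup>2)"

abbreviation energy :: "(complex \<Rightarrow> complex) \<Rightarrow> real" where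
  "energy a \<equiv> \<integral>z. (norm (a z))\<^sup>2 \<partial>lebesgue"

lemma square_integrable_measurable: "square_integrable a \<Longrightarrow> a \<in> borel_measurable lebesgue"
  by (simp add: square_integrable_def)

lemma square_integrable_le:
  assumes b: "square_integrable b" and a: "a \<in> borel_measurable lebesgue"
    and le: "\<And>z. norm (a z) \<le> C * norm (b z)"
  shows "square_integrable a"
  unfolding square_integrable_def
proof
  have "integrable lebesgue (\<lambda>z. C\<^sup>2 * (norm (b z))\<^sup>2)" using b by (simp add: square_integrable_def)
  then show "integrable lebesgue (\<lambda>z. (norm (a z))\<^sup>2)"
  proof (rule Bochner_Integration.integrable_bound)
    show "(\<lambda>z. (norm (a z))\<^sup>2) \<in> borel_measurable lebesgue" using a by measurable
    show "AE z in lebesgue. norm ((norm (a z))\<^sup>2) \<le> norm (C\<^sup>2 * (norm (b z))\<^sup>2)"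
      using power_mono[OF le norm_ge_zero, where n = 2] by (auto simp: power_mult_distrib intro!: AE_I2)
  qed
qed (rule a)

lemma norm_add_square_le: "(norm (x + y :: complex))\<^sup>2 \<le> 2 * (norm x)\<^sup>2 + 2 * (norm y)\<^sup>2"
proof -
  have "(norm (x + y))\<^sup>2 \<le> (norm x + norm y)\<^sup>2" by (intro power_mono norm_triangle_ineq) auto
  also have "\<dots> \<le> 2 * (norm x)\<^sup>2 + 2 * (norm y)\<^sup>2"
    using zero_le_power2[of "norm x - norm y"] by (simp add: power2_sum power2_diff)
  finally show ?thesis .
qed

lemma square_integrable_add:
  assumes "square_integrable a" "square_integrable b"
  shows "square_integrable (\<lambda>z. a z + b z)"
  unfolding square_integrable_def
proof
  note m = assms[unfolded square_integrable_def]
  show 1: "(\<lambda>z. a z + b z) \<in> borel_measurable lebesgue" using m by (intro borel_measurable_add) auto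
  show "integrable lebesgue (\<lambda>z. (norm (a z + b z))\<^sup>2)"
  proof (rule Bochner_Integration.integrable_bound)
    show "integrable lebesgue (\<lambda>z. 2 * (norm (a z))\<^sup>2 + 2 * (norm (b z))\<^sup>2)" using m by simp
    show "(\<lambda>z. (norm (a z + b z))\<^sup>2) \<in> borel_measurable lebesgue" using 1 by measurable
  qed (use norm_add_square_le in auto)
qed

lemma square_integrable_diff:
  assumes "square_integrable a" "square_integrable b"
  shows "square_integrable (\<lambda>z. a z - b z)"
proof -
  have "square_integrable (\<lambda>z. - b z)"
    by (rule square_integrable_le[OF assms(2), of _ 1]) (use assms in \<open>auto simp: square_integrable_def\<close>)
  from square_integrable_add[OF assms(1) this] show ?thesis by simp
qed

lemma square_integrable_indicator:
  assumes "square_integrable a" "A \<in> sets lebesgue"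
  shows "square_integrable (\<lambda>z. indicator A z *\<^sub>R a z)"
  by (rule square_integrable_le[OF assms(1), of _ 1])
     (use borel_measurable_scaleR[OF borel_measurable_indicator[OF assms(2)]] assms(1)
        in \<open>auto simp: square_integrable_def indicator_def\<close>)

lemma square_integrable_bounded_mult:
  assumes "square_integrable a" "continuous_on UNIV \<psi>" "\<And>z. norm (\<psi> z) \<le> C"
  shows "square_integrable (\<lambda>z. \<psi> z * a z)"
proof (rule square_integrable_le[OF assms(1)])
  show "(\<lambda>z. \<psi> z * a z) \<in> borel_measurable lebesgue"
    by (intro borel_measurable_times borel_measurable_lebesgue_continuous assms square_integrable_measurable)
  show "norm (\<psi> z * a z) \<le> C * norm (a z)" for z
    using assms(3) by (simp add: norm_mult mult_right_mono)
qed

lemma square_integrable_cong_AE: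
  assumes a: "square_integrable a" and ae: "AE z in lebesgue. a z = b z"
  shows "square_integrable b"
  unfolding square_integrable_def
proof
  show m: "b \<in> borel_measurable lebesgue"
    by (rule borel_measurable_AE[OF square_integrable_measurable[OF a] ae])
  have "integrable lebesgue (\<lambda>z. (norm (a z))\<^sup>2)" using a by (simp add: square_integrable_def)
  then show "integrable lebesgue (\<lambda>z. (norm (b z))\<^sup>2)"
  proof (rule integrable_cong_AE_imp)
    show "(\<lambda>z. (norm (b z))\<^sup>2) \<in> borel_measurable lebesgue" using m by measurable
    show "AE z in lebesgue. (norm (a z))\<^sup>2 = (norm (b z))\<^sup>2" using ae by eventually_elim simp
  qed
qed

lemma indicator_compact_continuous:
  fixes f :: "complex \<Rightarrow> 'b::euclidean_space"
  assumes K: "compact K" and f: "continuous_on K f"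
  shows "integrable lebesgue (\<lambda>z. indicator K z *\<^sub>R f z)"
    and "(\<lambda>z. indicator K z *\<^sub>R f z) \<in> borel_measurable lebesgue"
proof -
  have "integrable lborel (\<lambda>z. indicator K z *\<^sub>R f z)" by (intro borel_integrable_compact K f)
  then show i: "integrable lebesgue (\<lambda>z. indicator K z *\<^sub>R f z)"
    by (subst integrable_completion) (use borel_measurable_integrable in auto)
  then show "(\<lambda>z. indicator K z *\<^sub>R f z) \<in> borel_measurable lebesgue" by (rule borel_measurable_integrable)
qed

lemma square_integrable_indicator_continuous:
  assumes "compact K" "continuous_on K f"
  shows "square_integrable (\<lambda>z. indicator K z *\<^sub>R f z)"
proof -
  have "(norm (indicator K z *\<^sub>R f z))\<^sup>2 = indicator K z *\<^sub>R (norm (f z))\<^sup>2" for z by (simp add: indicator_def)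
  then show ?thesis
    using indicator_compact_continuous[OF assms] indicator_compact_continuous(1)[OF assms(1), of "\<lambda>z. (norm (f z))\<^sup>2"] assms(2)
    by (simp add: square_integrable_def continuous_intros)
qed

lemma square_integrable_continuous:
  assumes "continuous_on UNIV c" "\<And>z. norm z > R \<Longrightarrow> c z = 0"
  shows "square_integrable c"
proof -
  have "(\<lambda>z. indicator (cball 0 R) z *\<^sub>R c z) = c" using assms(2) by (auto simp: fun_eq_iff indicator_def not_le)
  then show ?thesis
    using square_integrable_indicator_continuous[OF compact_cball continuous_on_subset[OF assms(1)], of 0 R] by simp
qed

text \<open>The best choice is \<open>t = sqrt X / sqrt A\<close>. Enlarging both numbers by \<open>d > 0\<close> avoids the cases in
  which one of them vanishes.\<close>

lemma le_sqrt_mult_sqrt: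
  fixes y A X :: real
  assumes "A \<ge> 0" "X \<ge> 0" and le: "\<And>t. t > 0 \<Longrightarrow> y \<le> t / 2 * A + 1 / (2 * t) * X"
  shows "y \<le> sqrt A * sqrt X"
proof (rule tendsto_lowerbound)
  show "((\<lambda>d. sqrt (A + d) * sqrt (X + d)) \<longlongrightarrow> sqrt A * sqrt X) (at_right 0)"
    by (auto intro!: tendsto_eq_intros)
  show "\<forall>\<^sub>F d in at_right 0. y \<le> sqrt (A + d) * sqrt (X + d)"
    using eventually_at_right_less[of "0::real"]
  proof eventually_elim
    case (elim d)
    define a x where "a = sqrt (A + d)" and "x = sqrt (X + d)"
    have ax: "a > 0" "x > 0" "A + d = a * a" "X + d = x * x" using elim assms by (auto simp: a_def x_def)
    have "y \<le> (x / a) / 2 * A + 1 / (2 * (x / a)) * X" using ax by (intro le) auto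
    also have "\<dots> \<le> (x / a) / 2 * (A + d) + 1 / (2 * (x / a)) * (X + d)"
      using ax elim by (intro add_mono mult_left_mono) auto
    also have "\<dots> = a * x" using ax(1,2) unfolding ax(3,4) by (simp add: field_simps)
    finally show ?case by (simp add: a_def x_def)
  qed
qed simp

lemma young_inequality:
  fixes x y t :: real
  assumes "t > 0" shows "x * y \<le> t / 2 * x\<^sup>2 + 1 / (2 * t) * y\<^sup>2"
proof -
  have "0 \<le> (t * x - y)\<^sup>2 / (2 * t)" using assms by simp
  then show ?thesis using assms by (simp add: power2_diff power_mult_distrib field_simps power2_eq_square)
qed

lemma cauchy_schwarz_L2:
  assumes a: "square_integrable a" and b: "square_integrable b"
  shows "integrable lebesgue (\<lambda>z. a z * b z)"
    and "(\<integral>z. norm (a z) * norm (b z) \<partial>lebesgue) \<le> sqrt (energy a) * sqrt (energy b)"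
    and "norm (\<integral>z. a z * b z \<partial>lebesgue) \<le> sqrt (energy a) * sqrt (energy b)"
proof -
  have i: "integrable lebesgue (\<lambda>z. t / 2 * (norm (a z))\<^sup>2 + 1 / (2 * t) * (norm (b z))\<^sup>2)" for t
    using a b by (simp add: square_integrable_def)
  show 1: "integrable lebesgue (\<lambda>z. a z * b z)"
  proof (rule Bochner_Integration.integrable_bound[OF i[of 1]])
    show "(\<lambda>z. a z * b z) \<in> borel_measurable lebesgue"
      by (intro borel_measurable_times square_integrable_measurable a b)
    show "AE z in lebesgue. norm (a z * b z) \<le> norm (1 / 2 * (norm (a z))\<^sup>2 + 1 / (2 * 1) * (norm (b z))\<^sup>2)"
      using young_inequality[of 1 "norm (a z)" "norm (b z)" for z] by (intro AE_I2) (simp add: norm_mult)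
  qed
  show 2: "(\<integral>z. norm (a z) * norm (b z) \<partial>lebesgue) \<le> sqrt (energy a) * sqrt (energy b)"
  proof (rule le_sqrt_mult_sqrt)
    fix t :: real assume t: "t > 0"
    have "(\<integral>z. norm (a z) * norm (b z) \<partial>lebesgue) \<le> (\<integral>z. t / 2 * (norm (a z))\<^sup>2 + 1 / (2 * t) * (norm (b z))\<^sup>2 \<partial>lebesgue)"
      by (rule integral_mono[OF _ i young_inequality[OF t]]) (use integrable_norm[OF 1] in \<open>simp add: norm_mult\<close>)
    also have "\<dots> = t / 2 * energy a + 1 / (2 * t) * energy b"
      using a b by (simp add: square_integrable_def)
    finally show "(\<integral>z. norm (a z) * norm (b z) \<partial>lebesgue) \<le> t / 2 * energy a + 1 / (2 * t) * energy b" .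
  qed auto
  show "norm (\<integral>z. a z * b z \<partial>lebesgue) \<le> sqrt (energy a) * sqrt (energy b)"
    by (rule order_trans[OF integral_norm_bound]) (use 2 in \<open>simp add: norm_mult\<close>)
qed

text \<open>A measurable function is almost everywhere the limit of continuous functions \<open>g n\<close>. After a
  truncation \<open>T m\<close> in modulus and in space, dominated convergence applies: first to \<open>T m\<close> of \<open>a\<close> as
  \<open>m\<close> grows, then, for a fixed \<open>m\<close>, to \<open>T m\<close> of \<open>g n\<close>.\<close>

lemma continuous_approx_L2:
  assumes a: "square_integrable a" and e: "e > 0"
  obtains c R where "continuous_on UNIV c" "\<And>z. norm z > R \<Longrightarrow> c z = 0" "energy (\<lambda>z. a z - c z) < e"
proof -
  have am: "a \<in> borel_measurable lebesgue" and ai: "integrable lebesgue (\<lambda>z. (norm (a z))\<^sup>2)"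
    using a by (auto simp: square_integrable_def)
  obtain N g where N: "negligible N" and g: "\<And>n. continuous_on UNIV (g n)"
    and lim: "\<And>x. x \<notin> N \<Longrightarrow> (\<lambda>n. g n x) \<longlonglongrightarrow> a x"
    using lebesgue_measurable_imp_measurable_on[OF am, of UNIV] unfolding measurable_on_def by auto
  have nN: "AE x in lebesgue. x \<notin> N" using N by (simp add: negligible_iff_null_sets AE_not_in)
  \<comment> \<open>Reduces the modulus of \<open>v\<close> to at most \<open>m + 1\<close> and fades out between \<open>\<bar>z\<bar> = m\<close> and \<open>\<bar>z\<bar> = m + 1\<close>.\<close>
  define s where "s m z v = (max 0 (min 1 (real m + 1 - norm z))) / (max 1 (norm v / (real m + 1)))" for m and z v :: complex
  define T where "T m z v = s m z v *\<^sub>R v" for m z v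
  have s01: "0 \<le> s m z v" "s m z v \<le> 1" for m z v by (auto simp: s_def divide_le_eq_1)
  have s0: "s m z v = 0" if "norm z > real m + 1" for m z v using that by (simp add: s_def)
  have Tb: "norm (T m z v) \<le> indicator (cball 0 (real m + 1)) z * (real m + 1)" for m z v
  proof (cases "norm z > real m + 1")
    case False
    have "norm (T m z v) \<le> norm v / max 1 (norm v / (real m + 1))"
      unfolding T_def s_def by (auto simp: divide_right_mono mult_left_le_one_le)
    also have "\<dots> \<le> real m + 1"
    proof (cases "norm v \<le> real m + 1")
      case False
      then have "max 1 (norm v / (real m + 1)) = norm v / (real m + 1)" by (simp add: max_def field_simps)
      moreover have "norm v \<noteq> 0" using False by auto
      ultimately show ?thesis by simp
    qed (simp add: max_def divide_le_eq_1 field_simps)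
    finally show ?thesis using False by (simp add: indicator_def)
  qed (simp add: T_def s0)
  have Tcont: "continuous_on UNIV (\<lambda>z. T m z (h z))" if "continuous_on UNIV h" for m h
    unfolding T_def s_def using that by (auto intro!: continuous_intros)
  have Tlim: "(\<lambda>n. T m x (g n x)) \<longlonglongrightarrow> T m x (a x)" if "x \<notin> N" for m x
    unfolding T_def s_def by (auto intro!: tendsto_intros lim that)
  define aT where "aT m z = T m z (a z)" for m z
  have aTm: "aT m \<in> borel_measurable lebesgue" for m
  proof (rule borel_measurable_AE)
    show "(\<lambda>z. lim (\<lambda>n. T m z (g n z))) \<in> borel_measurable lebesgue"
      by (rule borel_measurable_lim_metric) (intro borel_measurable_lebesgue_continuous Tcont g)
    show "AE x in lebesgue. lim (\<lambda>n. T m x (g n x)) = aT m x"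
      using nN by eventually_elim (use Tlim in \<open>auto simp: aT_def intro: limI\<close>)
  qed
  have "(\<lambda>m. energy (\<lambda>z. a z - aT m z)) \<longlonglongrightarrow> (\<integral>z. (0::real) \<partial>(lebesgue :: complex measure))"
  proof (rule integral_dominated_convergence[OF _ _ ai])
    show "AE x in lebesgue. (\<lambda>m. (norm (a x - aT m x))\<^sup>2) \<longlonglongrightarrow> 0"
    proof (rule AE_I2, rule tendsto_eventually)
      fix x
      obtain M :: nat where M: "real M > norm x + norm (a x)" using reals_Archimedean2 by blast
      show "\<forall>\<^sub>F m in sequentially. (norm (a x - aT m x))\<^sup>2 = 0"
        using eventually_ge_at_top[of M]
      proof eventually_elim
        case (elim m)
        then have "norm x \<le> real m" "norm (a x) \<le> real m + 1"
          using M norm_ge_zero[of x] norm_ge_zero[of "a x"] by linarith+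
        then have "s m x (a x) = 1" by (simp add: s_def max_def min_def field_simps)
        then show ?case by (simp add: aT_def T_def)
      qed
    qed
    show "AE x in lebesgue. norm ((norm (a x - aT m x))\<^sup>2) \<le> (norm (a x))\<^sup>2" for m
    proof (rule AE_I2)
      fix x
      have "a x - aT m x = (1 - s m x (a x)) *\<^sub>R a x" by (simp add: aT_def T_def scaleR_diff_left)
      then have "norm (a x - aT m x) = (1 - s m x (a x)) * norm (a x)" using s01[of m x "a x"] by simp
      also have "\<dots> \<le> norm (a x)" using s01[of m x "a x"] by (intro mult_left_le_one_le) auto
      finally show "norm ((norm (a x - aT m x))\<^sup>2) \<le> (norm (a x))\<^sup>2" by (simp add: power_mono)
    qed
    show "(\<lambda>z. (norm (a z - aT m z))\<^sup>2) \<in> borel_measurable lebesgue" for m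
      using aTm am by measurable
  qed auto
  then have "\<forall>\<^sub>F m in sequentially. energy (\<lambda>z. a z - aT m z) < e / 4"
    using e by (intro order_tendstoD) auto
  then obtain m where m: "energy (\<lambda>z. a z - aT m z) < e / 4"
    using eventually_happens'[OF sequentially_bot] by blast
  define c where "c n z = T m z (g n z)" for n z
  have ccont: "continuous_on UNIV (c n)" for n unfolding c_def by (rule Tcont[OF g])
  have dom: "integrable lebesgue (\<lambda>z::complex. indicator (cball 0 (real m + 1)) z *\<^sub>R (2 * (real m + 1))\<^sup>2)"
    by (rule indicator_compact_continuous) auto
  have "(\<lambda>n. energy (\<lambda>z. aT m z - c n z)) \<longlonglongrightarrow> (\<integral>z. (0::real) \<partial>(lebesgue :: complex measure))"
  proof (rule integral_dominated_convergence[OF _ _ dom])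
    show "AE x in lebesgue. (\<lambda>n. (norm (aT m x - c n x))\<^sup>2) \<longlonglongrightarrow> 0"
      using nN
    proof eventually_elim
      case (elim x)
      have "(\<lambda>n. (norm (aT m x - c n x))\<^sup>2) \<longlonglongrightarrow> (norm (aT m x - aT m x))\<^sup>2"
        unfolding c_def by (intro tendsto_intros) (use Tlim elim in \<open>simp add: aT_def\<close>)
      then show ?case by simp
    qed
    show "AE x in lebesgue. norm ((norm (aT m x - c n x))\<^sup>2) \<le> indicator (cball 0 (real m + 1)) x *\<^sub>R (2 * (real m + 1))\<^sup>2" for n
    proof (rule AE_I2)
      fix x
      have "norm (aT m x - c n x) \<le> indicator (cball 0 (real m + 1)) x * (2 * (real m + 1))"
        using norm_triangle_ineq4[of "aT m x" "c n x"] Tb[of m x "a x"] Tb[of m x "g n x"]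
        by (simp add: aT_def c_def algebra_simps)
      then have "(norm (aT m x - c n x))\<^sup>2 \<le> (indicator (cball 0 (real m + 1)) x * (2 * (real m + 1)))\<^sup>2"
        by (intro power_mono) auto
      then show "norm ((norm (aT m x - c n x))\<^sup>2) \<le> indicator (cball 0 (real m + 1)) x *\<^sub>R (2 * (real m + 1))\<^sup>2"
        by (cases "x \<in> cball 0 (real m + 1)") (auto simp: indicator_def)
    qed
    show "(\<lambda>z. (norm (aT m z - c n z))\<^sup>2) \<in> borel_measurable lebesgue" for n
      using aTm borel_measurable_lebesgue_continuous[OF ccont] by measurable
  qed auto
  then have "\<forall>\<^sub>F n in sequentially. energy (\<lambda>z. aT m z - c n z) < e / 4"
    using e by (intro order_tendstoD) auto
  then obtain n where n: "energy (\<lambda>z. aT m z - c n z) < e / 4"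
    using eventually_happens'[OF sequentially_bot] by blast
  have off: "c n z = 0" if "norm z > real m + 1" for z using that by (simp add: c_def T_def s0)
  have sc: "square_integrable (c n)" by (rule square_integrable_continuous[OF ccont off])
  have saT: "square_integrable (aT m)"
    by (rule square_integrable_le[OF a aTm, where C = 1]) (use s01 in \<open>simp add: aT_def T_def mult_left_le_one_le\<close>)
  note i = square_integrable_diff[OF a saT] square_integrable_diff[OF saT sc] square_integrable_diff[OF a sc]
  have "energy (\<lambda>z. a z - c n z) \<le> (\<integral>z. 2 * (norm (a z - aT m z))\<^sup>2 + 2 * (norm (aT m z - c n z))\<^sup>2 \<partial>lebesgue)"
  proof (rule integral_mono)
    fix z
    show "(norm (a z - c n z))\<^sup>2 \<le> 2 * (norm (a z - aT m z))\<^sup>2 + 2 * (norm (aT m z - c n z))\<^sup>2"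
      using norm_add_square_le[of "a z - aT m z" "aT m z - c n z"] by simp
  qed (use i in \<open>auto simp: square_integrable_def\<close>)
  also have "\<dots> = 2 * energy (\<lambda>z. a z - aT m z) + 2 * energy (\<lambda>z. aT m z - c n z)"
    using i by (simp add: square_integrable_def)
  also have "\<dots> < e" using m n by linarith
  finally show ?thesis using that[OF ccont off] by blast
qed

section \<open>Local square-integrability\<close>

lemma locally_L2_on_iff:
  "locally_L2_on U a \<longleftrightarrow> (\<lambda>z. indicator U z *\<^sub>R a z) \<in> borel_measurable lebesgue \<and>
     (\<forall>K. compact K \<longrightarrow> K \<subseteq> U \<longrightarrow> square_integrable (\<lambda>z. indicator K z *\<^sub>R a z))"
proof -
  have e: "(\<lambda>z. (norm (indicator K z *\<^sub>R a z))\<^sup>2) = (\<lambda>z. indicator K z *\<^sub>R (norm (a z))\<^sup>2)" for K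
    by (auto simp: fun_eq_iff indicator_def)
  have m: "(\<lambda>z. indicator K z *\<^sub>R a z) \<in> borel_measurable lebesgue"
    if "compact K" "K \<subseteq> U" "(\<lambda>z. indicator U z *\<^sub>R a z) \<in> borel_measurable lebesgue" for K
  proof -
    have "K \<in> sets lebesgue" using that(1) by (simp add: borel_compact)
    from borel_measurable_scaleR[OF borel_measurable_indicator[OF this] that(3)]
    have "(\<lambda>z. indicator K z *\<^sub>R (indicator U z *\<^sub>R a z)) \<in> borel_measurable lebesgue" .
    also have "(\<lambda>z. indicator K z *\<^sub>R (indicator U z *\<^sub>R a z)) = (\<lambda>z. indicator K z *\<^sub>R a z)"
      using that(2) by (auto simp: fun_eq_iff indicator_def)
    finally show ?thesis .
  qed
  show ?thesis
    unfolding locally_L2_on_def set_borel_measurable_def set_integrable_def square_integrable_def e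
    using m by meson
qed

lemma locally_L2D: "locally_L2_on U a \<Longrightarrow> compact K \<Longrightarrow> K \<subseteq> U \<Longrightarrow> square_integrable (\<lambda>z. indicator K z *\<^sub>R a z)"
  by (simp add: locally_L2_on_iff)

lemma locally_L2_on_subset:
  assumes "locally_L2_on U f" "V \<subseteq> U" "V \<in> sets lebesgue"
  shows "locally_L2_on V f"
proof -
  have "(\<lambda>z. indicator U z *\<^sub>R f z) \<in> borel_measurable lebesgue" using assms(1) by (simp add: locally_L2_on_iff)
  from borel_measurable_scaleR[OF borel_measurable_indicator[OF assms(3)] this]
  have "(\<lambda>z. indicator V z *\<^sub>R (indicator U z *\<^sub>R f z)) \<in> borel_measurable lebesgue" .
  also have "(\<lambda>z. indicator V z *\<^sub>R (indicator U z *\<^sub>R f z)) = (\<lambda>z. indicator V z *\<^sub>R f z)"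
    using assms(2) by (auto simp: fun_eq_iff indicator_def)
  finally show ?thesis using assms(1,2) by (auto simp: locally_L2_on_iff)
qed

lemma locally_L2_on_continuous:
  assumes "open U" "continuous_on U f"
  shows "locally_L2_on U f"
  unfolding locally_L2_on_iff
proof (intro conjI allI impI)
  show "(\<lambda>z. indicator U z *\<^sub>R f z) \<in> borel_measurable lebesgue"
    using borel_measurable_continuous_on_indicator[OF _ assms(2)] assms(1) by (auto intro: measurable_completion)
  show "square_integrable (\<lambda>z. indicator K z *\<^sub>R f z)" if "compact K" "K \<subseteq> U" for K
    by (rule square_integrable_indicator_continuous[OF that(1) continuous_on_subset[OF assms(2) that(2)]])
qed

lemma square_integrable_imp_locally_L2: "square_integrable a \<Longrightarrow> locally_L2_on UNIV a"
  by (simp add: locally_L2_on_iff square_integrable_measurable square_integrable_indicator borel_compact)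

lemma locally_L2_on_add:
  "locally_L2_on U a \<Longrightarrow> locally_L2_on U b \<Longrightarrow> locally_L2_on U (\<lambda>z. a z + b z)"
  unfolding locally_L2_on_iff scaleR_add_right by (auto intro: borel_measurable_add square_integrable_add)

lemma locally_L2_on_cong_AE:
  assumes a: "locally_L2_on U a" and ae: "AE z in lebesgue. z \<in> U \<longrightarrow> a z = b z"
  shows "locally_L2_on U b"
  unfolding locally_L2_on_iff
proof (intro conjI allI impI)
  have "AE z in lebesgue. indicator U z *\<^sub>R a z = indicator U z *\<^sub>R b z"
    using ae by eventually_elim (auto simp: indicator_def)
  then show "(\<lambda>z. indicator U z *\<^sub>R b z) \<in> borel_measurable lebesgue"
    by (rule borel_measurable_AE[rotated]) (use a in \<open>simp add: locally_L2_on_iff\<close>)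
  fix K assume K: "compact K" "K \<subseteq> U"
  have "AE z in lebesgue. indicator K z *\<^sub>R a z = indicator K z *\<^sub>R b z"
    using ae by eventually_elim (use K in \<open>auto simp: indicator_def\<close>)
  then show "square_integrable (\<lambda>z. indicator K z *\<^sub>R b z)"
    by (rule square_integrable_cong_AE[OF locally_L2D[OF a K]])
qed

text \<open>The puncture is the pole of the quasiconformal map, near which the function is known to be
  regular for other reasons.\<close>

lemma locally_L2_fill_puncture:
  assumes a: "locally_L2_on (- {q}) a" and V: "locally_L2_on V a" "open V" "q \<in> V"
  shows "locally_L2_on UNIV a"
  unfolding locally_L2_on_iff
proof (intro conjI allI impI)
  have "AE z in lebesgue. z \<noteq> q" using AE_not_in[of "{q}" lebesgue] by simp
  then have "AE z in lebesgue. indicator (- {q}) z *\<^sub>R a z = indicator UNIV z *\<^sub>R a z" by eventually_elim simp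
  then show "(\<lambda>z. indicator UNIV z *\<^sub>R a z) \<in> borel_measurable lebesgue"
    by (rule borel_measurable_AE[rotated]) (use a in \<open>simp only: locally_L2_on_iff\<close>)
  fix K :: "complex set" assume K: "compact K"
  obtain s where s: "s > 0" "cball q s \<subseteq> V" using V open_contains_cball by blast
  have "square_integrable (\<lambda>z. indicator (K \<inter> cball q s) z *\<^sub>R a z)"
    by (rule locally_L2D[OF V(1)]) (use K s in auto)
  moreover have "square_integrable (\<lambda>z. indicator (K - ball q s) z *\<^sub>R a z)"
    by (rule locally_L2D[OF a]) (use K s in \<open>auto simp: compact_diff\<close>)
  then have "square_integrable (\<lambda>z. indicator (- cball q s) z *\<^sub>R (indicator (K - ball q s) z *\<^sub>R a z))"
    by (rule square_integrable_indicator) simp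
  ultimately have "square_integrable (\<lambda>z. indicator (K \<inter> cball q s) z *\<^sub>R a z +
      indicator (- cball q s) z *\<^sub>R (indicator (K - ball q s) z *\<^sub>R a z))"
    by (rule square_integrable_add)
  also have "(\<lambda>z. indicator (K \<inter> cball q s) z *\<^sub>R a z + indicator (- cball q s) z *\<^sub>R (indicator (K - ball q s) z *\<^sub>R a z))
      = (\<lambda>z. indicator K z *\<^sub>R a z)"
    by (auto simp: fun_eq_iff indicator_def)
  finally show "square_integrable (\<lambda>z. indicator K z *\<^sub>R a z)" .
qed

lemma locally_L2_closed_piece:
  assumes C: "closed C" and f: "continuous_on C f"
  shows "locally_L2_on UNIV (\<lambda>z. indicator C z *\<^sub>R f z)"
  unfolding locally_L2_on_iff
proof (intro conjI allI impI)
  have "(\<lambda>z. indicator C z *\<^sub>R f z) \<in> borel_measurable borel"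
    using borel_measurable_continuous_on_indicator[OF _ f] C by simp
  then show "(\<lambda>z. indicator UNIV z *\<^sub>R (indicator C z *\<^sub>R f z)) \<in> borel_measurable lebesgue"
    by (simp add: measurable_completion)
  fix K :: "complex set" assume K: "compact K"
  have "square_integrable (\<lambda>z. indicator (K \<inter> C) z *\<^sub>R f z)"
    by (rule square_integrable_indicator_continuous) (use K C f in \<open>auto simp: compact_Int_closed intro: continuous_on_subset\<close>)
  also have "(\<lambda>z. indicator (K \<inter> C) z *\<^sub>R f z) = (\<lambda>z. indicator K z *\<^sub>R (indicator C z *\<^sub>R f z))"
    by (auto simp: fun_eq_iff indicator_def)
  finally show "square_integrable (\<lambda>z. indicator K z *\<^sub>R (indicator C z *\<^sub>R f z))" .
qed

lemma continuous_compact_support_bounded: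
  fixes f :: "complex \<Rightarrow> 'b::real_normed_vector"
  assumes "continuous_on UNIV f" "\<And>z. norm z > R \<Longrightarrow> f z = 0"
  obtains C where "C > 0" "\<And>z. norm (f z) \<le> C"
proof -
  have "compact (f ` cball 0 R)"
    by (intro compact_continuous_image continuous_on_subset[OF assms(1)]) auto
  then obtain C where C: "C > 0" "\<And>z. z \<in> cball 0 R \<Longrightarrow> norm (f z) \<le> C"
    using compact_imp_bounded bounded_pos by (metis imageI)
  have "norm (f z) \<le> C" for z
    by (cases "norm z \<le> R") (use C assms(2)[of z] in auto)
  with C(1) that show ?thesis by blast
qed

lemma square_integrable_mult_continuous:
  assumes a: "locally_L2_on U a" and K: "compact K" "K \<subseteq> U"
    and \<psi>: "continuous_on UNIV \<psi>" "\<And>z. z \<notin> K \<Longrightarrow> \<psi> z = 0"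
  shows "square_integrable (\<lambda>z. \<psi> z * a z)"
proof -
  obtain R where R: "\<And>z. z \<in> K \<Longrightarrow> norm z \<le> R" using K(1) by (meson bounded_iff compact_imp_bounded)
  obtain C where "\<And>z. norm (\<psi> z) \<le> C"
    using continuous_compact_support_bounded[OF \<psi>(1), of R] \<psi>(2) R by (metis not_le)
  from square_integrable_bounded_mult[OF locally_L2D[OF a K] \<psi>(1) this]
  have "square_integrable (\<lambda>z. \<psi> z * (indicator K z *\<^sub>R a z))" .
  also have "(\<lambda>z. \<psi> z * (indicator K z *\<^sub>R a z)) = (\<lambda>z. \<psi> z * a z)"
    using \<psi>(2) by (auto simp: fun_eq_iff indicator_def)
  finally show ?thesis .
qed

lemma integrable_locally_L2_mult:
  assumes g: "locally_L2_on U g" and K: "compact K" "K \<subseteq> U"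
    and \<psi>: "continuous_on UNIV \<psi>" "\<And>z. z \<notin> K \<Longrightarrow> \<psi> z = 0"
  shows "integrable lebesgue (\<lambda>z. g z * \<psi> z)"
proof -
  have "square_integrable (\<lambda>z. indicator K z *\<^sub>R 1)"
    by (rule square_integrable_indicator_continuous[OF K(1)]) simp
  from cauchy_schwarz_L2(1)[OF square_integrable_mult_continuous[OF assms] this]
  have "integrable lebesgue (\<lambda>z. \<psi> z * g z * (indicator K z *\<^sub>R 1))" .
  also have "(\<lambda>z. \<psi> z * g z * (indicator K z *\<^sub>R 1)) = (\<lambda>z. g z * \<psi> z)"
    using \<psi>(2) by (auto simp: fun_eq_iff indicator_def)
  finally show ?thesis .
qed

section \<open>Integration by parts\<close>

lemma lebesgue_integral_translation:
  fixes f :: "complex \<Rightarrow> complex"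
  assumes "f \<in> borel_measurable borel"
  shows "(\<integral>z. f (z + t) \<partial>lebesgue) = (\<integral>z. f z \<partial>lebesgue)"
proof -
  have "(\<integral>z. f z \<partial>lborel) = (\<integral>z. f z \<partial>(distr lborel borel ((+) t)))"
    by (simp add: lborel_distr_plus)
  also have "\<dots> = (\<integral>z. f (t + z) \<partial>lborel)"
    by (rule integral_distr) (use assms in auto)
  finally show ?thesis
    using assms by (simp add: integral_completion add.commute)
qed

text \<open>Integration by parts without iterated integrals: a difference quotient of \<open>\<psi>\<close> has integral \<open>0\<close> by
  translation invariance, and all of them are bounded by the Lipschitz constant on one ball, so that
  dominated convergence carries this over to the derivative. Differentiability almost everywhere is
  enough, which admits functions with a kink along a circle.\<close>

lemma lipschitz_directional_derivative_integral:
  fixes \<psi> :: "complex \<Rightarrow> complex"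
  assumes lip: "L-lipschitz_on UNIV \<psi>" and supp: "\<And>z. norm z > R \<Longrightarrow> \<psi> z = 0"
    and ae: "AE z in lebesgue. has_wirtinger \<psi> (a z) (b z) z" and e: "norm e = 1"
  shows "integrable lebesgue (\<lambda>z. a z * e + b z * cnj e)"
    and "(\<integral>z. a z * e + b z * cnj e \<partial>lebesgue) = 0"
proof -
  define q where "q n z = of_nat (Suc n) * (\<psi> (z + e / of_nat (Suc n)) - \<psi> z)" for n z
  have cont: "continuous_on UNIV \<psi>" using lip by (rule lipschitz_on_continuous_on)
  have cont': "continuous_on UNIV (\<lambda>z. \<psi> (z + t))" for t
    by (rule continuous_on_compose2[OF cont]) (auto intro!: continuous_intros)
  have contq: "continuous_on UNIV (q n)" for n
    unfolding q_def by (intro continuous_intros cont cont')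
  have meas: "q n \<in> borel_measurable lebesgue" for n
    using contq by (rule borel_measurable_lebesgue_continuous)
  have far: "norm (z + e / of_nat (Suc n)) > R" if "norm z > R + 1" for n z
  proof -
    have "norm z \<le> norm (z + e / of_nat (Suc n)) + norm (e / of_nat (Suc n))"
      by (metis add_diff_cancel norm_triangle_ineq4)
    also have "norm (e / of_nat (Suc n)) \<le> 1" using e by (simp add: norm_divide del: of_nat_Suc)
    finally show ?thesis using that by linarith
  qed
  have bound: "norm (q n z) \<le> indicator (cball 0 (R + 1)) z *\<^sub>R L" for n z
  proof (cases "norm z \<le> R + 1")
    case True
    have "norm (\<psi> (z + e / of_nat (Suc n)) - \<psi> z) \<le> L * norm (e / of_nat (Suc n))"
      using lipschitz_onD[OF lip, of "z + e / of_nat (Suc n)" z] by (simp add: dist_norm)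
    also have "\<dots> = L / real (Suc n)" using e by (simp add: norm_divide del: of_nat_Suc)
    finally have "real (Suc n) * norm (\<psi> (z + e / of_nat (Suc n)) - \<psi> z) \<le> real (Suc n) * (L / real (Suc n))"
      by (rule mult_left_mono) auto
    then have "norm (q n z) \<le> L" by (simp add: q_def norm_mult del: of_nat_Suc)
    then show ?thesis using True by (simp add: indicator_def)
  next
    case False
    have "norm (z + e / of_nat (Suc n)) > R" using far False by simp
    then have "q n z = 0" using False supp by (simp add: q_def del: of_nat_Suc)
    then show ?thesis using False by (simp add: indicator_def)
  qed
  have intw: "integrable lebesgue (\<lambda>z::complex. indicator (cball 0 (R + 1)) z *\<^sub>R L)"
    by (rule indicator_compact_continuous) auto
  have lim: "AE z in lebesgue. (\<lambda>n. q n z) \<longlonglongrightarrow> a z * e + b z * cnj e"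
    using ae
  proof eventually_elim
    case (elim z)
    have "((\<lambda>t. \<psi> (z + t *\<^sub>R e)) has_vector_derivative a z * e + b z * cnj e) (at 0)"
    proof -
      have "((\<lambda>t::real. z + t *\<^sub>R e) has_derivative (\<lambda>t. t *\<^sub>R e)) (at 0)"
        by (auto intro!: derivative_eq_intros)
      moreover have "(\<psi> has_derivative (\<lambda>h. a z * h + b z * cnj h)) (at (z + 0 *\<^sub>R e))"
        using elim by (simp add: has_wirtinger_def)
      ultimately have "((\<lambda>t. \<psi> (z + t *\<^sub>R e)) has_derivative (\<lambda>t. a z * (t *\<^sub>R e) + b z * cnj (t *\<^sub>R e))) (at 0)"
        by (rule has_derivative_compose)
      then show ?thesis by (simp add: has_vector_derivative_def algebra_simps)
    qed
    then have "((\<lambda>t. (\<psi> (z + t *\<^sub>R e) - \<psi> z) /\<^sub>R t) \<longlongrightarrow> a z * e + b z * cnj e) (at 0)"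
    proof -
      assume "((\<lambda>t. \<psi> (z + t *\<^sub>R e)) has_vector_derivative a z * e + b z * cnj e) (at 0)"
      then have "(\<lambda>h. norm (\<psi> (z + h *\<^sub>R e) - \<psi> z - h *\<^sub>R (a z * e + b z * cnj e)) / norm h) \<midarrow>0\<rightarrow> 0"
        by (simp add: has_vector_derivative_def has_derivative_at)
      moreover have "\<forall>\<^sub>F h in at (0::real). norm (\<psi> (z + h *\<^sub>R e) - \<psi> z - h *\<^sub>R (a z * e + b z * cnj e)) / norm h
          = norm ((\<psi> (z + h *\<^sub>R e) - \<psi> z) /\<^sub>R h - (a z * e + b z * cnj e))"
      proof (rule eventually_mono[OF eventually_at_ball'[of 1 0 UNIV]])
        fix h :: real assume "h \<in> ball 0 1 \<and> h \<noteq> 0 \<and> h \<in> UNIV"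
        then have "(\<psi> (z + h *\<^sub>R e) - \<psi> z) /\<^sub>R h - (a z * e + b z * cnj e) =
            (\<psi> (z + h *\<^sub>R e) - \<psi> z - h *\<^sub>R (a z * e + b z * cnj e)) /\<^sub>R h"
          by (simp add: scaleR_diff_right)
        then show "norm (\<psi> (z + h *\<^sub>R e) - \<psi> z - h *\<^sub>R (a z * e + b z * cnj e)) / norm h
          = norm ((\<psi> (z + h *\<^sub>R e) - \<psi> z) /\<^sub>R h - (a z * e + b z * cnj e))"
          by (simp only: norm_scaleR) (simp add: divide_inverse mult.commute)
      qed simp
      ultimately show ?thesis
        by (rule LIM_zero_cancel[OF tendsto_norm_zero_cancel[OF Lim_transform_eventually]])
    qed
    moreover have "filterlim (\<lambda>n. inverse (real (Suc n))) (at 0) sequentially"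
      by (rule filterlim_atI[OF LIMSEQ_inverse_real_of_nat]) auto
    ultimately have "(\<lambda>n. (\<psi> (z + inverse (real (Suc n)) *\<^sub>R e) - \<psi> z) /\<^sub>R inverse (real (Suc n))) \<longlonglongrightarrow> a z * e + b z * cnj e"
      by (rule filterlim_compose)
    also have "(\<lambda>n. (\<psi> (z + inverse (real (Suc n)) *\<^sub>R e) - \<psi> z) /\<^sub>R inverse (real (Suc n))) = (\<lambda>n. q n z)"
      by (simp add: q_def scaleR_conv_of_real field_simps fun_eq_iff del: of_nat_Suc)
    finally show ?case .
  qed
  have m: "(\<lambda>z. a z * e + b z * cnj e) \<in> borel_measurable lebesgue"
  proof -
    have "(\<lambda>z. lim (\<lambda>n. q n z)) \<in> borel_measurable lebesgue"
      using meas by (rule borel_measurable_lim_metric)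
    moreover have "AE z in lebesgue. lim (\<lambda>n. q n z) = a z * e + b z * cnj e"
      using lim by eventually_elim (rule limI)
    ultimately show ?thesis
      by (rule borel_measurable_AE)
  qed
  note dct = m meas intw lim AE_I2[OF bound]
  show "integrable lebesgue (\<lambda>z. a z * e + b z * cnj e)"
    by (rule integrable_dominated_convergence[OF dct])
  have "integral\<^sup>L lebesgue (q n) = 0" for n
  proof -
    have i: "integrable lebesgue \<psi>" "integrable lebesgue (\<lambda>z. \<psi> (z + e / of_nat (Suc n)))"
    proof -
      show "integrable lebesgue \<psi>"
        by (rule integrable_continuous_compact_support[OF cont supp])
      have s: "\<psi> (z + e / of_nat (Suc n)) = 0" if "norm z > R + 1" for z
        by (rule supp[OF far[OF that]])
      show "integrable lebesgue (\<lambda>z. \<psi> (z + e / of_nat (Suc n)))"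
        by (rule integrable_continuous_compact_support[OF cont' s])
    qed
    have "(\<integral>z. \<psi> (z + e / of_nat (Suc n)) \<partial>lebesgue) = integral\<^sup>L lebesgue \<psi>"
      by (rule lebesgue_integral_translation) (use cont in \<open>auto intro: borel_measurable_continuous_onI\<close>)
    then show ?thesis unfolding q_def using i by simp
  qed
  then show "(\<integral>z. a z * e + b z * cnj e \<partial>lebesgue) = 0"
    using integral_dominated_convergence[OF dct] LIMSEQ_unique[OF _ tendsto_const] by simp
qed

text \<open>The two Wirtinger derivatives are combinations of the directional derivatives along \<open>1\<close> and \<open>\<i>\<close>.\<close>

lemma lipschitz_wirtinger_integral:
  fixes \<psi> :: "complex \<Rightarrow> complex"
  assumes lip: "L-lipschitz_on UNIV \<psi>" and supp: "\<And>z. norm z > R \<Longrightarrow> \<psi> z = 0"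
    and ae: "AE z in lebesgue. has_wirtinger \<psi> (a z) (b z) z"
  shows "integrable lebesgue a" "integral\<^sup>L lebesgue a = 0"
    and "integrable lebesgue b" "integral\<^sup>L lebesgue b = 0"
proof -
  have i1: "integrable lebesgue (\<lambda>z. a z + b z)" "(\<integral>z. a z + b z \<partial>lebesgue) = 0"
    and i2: "integrable lebesgue (\<lambda>z. \<i> * (a z * \<i> - b z * \<i>))" "(\<integral>z. \<i> * (a z * \<i> - b z * \<i>) \<partial>lebesgue) = 0"
    using lipschitz_directional_derivative_integral[OF assms, where e = 1] lipschitz_directional_derivative_integral[OF assms, where e = \<i>]
    by (auto simp del: right_diff_distrib)
  have eqs: "a = (\<lambda>z. ((a z + b z) - \<i> * (a z * \<i> - b z * \<i>)) / 2)"
     "b = (\<lambda>z. ((a z + b z) + \<i> * (a z * \<i> - b z * \<i>)) / 2)"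
    by (auto simp: field_simps)
  show "integrable lebesgue a" "integral\<^sup>L lebesgue a = 0"
    by (subst eqs(1), use i1 i2 in \<open>simp del: right_diff_distrib\<close>)+
  show "integrable lebesgue b" "integral\<^sup>L lebesgue b = 0"
    by (subst eqs(2), use i1 i2 in \<open>simp del: right_diff_distrib\<close>)+
qed

lemma wirtinger_bounded_imp_lipschitz:
  assumes "convex S" "\<And>z. z \<in> S \<Longrightarrow> has_wirtinger f (a z) (b z) z"
    and "\<And>z. z \<in> S \<Longrightarrow> norm (a z) \<le> A" "\<And>z. z \<in> S \<Longrightarrow> norm (b z) \<le> B" "A \<ge> 0" "B \<ge> 0"
  shows "(A + B)-lipschitz_on S f"
proof (rule lipschitz_onI)
  show "0 \<le> A + B" using assms(5,6) by simp
  fix x y assume xy: "x \<in> S" "y \<in> S"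
  have "norm (f x - f y) \<le> (A + B) * norm (x - y)"
  proof (rule differentiable_bound[where S = S and f' = "\<lambda>z h. a z * h + b z * cnj h"])
    fix z assume z: "z \<in> S"
    show "(f has_derivative (\<lambda>h. a z * h + b z * cnj h)) (at z within S)"
      using assms(2)[OF z] unfolding has_wirtinger_def by (rule has_derivative_at_withinI)
    show "onorm (\<lambda>h. a z * h + b z * cnj h) \<le> A + B"
    proof (rule onorm_le)
      fix h
      have "norm (a z * h + b z * cnj h) \<le> norm (a z) * norm h + norm (b z) * norm h"
        by (rule norm_triangle_le) (simp add: norm_mult)
      also have "\<dots> \<le> (A + B) * norm h"
        using assms(3,4)[OF z] by (simp add: distrib_right add_mono mult_right_mono)
      finally show "norm (a z * h + b z * cnj h) \<le> (A + B) * norm h" .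
    qed
  qed (use assms(1) xy in auto)
  then show "dist (f x) (f y) \<le> (A + B) * dist x y" by (simp add: dist_norm)
qed

lemma C1_compact_support_lipschitz:
  assumes "\<And>z. has_wirtinger f (a z) (b z) z" "continuous_on UNIV a" "continuous_on UNIV b"
    "\<And>z. norm z > R \<Longrightarrow> a z = 0" "\<And>z. norm z > R \<Longrightarrow> b z = 0"
  obtains L where "L-lipschitz_on UNIV f"
proof -
  obtain A where A: "A > 0" "\<And>z. norm (a z) \<le> A"
    using continuous_compact_support_bounded[OF assms(2,4)] by blast
  obtain B where B: "B > 0" "\<And>z. norm (b z) \<le> B"
    using continuous_compact_support_bounded[OF assms(3,5)] by blast
  show ?thesis using wirtinger_bounded_imp_lipschitz[OF convex_UNIV assms(1) A(2) B(2)] A(1) B(1) that by simp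
qed

section \<open>Distributional derivatives\<close>

lemma wirtinger_zero_off_support:
  assumes "closed K" "\<And>z. z \<notin> K \<Longrightarrow> f z = 0" "z \<notin> K"
  shows "has_wirtinger f 0 0 z"
  by (rule has_wirtinger_transform[OF has_wirtinger_const[of 0], of "- K"]) (use assms in auto)

lemma wirtinger_derivs_zero_off_ball:
  assumes "smooth \<rho>" "\<And>z. norm z > R \<Longrightarrow> \<rho> z = 0" "norm z > R"
  shows "dz \<rho> z = 0" "dzbar \<rho> z = 0"
proof -
  have "has_wirtinger \<rho> 0 0 z"
    by (rule wirtinger_zero_off_support[of "cball 0 R"]) (use assms in auto)
  then show "dz \<rho> z = 0" "dzbar \<rho> z = 0" using dz_wirtinger dzbar_wirtinger by blast+
qed

lemma test_functionI:
  assumes "smooth \<phi>" "compact K" "K \<subseteq> U" "\<And>z. z \<notin> K \<Longrightarrow> \<phi> z = 0"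
  shows "test_function_on U \<phi>"
proof -
  have "closure {z. \<phi> z \<noteq> 0} \<subseteq> K"
    by (rule closure_minimal) (use assms in \<open>auto intro: compact_imp_closed\<close>)
  moreover have "compact (closure {z. \<phi> z \<noteq> 0})"
    unfolding compact_closure
    by (rule bounded_subset[OF compact_imp_bounded[OF assms(2)]]) (use assms(4) in blast)
  ultimately show ?thesis using assms by (auto simp: test_function_on_def smooth_def)
qed

lemma test_functionE:
  assumes "test_function_on U \<phi>"
  obtains K where "smooth \<phi>" "compact K" "K \<subseteq> U" "\<And>z. z \<notin> K \<Longrightarrow> \<phi> z = 0"
    "\<And>z. z \<notin> K \<Longrightarrow> dz \<phi> z = 0" "\<And>z. z \<notin> K \<Longrightarrow> dzbar \<phi> z = 0"
proof -
  define K where "K = closure {z. \<phi> z \<noteq> 0}"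
  have K: "smooth \<phi>" "compact K" "K \<subseteq> U" using assms by (auto simp: test_function_on_def smooth_def K_def)
  have 0: "\<phi> z = 0" if "z \<notin> K" for z using that closure_subset[of "{z. \<phi> z \<noteq> 0}"] unfolding K_def by blast
  have "has_wirtinger \<phi> 0 0 z" if "z \<notin> K" for z
    by (rule wirtinger_zero_off_support[of K]) (use 0 K that in \<open>auto intro: compact_imp_closed\<close>)
  with that[OF K 0] show ?thesis using dz_wirtinger dzbar_wirtinger by blast
qed

lemma set_integral_eq_integral_support:
  fixes f :: "complex \<Rightarrow> complex"
  assumes "\<And>z. z \<notin> U \<Longrightarrow> f z = 0"
  shows "set_lebesgue_integral lebesgue U f = integral\<^sup>L lebesgue f"
  unfolding set_lebesgue_integral_def
  by (rule arg_cong[where f = "integral\<^sup>L lebesgue"]) (use assms in \<open>auto simp: indicator_def\<close>)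

definition weak_wirtinger ::
  "complex set \<Rightarrow> (complex \<Rightarrow> complex) \<Rightarrow> (complex \<Rightarrow> complex) \<Rightarrow> (complex \<Rightarrow> complex) \<Rightarrow> bool" where
  "weak_wirtinger U f a b \<longleftrightarrow> has_distrib_deriv_on dz U f a \<and> has_distrib_deriv_on dzbar U f b"

lemma weak_wirtinger_iff:
  "weak_wirtinger U f a b \<longleftrightarrow> (\<forall>\<phi>. test_function_on U \<phi> \<longrightarrow>
      (\<integral>z. f z * dz \<phi> z \<partial>lebesgue) = - (\<integral>z. a z * \<phi> z \<partial>lebesgue) \<and>
      (\<integral>z. f z * dzbar \<phi> z \<partial>lebesgue) = - (\<integral>z. b z * \<phi> z \<partial>lebesgue))"
proof -
  have "set_lebesgue_integral lebesgue U (\<lambda>z. f z * dz \<phi> z) = (\<integral>z. f z * dz \<phi> z \<partial>lebesgue)"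
    "set_lebesgue_integral lebesgue U (\<lambda>z. f z * dzbar \<phi> z) = (\<integral>z. f z * dzbar \<phi> z \<partial>lebesgue)"
    "set_lebesgue_integral lebesgue U (\<lambda>z. g z * \<phi> z) = (\<integral>z. g z * \<phi> z \<partial>lebesgue)"
    if "test_function_on U \<phi>" for \<phi> g
    using that by (auto elim!: test_functionE intro!: set_integral_eq_integral_support)
  then show ?thesis unfolding weak_wirtinger_def has_distrib_deriv_on_def by auto
qed

lemma weak_wirtingerD:
  assumes "weak_wirtinger U f a b" "test_function_on U \<phi>"
  shows "(\<integral>z. f z * dz \<phi> z \<partial>lebesgue) = - (\<integral>z. a z * \<phi> z \<partial>lebesgue)"
    "(\<integral>z. f z * dzbar \<phi> z \<partial>lebesgue) = - (\<integral>z. b z * \<phi> z \<partial>lebesgue)"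
  using assms unfolding weak_wirtinger_iff by blast+

lemma test_function_mono: "test_function_on U \<phi> \<Longrightarrow> U \<subseteq> V \<Longrightarrow> test_function_on V \<phi>"
  unfolding test_function_on_def by blast

lemma weak_wirtinger_subset: "weak_wirtinger V f a b \<Longrightarrow> U \<subseteq> V \<Longrightarrow> weak_wirtinger U f a b"
  unfolding weak_wirtinger_iff using test_function_mono by blast

lemma integrable_test_mult:
  assumes "test_function_on U \<phi>" "locally_L2_on U g"
  shows "integrable lebesgue (\<lambda>z. g z * \<phi> z)" "integrable lebesgue (\<lambda>z. g z * dz \<phi> z)"
    "integrable lebesgue (\<lambda>z. g z * dzbar \<phi> z)"
proof -
  obtain K where K: "smooth \<phi>" "compact K" "K \<subseteq> U" "\<And>z. z \<notin> K \<Longrightarrow> \<phi> z = 0"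
    "\<And>z. z \<notin> K \<Longrightarrow> dz \<phi> z = 0" "\<And>z. z \<notin> K \<Longrightarrow> dzbar \<phi> z = 0" using assms(1) by (metis test_functionE)
  show "integrable lebesgue (\<lambda>z. g z * \<phi> z)" "integrable lebesgue (\<lambda>z. g z * dz \<phi> z)"
    "integrable lebesgue (\<lambda>z. g z * dzbar \<phi> z)"
    by (rule integrable_locally_L2_mult[OF assms(2) K(2,3)]; use K smooth_continuous smooth_dz smooth_dzbar in blast)+
qed

lemma weak_wirtinger_cong:
  assumes w: "weak_wirtinger U f a b" and L2: "locally_L2_on U a" "locally_L2_on U b"
    and f: "\<And>z. z \<in> U \<Longrightarrow> f z = f' z" and ae: "AE z in lebesgue. z \<in> U \<longrightarrow> a z = a' z \<and> b z = b' z"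
  shows "weak_wirtinger U f' a' b'"
  unfolding weak_wirtinger_iff
proof (intro allI impI)
  fix \<phi> assume \<phi>: "test_function_on U \<phi>"
  then obtain K where K: "K \<subseteq> U" "\<And>z. z \<notin> K \<Longrightarrow> \<phi> z = 0"
    "\<And>z. z \<notin> K \<Longrightarrow> dz \<phi> z = 0" "\<And>z. z \<notin> K \<Longrightarrow> dzbar \<phi> z = 0" by (metis test_functionE)
  have "(\<lambda>z. f z * dz \<phi> z) = (\<lambda>z. f' z * dz \<phi> z)" "(\<lambda>z. f z * dzbar \<phi> z) = (\<lambda>z. f' z * dzbar \<phi> z)"
    using K f by (metis mult_zero_right subsetD)+
  moreover have "(\<integral>z. c z * \<phi> z \<partial>lebesgue) = (\<integral>z. c' z * \<phi> z \<partial>lebesgue)"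
    if c: "locally_L2_on U c" and ae: "AE z in lebesgue. z \<in> U \<longrightarrow> c z = c' z" for c c'
    by (rule integral_cong_AE)
       (use integrable_test_mult(1)[OF \<phi> c] integrable_test_mult(1)[OF \<phi> locally_L2_on_cong_AE[OF c ae]] ae K
          in \<open>auto elim!: eventually_mono\<close>)
  note this[OF L2(1), of a'] this[OF L2(2), of b']
  moreover have "AE z in lebesgue. z \<in> U \<longrightarrow> a z = a' z" "AE z in lebesgue. z \<in> U \<longrightarrow> b z = b' z"
    using ae by (eventually_elim, simp)+
  ultimately show "(\<integral>z. f' z * dz \<phi> z \<partial>lebesgue) = - (\<integral>z. a' z * \<phi> z \<partial>lebesgue) \<and>
      (\<integral>z. f' z * dzbar \<phi> z \<partial>lebesgue) = - (\<integral>z. b' z * \<phi> z \<partial>lebesgue)"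
    using weak_wirtingerD[OF w \<phi>] by simp
qed

lemma weak_wirtinger_add_cmult:
  assumes "weak_wirtinger U f a b" "weak_wirtinger U f' a' b'"
    and L2: "locally_L2_on U f" "locally_L2_on U f'" "locally_L2_on U a" "locally_L2_on U a'"
      "locally_L2_on U b" "locally_L2_on U b'"
  shows "weak_wirtinger U (\<lambda>z. f z + c * f' z) (\<lambda>z. a z + c * a' z) (\<lambda>z. b z + c * b' z)"
  unfolding weak_wirtinger_iff
proof (intro allI impI)
  fix \<phi> assume \<phi>: "test_function_on U \<phi>"
  show "(\<integral>z. (f z + c * f' z) * dz \<phi> z \<partial>lebesgue) = - (\<integral>z. (a z + c * a' z) * \<phi> z \<partial>lebesgue) \<and>
      (\<integral>z. (f z + c * f' z) * dzbar \<phi> z \<partial>lebesgue) = - (\<integral>z. (b z + c * b' z) * \<phi> z \<partial>lebesgue)"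
    using L2[THEN integrable_test_mult(1)[OF \<phi>]] L2[THEN integrable_test_mult(2)[OF \<phi>]] L2[THEN integrable_test_mult(3)[OF \<phi>]]
      weak_wirtingerD[OF assms(1) \<phi>] weak_wirtingerD[OF assms(2) \<phi>]
    by (simp add: distrib_right mult.assoc)
qed

lemma has_wirtinger_mult_test_function:
  assumes \<phi>: "smooth \<phi>" "closed K" "K \<subseteq> U" "\<And>z. z \<notin> K \<Longrightarrow> \<phi> z = 0"
    and f: "z \<in> U \<Longrightarrow> has_wirtinger f a b z"
  shows "has_wirtinger (\<lambda>z. f z * \<phi> z) (a * \<phi> z + f z * dz \<phi> z) (b * \<phi> z + f z * dzbar \<phi> z) z"
proof (cases "z \<in> K")
  case True
  then show ?thesis using \<phi>(3) by (intro has_wirtinger_mult f smooth_wirtinger \<phi>(1)) auto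
next
  case False
  have "has_wirtinger \<phi> 0 0 z" by (rule wirtinger_zero_off_support[OF \<phi>(2,4) False])
  moreover have "has_wirtinger (\<lambda>z. f z * \<phi> z) 0 0 z"
    by (rule wirtinger_zero_off_support[OF \<phi>(2) _ False]) (simp add: \<phi>(4))
  ultimately show ?thesis by (simp add: dz_wirtinger dzbar_wirtinger \<phi>(4)[OF False])
qed

text \<open>Integration by parts for the product \<open>f \<phi>\<close>. For smooth \<open>f\<close> this product is Lipschitz by compactness,
  for Lipschitz \<open>f\<close> by boundedness; the next lemmas treat these two cases.\<close>

lemma weak_wirtinger_of_lipschitz_product:
  assumes U: "open U" and f: "continuous_on U f" "AE z in lebesgue. z \<in> U \<longrightarrow> has_wirtinger f (a z) (b z) z"
    and lip: "\<And>\<phi>. test_function_on U \<phi> \<Longrightarrow> \<exists>L. L-lipschitz_on UNIV (\<lambda>z. f z * \<phi> z)"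
  shows "weak_wirtinger U f a b"
  unfolding weak_wirtinger_iff
proof (intro allI impI)
  fix \<phi> assume \<phi>: "test_function_on U \<phi>"
  then obtain K where K: "smooth \<phi>" "compact K" "K \<subseteq> U" "\<And>z. z \<notin> K \<Longrightarrow> \<phi> z = 0"
    "\<And>z. z \<notin> K \<Longrightarrow> dz \<phi> z = 0" "\<And>z. z \<notin> K \<Longrightarrow> dzbar \<phi> z = 0" by (metis test_functionE)
  obtain R where R: "\<And>z. z \<in> K \<Longrightarrow> norm z \<le> R" using K(2) by (meson bounded_iff compact_imp_bounded)
  obtain L where L: "L-lipschitz_on UNIV (\<lambda>z. f z * \<phi> z)" using lip[OF \<phi>] by blast
  have s: "f z * \<phi> z = 0" if "norm z > R" for z using that R K(4) by (metis not_le mult_zero_right)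
  have w: "AE z in lebesgue. has_wirtinger (\<lambda>z. f z * \<phi> z) (a z * \<phi> z + f z * dz \<phi> z) (b z * \<phi> z + f z * dzbar \<phi> z) z"
    using f(2)
  proof eventually_elim
    case (elim z)
    show ?case
      by (rule has_wirtinger_mult_test_function[OF K(1) compact_imp_closed[OF K(2)] K(3,4)]) (use elim in blast)+
  qed
  note i = integrable_test_mult(2,3)[OF \<phi> locally_L2_on_continuous[OF U f(1)]]
    and j = lipschitz_wirtinger_integral[OF L s w]
  have "integrable lebesgue (\<lambda>z. a z * \<phi> z)" "integrable lebesgue (\<lambda>z. b z * \<phi> z)"
    using Bochner_Integration.integrable_diff[OF j(1) i(1)] Bochner_Integration.integrable_diff[OF j(3) i(2)] by simp_all
  then show "(\<integral>z. f z * dz \<phi> z \<partial>lebesgue) = - (\<integral>z. a z * \<phi> z \<partial>lebesgue) \<and>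
      (\<integral>z. f z * dzbar \<phi> z \<partial>lebesgue) = - (\<integral>z. b z * \<phi> z \<partial>lebesgue)"
    using j(2,4) i by (simp add: eq_neg_iff_add_eq_0 add.commute)
qed

lemma continuous_mult_compact_support:
  fixes f :: "complex \<Rightarrow> complex"
  assumes "open U" "continuous_on U f" "compact K" "K \<subseteq> U" "continuous_on UNIV \<phi>" "\<And>z. z \<notin> K \<Longrightarrow> \<phi> z = 0"
  shows "continuous_on UNIV (\<lambda>z. f z * \<phi> z)"
proof -
  have "continuous_on (U \<union> - K) (\<lambda>z. f z * \<phi> z)"
  proof (rule continuous_on_open_Un)
    show "continuous_on U (\<lambda>z. f z * \<phi> z)"
      by (intro continuous_intros assms continuous_on_subset[OF assms(5)]) auto
    have "continuous_on (- K) (\<lambda>z. 0 :: complex)" by simp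
    then show "continuous_on (- K) (\<lambda>z. f z * \<phi> z)"
      by (rule continuous_on_eq) (use assms in auto)
  qed (use assms compact_imp_closed in auto)
  moreover have "U \<union> - K = UNIV" using assms by auto
  ultimately show ?thesis by simp
qed

lemma weak_wirtinger_C1:
  assumes U: "open U" and f: "\<And>z. z \<in> U \<Longrightarrow> has_wirtinger f (a z) (b z) z"
    and ab: "continuous_on U a" "continuous_on U b"
  shows "weak_wirtinger U f a b"
proof (rule weak_wirtinger_of_lipschitz_product[OF U])
  show fc: "continuous_on U f"
    by (rule continuous_at_imp_continuous_on) (use f has_wirtinger_imp_isCont in blast)
  fix \<phi> assume "test_function_on U \<phi>"
  then obtain K where K: "smooth \<phi>" "compact K" "K \<subseteq> U" "\<And>z. z \<notin> K \<Longrightarrow> \<phi> z = 0"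
    "\<And>z. z \<notin> K \<Longrightarrow> dz \<phi> z = 0" "\<And>z. z \<notin> K \<Longrightarrow> dzbar \<phi> z = 0" by (metis test_functionE)
  note c = smooth_continuous[OF K(1)] smooth_continuous[OF smooth_dz[OF K(1)]] smooth_continuous[OF smooth_dzbar[OF K(1)]]
  obtain R where R: "\<And>z. z \<in> K \<Longrightarrow> norm z \<le> R" using K(2) by (meson bounded_iff compact_imp_bounded)
  have w: "has_wirtinger (\<lambda>z. f z * \<phi> z) (a z * \<phi> z + f z * dz \<phi> z) (b z * \<phi> z + f z * dzbar \<phi> z) z" for z
    by (rule has_wirtinger_mult_test_function[OF K(1) compact_imp_closed[OF K(2)] K(3,4)]) (use f in auto)
  have off: "z \<notin> K" if "norm z > R" for z using that R not_le by blast
  show "\<exists>L. L-lipschitz_on UNIV (\<lambda>z. f z * \<phi> z)"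
    by (rule C1_compact_support_lipschitz[OF w, of R])
       (use K off fc ab c in \<open>auto intro!: continuous_on_add continuous_mult_compact_support[OF U _ K(2,3)]\<close>)
qed (use f in auto)

lemma lipschitz_on_mult_bounded:
  fixes f g :: "complex \<Rightarrow> complex"
  assumes f: "L-lipschitz_on UNIV f" "\<And>z. norm (f z) \<le> B" and g: "M-lipschitz_on UNIV g" "\<And>z. norm (g z) \<le> C"
  shows "(B * M + C * L)-lipschitz_on UNIV (\<lambda>z. f z * g z)"
proof (rule lipschitz_onI)
  have nn: "B \<ge> 0" "C \<ge> 0" using f(2)[of 0] g(2)[of 0] norm_ge_zero order_trans by blast+
  then show "0 \<le> B * M + C * L" using f(1) g(1) by (auto dest!: lipschitz_on_nonneg)
  fix x y
  have "f x * g x - f y * g y = f x * (g x - g y) + g y * (f x - f y)" by (simp add: algebra_simps)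
  then have "norm (f x * g x - f y * g y) \<le> norm (f x) * norm (g x - g y) + norm (g y) * norm (f x - f y)"
    by (metis norm_mult norm_triangle_ineq)
  also have "\<dots> \<le> B * (M * dist x y) + C * (L * dist x y)"
    using lipschitz_onD[OF f(1), of x y] lipschitz_onD[OF g(1), of x y] f(2) g(2) nn
    by (intro add_mono mult_mono) (auto simp: dist_norm)
  finally show "dist (f x * g x) (f y * g y) \<le> (B * M + C * L) * dist x y"
    by (simp add: dist_norm algebra_simps)
qed

lemma smooth_lipschitz:
  assumes "smooth \<rho>" "\<And>z. norm z > R \<Longrightarrow> \<rho> z = 0"
  obtains L where "L-lipschitz_on UNIV \<rho>"
  by (rule C1_compact_support_lipschitz[OF smooth_wirtinger[OF assms(1)] smooth_continuous[OF smooth_dz[OF assms(1)]]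
     smooth_continuous[OF smooth_dzbar[OF assms(1)]], of R])
     (use wirtinger_derivs_zero_off_ball[OF assms] in blast)+

lemma weak_wirtinger_lipschitz:
  assumes lip: "L-lipschitz_on UNIV f" and bd: "\<And>z. norm (f z) \<le> B"
    and ae: "AE z in lebesgue. has_wirtinger f (a z) (b z) z"
  shows "weak_wirtinger UNIV f a b"
proof (rule weak_wirtinger_of_lipschitz_product)
  fix \<phi> assume "test_function_on UNIV \<phi>"
  then obtain K where K: "smooth \<phi>" "compact K" "\<And>z. z \<notin> K \<Longrightarrow> \<phi> z = 0" by (metis test_functionE)
  obtain R where "\<And>z. z \<in> K \<Longrightarrow> norm z \<le> R" using K(2) by (meson bounded_iff compact_imp_bounded)
  then have off: "\<phi> z = 0" if "norm z > R" for z using K(3) that not_le by blast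
  obtain M where M: "M-lipschitz_on UNIV \<phi>" by (rule smooth_lipschitz[OF K(1) off])
  obtain C where C: "\<And>z. norm (\<phi> z) \<le> C"
    using continuous_compact_support_bounded[OF smooth_continuous[OF K(1)] off] by blast
  show "\<exists>L. L-lipschitz_on UNIV (\<lambda>z. f z * \<phi> z)"
    using lipschitz_on_mult_bounded[OF lip bd M C] by blast
qed (use ae lip in \<open>auto intro: lipschitz_on_continuous_on\<close>)

text \<open>The functions \<open>\<kappa>\<close> and \<open>1 - \<kappa>\<close> form a partition of unity that splits a test function on the plane into
  one on \<open>V\<close> and one on \<open>U\<close>.\<close>

lemma weak_wirtinger_glue:
  assumes U: "weak_wirtinger U f a b" and V: "weak_wirtinger V f a b"
    and \<kappa>: "smooth \<kappa>" "compact K" "K \<subseteq> V" "\<And>z. z \<notin> K \<Longrightarrow> \<kappa> z = 0"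
    and C: "closed C" "C \<subseteq> U" "\<And>z. z \<notin> C \<Longrightarrow> \<kappa> z = 1"
    and L2: "locally_L2_on UNIV f" "locally_L2_on UNIV a" "locally_L2_on UNIV b"
  shows "weak_wirtinger UNIV f a b"
  unfolding weak_wirtinger_iff
proof (intro allI impI)
  fix \<phi> assume "test_function_on UNIV \<phi>"
  then obtain K' where K': "smooth \<phi>" "compact K'" "\<And>z. z \<notin> K' \<Longrightarrow> \<phi> z = 0" by (metis test_functionE)
  define \<phi>1 where "\<phi>1 = (\<lambda>z. \<kappa> z * \<phi> z)"
  define \<phi>2 where "\<phi>2 = (\<lambda>z. (1 + (-1) * \<kappa> z) * \<phi> z)"
  have sm: "smooth \<phi>1" "smooth \<phi>2" unfolding \<phi>1_def \<phi>2_def by (intro smooth_intros \<kappa> K')+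
  have t1: "test_function_on V \<phi>1"
    by (rule test_functionI[of _ K]) (use sm \<kappa> in \<open>auto simp: \<phi>1_def\<close>)
  have t2: "test_function_on U \<phi>2"
    by (rule test_functionI[of _ "K' \<inter> C"]) (use sm K' C in \<open>auto simp: \<phi>2_def\<close>)
  have sum: "\<phi> = (\<lambda>z. \<phi>1 z + \<phi>2 z)" by (auto simp: \<phi>1_def \<phi>2_def algebra_simps)
  have d: "dz \<phi> z = dz \<phi>1 z + dz \<phi>2 z" "dzbar \<phi> z = dzbar \<phi>1 z + dzbar \<phi>2 z" for z
    unfolding sum using has_wirtinger_add[OF smooth_wirtinger[OF sm(1)] smooth_wirtinger[OF sm(2)]]
    by (auto intro: dz_wirtinger dzbar_wirtinger)
  note i = L2[THEN integrable_test_mult(1)[OF test_function_mono[OF t1 subset_UNIV]]]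
    L2[THEN integrable_test_mult(2)[OF test_function_mono[OF t1 subset_UNIV]]]
    L2[THEN integrable_test_mult(3)[OF test_function_mono[OF t1 subset_UNIV]]]
    L2[THEN integrable_test_mult(1)[OF test_function_mono[OF t2 subset_UNIV]]]
    L2[THEN integrable_test_mult(2)[OF test_function_mono[OF t2 subset_UNIV]]]
    L2[THEN integrable_test_mult(3)[OF test_function_mono[OF t2 subset_UNIV]]]
  have e: "(\<lambda>z. a z * \<phi> z) = (\<lambda>z. a z * \<phi>1 z + a z * \<phi>2 z)" "(\<lambda>z. b z * \<phi> z) = (\<lambda>z. b z * \<phi>1 z + b z * \<phi>2 z)"
    by (simp_all add: fun_cong[OF sum] distrib_left)
  show "(\<integral>z. f z * dz \<phi> z \<partial>lebesgue) = - (\<integral>z. a z * \<phi> z \<partial>lebesgue) \<and>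
      (\<integral>z. f z * dzbar \<phi> z \<partial>lebesgue) = - (\<integral>z. b z * \<phi> z \<partial>lebesgue)"
    unfolding d e using i weak_wirtingerD[OF V t1] weak_wirtingerD[OF U t2] by (simp add: distrib_left)
qed

section \<open>Convolution and cut-off functions\<close>

definition conv :: "(complex \<Rightarrow> complex) \<Rightarrow> (complex \<Rightarrow> complex) \<Rightarrow> complex \<Rightarrow> complex" where
  "conv w \<rho> x = (\<integral>y. w y * \<rho> (x - y) \<partial>lebesgue)"

lemma continuous_on_reflect:
  "continuous_on UNIV \<rho> \<Longrightarrow> continuous_on UNIV (\<lambda>y. \<rho> (x - y :: complex))"
  by (rule continuous_on_compose2[of UNIV \<rho>]) (auto intro!: continuous_intros)

lemma integrable_conv:
  assumes "locally_L2_on UNIV w" "continuous_on UNIV \<rho>" "\<And>z. norm z > R \<Longrightarrow> \<rho> z = 0"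
  shows "integrable lebesgue (\<lambda>y. w y * \<rho> (x - y))"
  by (rule integrable_locally_L2_mult[OF assms(1), of "cball x R"])
     (use assms in \<open>auto intro!: continuous_on_reflect simp: dist_norm\<close>)

text \<open>The derivatives of \<open>\<rho>\<close> are Lipschitz, which makes the error of the linear approximation quadratic,
  uniformly in the base point. This uniformity is what survives integration in the next lemma.\<close>

lemma wirtinger_taylor_bound:
  assumes "smooth \<rho>" "\<And>z. norm z > R \<Longrightarrow> \<rho> z = 0"
  obtains C where "C \<ge> 0" "\<And>x h. norm (\<rho> (x + h) - \<rho> x - (dz \<rho> x * h + dzbar \<rho> x * cnj h)) \<le> C * (norm h)\<^sup>2"
proof -
  obtain A where A: "A-lipschitz_on UNIV (dz \<rho>)"
    using smooth_lipschitz[OF smooth_dz[OF assms(1)]] wirtinger_derivs_zero_off_ball(1)[OF assms] by metis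
  obtain B where B: "B-lipschitz_on UNIV (dzbar \<rho>)"
    using smooth_lipschitz[OF smooth_dzbar[OF assms(1)]] wirtinger_derivs_zero_off_ball(2)[OF assms] by metis
  have "norm (\<rho> (x + h) - \<rho> x - (dz \<rho> x * h + dzbar \<rho> x * cnj h)) \<le> (A + B) * (norm h)\<^sup>2" for x h
  proof -
    define g where "g z = \<rho> z - (dz \<rho> x * z + dzbar \<rho> x * cnj z)" for z
    have g: "(g has_derivative (\<lambda>k. (dz \<rho> z - dz \<rho> x) * k + (dzbar \<rho> z - dzbar \<rho> x) * cnj k)) (at z within cball x (norm h))" for z
    proof -
      have "(\<rho> has_derivative (\<lambda>k. dz \<rho> z * k + dzbar \<rho> z * cnj k)) (at z within cball x (norm h))"
        using smooth_wirtinger[OF assms(1)] unfolding has_wirtinger_def by (rule has_derivative_at_withinI)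
      then show ?thesis unfolding g_def
        by (auto intro!: derivative_eq_intros simp: algebra_simps)
    qed
    have "norm (g (x + h) - g x) \<le> ((A + B) * norm h) * norm (x + h - x)"
    proof (rule differentiable_bound[OF _ g])
      fix z assume z: "z \<in> cball x (norm h)"
      show "onorm (\<lambda>k. (dz \<rho> z - dz \<rho> x) * k + (dzbar \<rho> z - dzbar \<rho> x) * cnj k) \<le> (A + B) * norm h"
      proof (rule onorm_le)
        fix k
        have "norm ((dz \<rho> z - dz \<rho> x) * k + (dzbar \<rho> z - dzbar \<rho> x) * cnj k)
           \<le> norm (dz \<rho> z - dz \<rho> x) * norm k + norm (dzbar \<rho> z - dzbar \<rho> x) * norm k"
          by (rule norm_triangle_le) (simp add: norm_mult)
        also have "\<dots> \<le> (A * norm h) * norm k + (B * norm h) * norm k"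
        proof (intro add_mono mult_right_mono)
          have d: "dist z x \<le> norm h" using z by (simp add: dist_commute)
          show "norm (dz \<rho> z - dz \<rho> x) \<le> A * norm h"
            using lipschitz_onD[OF A, of z x] mult_left_mono[OF d lipschitz_on_nonneg[OF A]] by (simp add: dist_norm)
          show "norm (dzbar \<rho> z - dzbar \<rho> x) \<le> B * norm h"
            using lipschitz_onD[OF B, of z x] mult_left_mono[OF d lipschitz_on_nonneg[OF B]] by (simp add: dist_norm)
        qed auto
        finally show "norm ((dz \<rho> z - dz \<rho> x) * k + (dzbar \<rho> z - dzbar \<rho> x) * cnj k) \<le> (A + B) * norm h * norm k"
          by (simp add: algebra_simps)
      qed
    qed (auto simp: dist_norm)
    then show ?thesis by (simp add: g_def algebra_simps power2_eq_square)
  qed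
  moreover have "A + B \<ge> 0" using A B by (auto dest!: lipschitz_on_nonneg)
  ultimately show ?thesis using that by blast
qed

lemma conv_has_wirtinger:
  assumes w: "locally_L2_on UNIV w" and \<rho>: "smooth \<rho>" "\<And>z. norm z > R \<Longrightarrow> \<rho> z = 0"
  shows "has_wirtinger (conv w \<rho>) (conv w (dz \<rho>) x) (conv w (dzbar \<rho>) x) x"
proof -
  obtain C where C: "C \<ge> 0" "\<And>x h. norm (\<rho> (x + h) - \<rho> x - (dz \<rho> x * h + dzbar \<rho> x * cnj h)) \<le> C * (norm h)\<^sup>2"
    using wirtinger_taylor_bound[OF \<rho>] by blast
  have z: "dz \<rho> z = 0" "dzbar \<rho> z = 0" if "norm z > R" for z
    using wirtinger_derivs_zero_off_ball[OF \<rho> that] by auto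
  note c = smooth_continuous[OF \<rho>(1)] smooth_continuous[OF smooth_dz[OF \<rho>(1)]] smooth_continuous[OF smooth_dzbar[OF \<rho>(1)]]
  define B where "B = cball (0::complex) (norm x + 1 + R)"
  have wB: "integrable lebesgue (\<lambda>y. indicator B y *\<^sub>R w y)"
    using cauchy_schwarz_L2(1)[OF locally_L2D[OF w compact_cball[of 0 "norm x + 1 + R"] subset_UNIV]
        locally_L2D[OF locally_L2_on_continuous[OF open_UNIV continuous_on_const[of _ 1]] compact_cball[of 0 "norm x + 1 + R"] subset_UNIV]]
    by (rule Bochner_Integration.integrable_cong[THEN iffD1, rotated 2]) (auto simp: B_def indicator_def)
  define M where "M = (\<integral>y. norm (indicator B y *\<^sub>R w y) \<partial>lebesgue)"
  have M: "M \<ge> 0" unfolding M_def by simp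
  define D where "D h = conv w (dz \<rho>) x * h + conv w (dzbar \<rho>) x * cnj h" for h
  have main: "norm (conv w \<rho> (x + h) - conv w \<rho> x - D h) \<le> C * (norm h)\<^sup>2 * M" if h: "norm h \<le> 1" for h
  proof -
    define r where "r y = \<rho> ((x - y) + h) - \<rho> (x - y) - (dz \<rho> (x - y) * h + dzbar \<rho> (x - y) * cnj h)" for y
    have i: "integrable lebesgue (\<lambda>y. w y * \<rho> (x + h - y))" "integrable lebesgue (\<lambda>y. w y * \<rho> (x - y))"
      "integrable lebesgue (\<lambda>y. w y * dz \<rho> (x - y))" "integrable lebesgue (\<lambda>y. w y * dzbar \<rho> (x - y))"
      by (rule integrable_conv[OF w]; use c \<rho> z in blast)+
    have e: "w y * r y = w y * \<rho> (x + h - y) - w y * \<rho> (x - y) - ((w y * dz \<rho> (x - y)) * h + (w y * dzbar \<rho> (x - y)) * cnj h)" for y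
      by (simp add: r_def algebra_simps)
    have ir: "integrable lebesgue (\<lambda>y. w y * r y)" unfolding e using i by simp
    have "conv w \<rho> (x + h) - conv w \<rho> x - D h = (\<integral>y. w y * r y \<partial>lebesgue)"
      unfolding e D_def conv_def using i by simp
    also have "norm \<dots> \<le> (\<integral>y. C * (norm h)\<^sup>2 * norm (indicator B y *\<^sub>R w y) \<partial>lebesgue)"
    proof (rule order_trans[OF integral_norm_bound integral_mono])
      show "integrable lebesgue (\<lambda>y. norm (w y * r y))" using ir by simp
      show "integrable lebesgue (\<lambda>y. C * (norm h)\<^sup>2 * norm (indicator B y *\<^sub>R w y))"
        by (intro integrable_mult_right integrable_norm wB)
      fix y
      show "norm (w y * r y) \<le> C * (norm h)\<^sup>2 * norm (indicator B y *\<^sub>R w y)"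
      proof (cases "y \<in> B")
        case True
        have "norm (w y) * norm (r y) \<le> norm (w y) * (C * (norm h)\<^sup>2)"
          unfolding r_def by (intro mult_left_mono C) auto
        then show ?thesis using True by (simp add: norm_mult mult.commute)
      next
        case False
        then have y: "norm y > norm x + 1 + R" by (simp add: B_def)
        have "norm (x - y) > R" using y norm_triangle_ineq2[of y x] by (simp add: norm_minus_commute)
        moreover have "norm (x - y + h) > R"
          using y h norm_triangle_ineq2[of y x] norm_triangle_ineq2[of "y - x" h] norm_minus_commute[of "y - x" h]
          by (simp add: algebra_simps)
        ultimately have "r y = 0" using \<rho>(2) z by (simp add: r_def)
        then show ?thesis using C(1) by (auto intro!: mult_nonneg_nonneg)
      qed
    qed
    also have "\<dots> = C * (norm h)\<^sup>2 * M" by (simp add: M_def)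
    finally show ?thesis .
  qed
  have "(conv w \<rho> has_derivative D) (at x)"
    unfolding has_derivative_at
  proof
    show "bounded_linear D" unfolding D_def
      by (intro bounded_linear_add bounded_linear_const_mult bounded_linear_ident bounded_linear_cnj)
    show "(\<lambda>h. norm (conv w \<rho> (x + h) - conv w \<rho> x - D h) / norm h) \<midarrow>0\<rightarrow> 0"
    proof (rule Lim_null_comparison)
      show "\<forall>\<^sub>F h in at 0. norm (norm (conv w \<rho> (x + h) - conv w \<rho> x - D h) / norm h) \<le> C * M * norm h"
      proof (rule eventually_mono[OF eventually_at_ball'[of 1 0 UNIV]])
        fix h :: complex assume "h \<in> ball 0 1 \<and> h \<noteq> 0 \<and> h \<in> UNIV"
        then have "h \<noteq> 0" "norm h \<le> 1" by auto
        then show "norm (norm (conv w \<rho> (x + h) - conv w \<rho> x - D h) / norm h) \<le> C * M * norm h"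
          using main[of h] by (simp add: divide_le_eq power2_eq_square mult_ac)
      qed simp
      show "((\<lambda>h::complex. C * M * norm h) \<longlongrightarrow> 0) (at 0)"
        by (auto intro!: tendsto_eq_intros)
    qed
  qed
  then show ?thesis unfolding has_wirtinger_def D_def .
qed

lemma smooth_conv:
  assumes w: "locally_L2_on UNIV w" and \<rho>: "smooth \<rho>" "\<And>z. norm z > R \<Longrightarrow> \<rho> z = 0"
  shows "smooth (conv w \<rho>)"
proof -
  have "C_class n (conv w \<rho>)" for n
    using \<rho>
  proof (induction n arbitrary: \<rho>)
    case 0
    have "isCont (conv w \<rho>) x" for x
      by (rule has_wirtinger_imp_isCont[OF conv_has_wirtinger[OF w 0]])
    then show ?case unfolding C_class.simps by (intro continuous_at_imp_continuous_on) blast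
  next
    case (Suc n)
    have hw: "has_wirtinger (conv w \<rho>) (conv w (dz \<rho>) x) (conv w (dzbar \<rho>) x) x" for x
      by (rule conv_has_wirtinger[OF w Suc.prems])
    have z: "dz \<rho> z = 0" "dzbar \<rho> z = 0" if "norm z > R" for z
      using wirtinger_derivs_zero_off_ball[OF Suc.prems that] by auto
    show ?case
      by (rule C_class_SucI[OF hw]; rule Suc.IH) (use Suc.prems(1) z in \<open>auto intro: smooth_dz smooth_dzbar\<close>)
  qed
  then show ?thesis by (simp add: smooth_def)
qed

abbreviation mollify :: "real \<Rightarrow> (complex \<Rightarrow> complex) \<Rightarrow> complex \<Rightarrow> complex" where
  "mollify \<epsilon> w \<equiv> conv w (\<lambda>z. of_real (mollifier \<epsilon> z))"

lemma integrable_mollify: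
  assumes "locally_L2_on UNIV w" "\<epsilon> > 0"
  shows "integrable lebesgue (\<lambda>y. w y * of_real (mollifier \<epsilon> (x - y)))"
  by (rule integrable_conv[OF assms(1), where R = \<epsilon>])
     (use assms(2) in \<open>auto intro!: continuous_intros continuous_mollifier simp: mollifier_zero\<close>)

lemma smooth_mollify: "locally_L2_on UNIV w \<Longrightarrow> \<epsilon> > 0 \<Longrightarrow> smooth (mollify \<epsilon> w)"
  by (rule smooth_conv[OF _ smooth_mollifier, of w \<epsilon>]) (auto simp: mollifier_zero)

lemma mollify_eq:
  assumes "\<epsilon> > 0" "\<And>y. norm (y - x) \<le> \<epsilon> \<Longrightarrow> w y = c"
  shows "mollify \<epsilon> w x = c"
proof -
  have m: "mollifier \<epsilon> \<in> borel_measurable borel"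
    using continuous_mollifier by (rule borel_measurable_continuous_onI)
  have "mollify \<epsilon> w x = (\<integral>y. c * of_real (mollifier \<epsilon> (x - y)) \<partial>lebesgue)"
    unfolding conv_def
  proof (rule Bochner_Integration.integral_cong)
    fix y
    show "w y * of_real (mollifier \<epsilon> (x - y)) = c * of_real (mollifier \<epsilon> (x - y))"
      by (cases "norm (y - x) \<le> \<epsilon>") (use assms mollifier_zero[of \<epsilon> "x - y"] in \<open>auto simp: norm_minus_commute\<close>)
  qed simp
  also have "\<dots> = c * (\<integral>y. of_real (mollifier \<epsilon> (y + (- x))) \<partial>lebesgue)"
    by (subst mollifier_minus) (simp del: integral_complex_of_real)
  also have "(\<integral>y. complex_of_real (mollifier \<epsilon> (y + (- x))) \<partial>lebesgue) = (\<integral>y. complex_of_real (mollifier \<epsilon> y) \<partial>lebesgue)"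
    by (rule lebesgue_integral_translation[where f = "\<lambda>y. complex_of_real (mollifier \<epsilon> y)"]) (use m in measurable)
  also have "\<dots> = 1"
    using integral_mollifier[OF assms(1)] m by (simp add: integral_completion)
  finally show ?thesis by simp
qed

text \<open>Mollifying a continuous cut-off at scale \<open>1\<close> changes it only within distance \<open>1\<close> of the places where
  it is not constant.\<close>

lemma smooth_cutoff_exists:
  obtains \<tau> where "smooth \<tau>" "\<And>z. norm z \<le> 1 \<Longrightarrow> \<tau> z = 1" "\<And>z. norm z > 4 \<Longrightarrow> \<tau> z = 0"
proof -
  \<comment> \<open>Equal to \<open>1\<close> for \<open>\<bar>z\<bar> \<le> 2\<close> and to \<open>0\<close> for \<open>\<bar>z\<bar> \<ge> 3\<close>, a distance \<open>1\<close> away from the two regions in the claim.\<close>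
  define c where "c z = complex_of_real (min 1 (max 0 (3 - norm z)))" for z :: complex
  have c: "continuous_on UNIV c" unfolding c_def by (intro continuous_intros)
  define \<tau> where "\<tau> = mollify 1 c"
  show ?thesis
  proof
    show "smooth \<tau>" unfolding \<tau>_def
      by (rule smooth_mollify[OF locally_L2_on_continuous[OF open_UNIV c]]) simp
    show "\<tau> z = 1" if "norm z \<le> 1" for z
      unfolding \<tau>_def
    proof (rule mollify_eq)
      fix y assume "norm (y - z) \<le> 1"
      then have "norm y \<le> 2" using that norm_triangle_ineq2[of y z] by linarith
      then show "c y = 1" by (simp add: c_def)
    qed simp
    show "\<tau> z = 0" if "norm z > 4" for z
      unfolding \<tau>_def
    proof (rule mollify_eq)
      fix y assume "norm (y - z) \<le> 1"
      then have "norm y \<ge> 3" using that norm_triangle_ineq2[of z y] by (simp add: norm_minus_commute)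
      then show "c y = 0" by (simp add: c_def)
    qed simp
  qed
qed

section \<open>Weak convergence of mollifications\<close>

lemma borel_measurable_cnj:
  "f \<in> borel_measurable M \<Longrightarrow> (\<lambda>x. cnj (f x)) \<in> borel_measurable M"
  by (rule borel_measurable_continuous_on[where f = cnj]) (auto intro: continuous_intros)

lemma borel_representative:
  fixes a :: "complex \<Rightarrow> complex"
  assumes "a \<in> borel_measurable lebesgue"
  obtains a' where "a' \<in> borel_measurable borel" "AE x in lborel. a x = a' x"
proof -
  obtain r i where r: "r \<in> borel_measurable lborel" "AE x in lborel. Re (a x) = r x"
    and i: "i \<in> borel_measurable lborel" "AE x in lborel. Im (a x) = i x"
    using completion_ex_borel_measurable_real[of "\<lambda>x. Re (a x)" lborel]
      completion_ex_borel_measurable_real[of "\<lambda>x. Im (a x)" lborel] assms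
    by (auto simp: borel_measurable_complex_iff)
  have "(\<lambda>x. Complex (r x) (i x)) \<in> borel_measurable borel"
    using r i by (simp add: borel_measurable_complex_iff)
  moreover have "AE x in lborel. a x = Complex (r x) (i x)"
    using r(2) i(2) by eventually_elim (simp add: complex_eq_iff)
  ultimately show ?thesis using that by blast
qed

lemma nn_integral_mollifier:
  assumes "\<epsilon> > 0" shows "(\<integral>\<^sup>+y. ennreal (mollifier \<epsilon> (y - x)) \<partial>lborel) = 1"
proof -
  have [measurable]: "mollifier \<epsilon> \<in> borel_measurable borel"
    using continuous_mollifier by (rule borel_measurable_continuous_onI)
  have "1 = ennreal (integral\<^sup>L lborel (mollifier \<epsilon>))" by (simp add: integral_mollifier assms)
  also have "\<dots> = (\<integral>\<^sup>+y. ennreal (mollifier \<epsilon> y) \<partial>lborel)"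
    by (rule nn_integral_eq_integral[symmetric])
       (use assms in \<open>auto simp: mollifier_nonneg integrable_mollifier\<close>)
  also have "\<dots> = (\<integral>\<^sup>+y. ennreal (mollifier \<epsilon> y) \<partial>(distr lborel borel ((+) (- x))))"
    by (simp add: lborel_distr_plus)
  also have "\<dots> = (\<integral>\<^sup>+y. ennreal (mollifier \<epsilon> (- x + y)) \<partial>lborel)"
    by (rule nn_integral_distr) auto
  finally show ?thesis by simp
qed

lemma square_integrable_nn:
  assumes "square_integrable a"
  shows "(\<integral>\<^sup>+x. ennreal ((norm (a x))\<^sup>2) \<partial>lborel) = ennreal (\<integral>x. (norm (a x))\<^sup>2 \<partial>lebesgue)"
  using nn_integral_eq_integral[of lebesgue "\<lambda>x. (norm (a x))\<^sup>2"] assms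
  by (simp add: square_integrable_def nn_integral_completion)

text \<open>By Young's inequality the double integral of \<open>\<bar>w x\<bar> \<bar>b y\<bar> \<rho> (x - y)\<close> is at most
  \<open>t / 2 \<integral>\<bar>w\<bar>\<^sup>2 + 1 / (2 t) \<integral>\<bar>b\<bar>\<^sup>2\<close>, as the mollifier has integral \<open>1\<close> in each of its two variables. The
  optimal \<open>t\<close> gives a bound that does not depend on \<open>\<epsilon>\<close>.\<close>

lemma mollified_pairing_bound:
  assumes w: "square_integrable w" and b: "square_integrable b" and \<epsilon>: "\<epsilon> > 0"
  shows "integrable lebesgue (\<lambda>x. w x * cnj (mollify \<epsilon> b x))"
    and "norm (\<integral>x. w x * cnj (mollify \<epsilon> b x) \<partial>lebesgue) \<le> sqrt (energy w) * sqrt (energy b)"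
proof -
  define \<rho> where "\<rho> = mollifier \<epsilon>"
  define g where "g x = w x * cnj (conv b (\<lambda>z. of_real (\<rho> z)) x)" for x
  have \<rho>m[measurable]: "\<rho> \<in> borel_measurable borel"
    unfolding \<rho>_def using continuous_mollifier by (rule borel_measurable_continuous_onI)
  have \<rho>0: "\<rho> z \<ge> 0" for z unfolding \<rho>_def using mollifier_nonneg[OF \<epsilon>] .
  obtain w' where w'[measurable]: "w' \<in> borel_measurable borel" and ww: "AE x in lborel. w x = w' x"
    using borel_representative[of w] w by (auto simp: square_integrable_def)
  obtain b' where b'[measurable]: "b' \<in> borel_measurable borel" and bb: "AE x in lborel. b x = b' x"
    using borel_representative[of b] b by (auto simp: square_integrable_def)
  have conv_le: "ennreal (norm (conv b (\<lambda>z. of_real (\<rho> z)) x)) \<le> (\<integral>\<^sup>+y. ennreal (norm (b' y) * \<rho> (x - y)) \<partial>lborel)" for x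
  proof -
    have "ennreal (norm (conv b (\<lambda>z. of_real (\<rho> z)) x)) \<le> (\<integral>\<^sup>+y. ennreal (norm (b y * of_real (\<rho> (x - y)))) \<partial>lebesgue)"
      unfolding conv_def by (cases "integrable lebesgue (\<lambda>y. b y * of_real (\<rho> (x - y)))")
         (auto intro!: integral_norm_bound_ennreal simp: not_integrable_integral_eq)
    also have "\<dots> = (\<integral>\<^sup>+y. ennreal (norm (b' y) * \<rho> (x - y)) \<partial>lborel)"
      unfolding nn_integral_completion
      by (rule nn_integral_cong_AE) (use bb in eventually_elim, simp add: norm_mult \<rho>0)
    finally show ?thesis .
  qed
  have r: "(\<integral>\<^sup>+x. ennreal ((norm (w' x))\<^sup>2) \<partial>lborel) = ennreal (energy w)"
    "(\<integral>\<^sup>+x. ennreal ((norm (b' x))\<^sup>2) \<partial>lborel) = ennreal (energy b)"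
    unfolding square_integrable_nn[OF w, symmetric] square_integrable_nn[OF b, symmetric]
    by (rule nn_integral_cong_AE, use ww in eventually_elim, simp,
        rule nn_integral_cong_AE, use bb in eventually_elim, simp)
  have \<rho>1: "(\<integral>\<^sup>+y. ennreal (\<rho> (x - y)) \<partial>lborel) = 1" "(\<integral>\<^sup>+y. ennreal (\<rho> (y - x)) \<partial>lborel) = 1" for x
    unfolding \<rho>_def by (subst mollifier_minus) (rule nn_integral_mollifier[OF \<epsilon>])+
  have m\<rho>: "(\<lambda>y. ennreal (\<rho> (x - y))) \<in> borel_measurable lborel" "(\<lambda>y. ennreal (\<rho> (y - x))) \<in> borel_measurable lborel" for x
    by measurable
  have r': "(\<integral>\<^sup>+x. ennreal (k * (norm (w' x))\<^sup>2) \<partial>lborel) = ennreal (k * energy w)"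
    "(\<integral>\<^sup>+x. ennreal (k * (norm (b' x))\<^sup>2) \<partial>lborel) = ennreal (k * energy b)" if "k \<ge> 0" for k
    using that by (simp_all add: ennreal_mult nn_integral_cmult r)
  have fin: "(\<integral>\<^sup>+x. ennreal (norm (g x)) \<partial>lebesgue) \<le> ennreal (t / 2 * energy w + 1 / (2 * t) * energy b)"
    if t: "t > 0" for t
  proof -
    have "(\<integral>\<^sup>+x. ennreal (norm (g x)) \<partial>lebesgue) \<le> (\<integral>\<^sup>+x. ennreal (norm (w x)) * (\<integral>\<^sup>+y. ennreal (norm (b' y) * \<rho> (x - y)) \<partial>lborel) \<partial>lebesgue)"
      by (rule nn_integral_mono) (auto simp: g_def norm_mult ennreal_mult intro!: mult_left_mono conv_le)
    also have "\<dots> = (\<integral>\<^sup>+x. ennreal (norm (w' x)) * (\<integral>\<^sup>+y. ennreal (norm (b' y) * \<rho> (x - y)) \<partial>lborel) \<partial>lborel)"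
      unfolding nn_integral_completion
      by (rule nn_integral_cong_AE) (use ww in eventually_elim, simp)
    also have "\<dots> = (\<integral>\<^sup>+x. \<integral>\<^sup>+y. ennreal (norm (w' x) * (norm (b' y) * \<rho> (x - y))) \<partial>lborel \<partial>lborel)"
      by (subst nn_integral_cmult[symmetric]) (auto simp: ennreal_mult \<rho>0)
    also have "\<dots> \<le> (\<integral>\<^sup>+x. \<integral>\<^sup>+y. ennreal (t / 2 * (norm (w' x))\<^sup>2) * ennreal (\<rho> (x - y))
         + ennreal (1 / (2 * t) * (norm (b' y))\<^sup>2) * ennreal (\<rho> (x - y)) \<partial>lborel \<partial>lborel)"
    proof (intro nn_integral_mono)
      fix x y
      have "norm (w' x) * norm (b' y) * \<rho> (x - y) \<le> (t / 2 * (norm (w' x))\<^sup>2 + 1 / (2 * t) * (norm (b' y))\<^sup>2) * \<rho> (x - y)"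
        by (rule mult_right_mono[OF young_inequality[OF t] \<rho>0])
      then show "ennreal (norm (w' x) * (norm (b' y) * \<rho> (x - y))) \<le> ennreal (t / 2 * (norm (w' x))\<^sup>2) * ennreal (\<rho> (x - y))
         + ennreal (1 / (2 * t) * (norm (b' y))\<^sup>2) * ennreal (\<rho> (x - y))"
        using t by (simp add: \<rho>0 distrib_right mult.assoc flip: ennreal_mult ennreal_plus)
    qed
    also have "\<dots> = (\<integral>\<^sup>+x. \<integral>\<^sup>+y. ennreal (t / 2 * (norm (w' x))\<^sup>2) * ennreal (\<rho> (x - y)) \<partial>lborel \<partial>lborel)
        + (\<integral>\<^sup>+x. \<integral>\<^sup>+y. ennreal (1 / (2 * t) * (norm (b' y))\<^sup>2) * ennreal (\<rho> (x - y)) \<partial>lborel \<partial>lborel)"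
      by (subst nn_integral_add[symmetric]) (auto intro!: nn_integral_cong nn_integral_add)
    also have "(\<integral>\<^sup>+x. \<integral>\<^sup>+y. ennreal (t / 2 * (norm (w' x))\<^sup>2) * ennreal (\<rho> (x - y)) \<partial>lborel \<partial>lborel)
        = ennreal (t / 2 * energy w)"
      using t by (simp only: nn_integral_cmult[OF m\<rho>(1)] \<rho>1 mult_1_right, intro r') auto
    also have "(\<integral>\<^sup>+x. \<integral>\<^sup>+y. ennreal (1 / (2 * t) * (norm (b' y))\<^sup>2) * ennreal (\<rho> (x - y)) \<partial>lborel \<partial>lborel)
       = (\<integral>\<^sup>+y. \<integral>\<^sup>+x. ennreal (1 / (2 * t) * (norm (b' y))\<^sup>2) * ennreal (\<rho> (x - y)) \<partial>lborel \<partial>lborel)"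
      by (rule lborel_pair.Fubini') measurable
    also have "\<dots> = ennreal (1 / (2 * t) * energy b)"
      using t by (simp only: nn_integral_cmult[OF m\<rho>(2)] \<rho>1 mult_1_right, intro r') auto
    finally show ?thesis using t by (simp add: ennreal_plus)
  qed
  have gm: "g \<in> borel_measurable lebesgue"
    unfolding g_def \<rho>_def
    by (intro borel_measurable_times borel_measurable_cnj square_integrable_measurable w
        borel_measurable_lebesgue_continuous smooth_continuous smooth_mollify square_integrable_imp_locally_L2 b \<epsilon>)
  have gi: "integrable lebesgue g"
    unfolding integrable_iff_bounded infinity_ennreal_def
    by (intro conjI gm le_less_trans[OF fin[OF zero_less_one] ennreal_less_top])
  then show "integrable lebesgue (\<lambda>x. w x * cnj (mollify \<epsilon> b x))" unfolding g_def \<rho>_def .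
  have "norm (integral\<^sup>L lebesgue g) \<le> sqrt (energy w) * sqrt (energy b)"
  proof (rule le_sqrt_mult_sqrt)
    fix t :: real assume t: "t > 0"
    have "ennreal (norm (integral\<^sup>L lebesgue g)) \<le> ennreal (t / 2 * energy w + 1 / (2 * t) * energy b)"
      by (rule order_trans[OF integral_norm_bound_ennreal[OF gi] fin[OF t]])
    then show "norm (integral\<^sup>L lebesgue g) \<le> t / 2 * energy w + 1 / (2 * t) * energy b"
      by (subst (asm) ennreal_le_iff) (use t in auto)
  qed auto
  then show "norm (\<integral>x. w x * cnj (mollify \<epsilon> b x) \<partial>lebesgue) \<le> sqrt (energy w) * sqrt (energy b)"
    unfolding g_def \<rho>_def .
qed

lemma mollify_uniform_limit:
  assumes c: "continuous_on UNIV c" "\<And>z. norm z > R \<Longrightarrow> c z = 0" and e: "e > 0"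
  obtains \<delta> where "\<delta> > 0" "\<And>\<epsilon> x. 0 < \<epsilon> \<Longrightarrow> \<epsilon> < \<delta> \<Longrightarrow> norm (mollify \<epsilon> c x - c x) \<le> e"
proof -
  have "uniformly_continuous_on (cball 0 (R + 1)) c"
    by (intro compact_uniformly_continuous continuous_on_subset[OF c(1)]) auto
  then obtain d where d: "d > 0" "\<And>x y. x \<in> cball 0 (R + 1) \<Longrightarrow> y \<in> cball 0 (R + 1) \<Longrightarrow> dist y x < d \<Longrightarrow> dist (c y) (c x) < e"
    using e unfolding uniformly_continuous_on_def by metis
  have uc: "norm (c y - c x) \<le> e" if "norm (y - x) < min d 1" for x y
  proof (cases "norm x \<le> R \<or> norm y \<le> R")
    case True
    then have "norm x \<le> R + 1" "norm y \<le> R + 1"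
      using that norm_triangle_ineq2[of x y] norm_triangle_ineq2[of y x] by (auto simp: norm_minus_commute)
    then show ?thesis using d(2)[of x y] that by (simp add: dist_norm less_imp_le)
  next
    case False
    then show ?thesis using c(2) e by (simp add: not_le)
  qed
  show ?thesis
  proof (rule that[of "min d 1"])
    fix \<epsilon> :: real and x assume \<epsilon>: "0 < \<epsilon>" "\<epsilon> < min d 1"
    let ?\<rho> = "\<lambda>z. complex_of_real (mollifier \<epsilon> z)"
    note int = integrable_mollify[OF locally_L2_on_continuous[OF open_UNIV _] \<epsilon>(1), of _ x]
    have i1: "integrable lebesgue (\<lambda>y. c y * ?\<rho> (x - y))" by (rule int[OF c(1)])
    have i2: "integrable lebesgue (\<lambda>y. c x * ?\<rho> (x - y))" by (rule int[OF continuous_on_const])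
    have i3: "integrable lebesgue (\<lambda>y. e * mollifier \<epsilon> (x - y))"
      using integrable_norm[OF int[OF continuous_on_const[of _ "of_real e"]]] \<epsilon> e by (simp add: norm_mult mollifier_nonneg)
    have one: "(\<integral>y. mollifier \<epsilon> (x - y) \<partial>lebesgue) = 1"
    proof -
      have "complex_of_real (\<integral>y. mollifier \<epsilon> (x - y) \<partial>lebesgue) = conv (\<lambda>_. 1) ?\<rho> x"
        by (simp add: conv_def)
      also have "\<dots> = 1" by (rule mollify_eq[OF \<epsilon>(1)]) simp
      finally show ?thesis by simp
    qed
    have "conv (\<lambda>_. c x) ?\<rho> x = c x" by (rule mollify_eq[OF \<epsilon>(1)]) simp
    then have "mollify \<epsilon> c x - c x = mollify \<epsilon> c x - conv (\<lambda>_. c x) ?\<rho> x" by simp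
    also have "\<dots> = (\<integral>y. c y * ?\<rho> (x - y) - c x * ?\<rho> (x - y) \<partial>lebesgue)"
      unfolding conv_def by (rule Bochner_Integration.integral_diff[OF i1 i2, symmetric])
    also have "norm \<dots> \<le> (\<integral>y. e * mollifier \<epsilon> (x - y) \<partial>lebesgue)"
    proof (rule order_trans[OF integral_norm_bound integral_mono[OF _ i3]])
      show "integrable lebesgue (\<lambda>y. norm (c y * ?\<rho> (x - y) - c x * ?\<rho> (x - y)))"
        using i1 i2 by (intro integrable_norm Bochner_Integration.integrable_diff)
      fix y
      have "norm (c y - c x) * mollifier \<epsilon> (x - y) \<le> e * mollifier \<epsilon> (x - y)"
      proof (cases "norm (y - x) < \<epsilon>")
        case True
        then show ?thesis using \<epsilon> by (intro mult_right_mono uc mollifier_nonneg) auto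
      next
        case False
        then show ?thesis using mollifier_zero[OF \<epsilon>(1), of "x - y"] by (simp add: norm_minus_commute)
      qed
      then show "norm (c y * ?\<rho> (x - y) - c x * ?\<rho> (x - y)) \<le> e * mollifier \<epsilon> (x - y)"
        using \<epsilon> by (simp add: left_diff_distrib[symmetric] norm_mult mollifier_nonneg)
    qed
    also have "\<dots> = e" using one by simp
    finally show "norm (mollify \<epsilon> c x - c x) \<le> e" .
  qed (use d in auto)
qed

text \<open>Since \<open>mollified_pairing_bound\<close> is uniform in \<open>\<epsilon>\<close>, the function \<open>a\<close> may be replaced by a continuous
  one with compact support, whose mollifications converge uniformly.\<close>

lemma mollification_weak_limit:
  assumes w: "square_integrable w" and a: "square_integrable a"
  shows "((\<lambda>\<epsilon>. \<integral>x. w x * cnj (mollify \<epsilon> a x) \<partial>lebesgue) \<longlongrightarrow> (\<integral>x. w x * cnj (a x) \<partial>lebesgue)) (at_right 0)"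
proof (rule tendstoI)
  fix e :: real assume e: "e > 0"
  have cnj_sq: "square_integrable (\<lambda>x. cnj (b x))" if "square_integrable b" for b
    by (rule square_integrable_le[OF that, where C = 1]) (use that in \<open>auto intro: borel_measurable_cnj square_integrable_measurable\<close>)
  define t where "t = e / 4 / (sqrt (energy w) + 1)"
  have W: "sqrt (energy w) \<ge> 0" by simp
  then have t: "t > 0" "sqrt (energy w) * t \<le> e / 4"
    using e by (auto simp: t_def field_simps add_pos_nonneg)
  obtain c R where c: "continuous_on UNIV c" "\<And>z. norm z > R \<Longrightarrow> c z = 0"
    and ac: "energy (\<lambda>z. a z - c z) < t\<^sup>2"
    using continuous_approx_L2[OF a, of "t\<^sup>2"] t by auto
  have sc: "square_integrable c" by (rule square_integrable_continuous[OF c])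
  have sd: "square_integrable (\<lambda>z. a z - c z)" by (rule square_integrable_diff[OF a sc])
  have bound: "sqrt (energy w) * sqrt (energy (\<lambda>z. a z - c z)) \<le> e / 4"
    using mult_left_mono[OF real_sqrt_le_mono[OF less_imp_le[OF ac]] W] t by simp
  note pair = cauchy_schwarz_L2[OF w cnj_sq]
  define M where "M = (\<integral>x. norm (indicator (cball 0 (R + 1)) x *\<^sub>R w x) \<partial>lebesgue)"
  have M: "M \<ge> 0" by (simp add: M_def)
  have "square_integrable (\<lambda>x. indicator (cball 0 (R + 1)) x *\<^sub>R 1)"
    by (rule square_integrable_indicator_continuous) auto
  from integrable_norm[OF cauchy_schwarz_L2(1)[OF w this]]
  have wi: "integrable lebesgue (\<lambda>x. norm (indicator (cball 0 (R + 1)) x *\<^sub>R w x))"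
    by (simp add: norm_mult mult.commute)
  define d where "d = e / (4 * (M + 1))"
  have d: "d > 0" "d * M \<le> e / 4" using e M by (auto simp: d_def field_simps)
  obtain \<delta> where \<delta>: "\<delta> > 0" "\<And>\<epsilon> x. 0 < \<epsilon> \<Longrightarrow> \<epsilon> < \<delta> \<Longrightarrow> norm (mollify \<epsilon> c x - c x) \<le> d"
    using mollify_uniform_limit[OF c d(1)] by blast
  have "\<forall>\<^sub>F \<epsilon> in at_right 0. \<epsilon> \<in> {0<..<min \<delta> 1}"
    using \<delta> by (intro eventually_at_right_real) auto
  then show "\<forall>\<^sub>F \<epsilon> in at_right 0. dist (\<integral>x. w x * cnj (mollify \<epsilon> a x) \<partial>lebesgue) (\<integral>x. w x * cnj (a x) \<partial>lebesgue) < e"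
  proof eventually_elim
    case (elim \<epsilon>)
    then have \<epsilon>: "0 < \<epsilon>" "\<epsilon> < \<delta>" "\<epsilon> \<le> 1" by auto
    note int = integrable_mollify[OF square_integrable_imp_locally_L2 \<epsilon>(1)]
    have cd: "mollify \<epsilon> (\<lambda>z. a z - c z) x = mollify \<epsilon> a x - mollify \<epsilon> c x" for x
      unfolding conv_def using int[OF a] int[OF sc] by (simp add: left_diff_distrib)
    note i1 = mollified_pairing_bound[OF w a \<epsilon>(1)] and i2 = mollified_pairing_bound[OF w sc \<epsilon>(1)]
    have t1: "norm ((\<integral>x. w x * cnj (mollify \<epsilon> a x) \<partial>lebesgue) - (\<integral>x. w x * cnj (mollify \<epsilon> c x) \<partial>lebesgue)) \<le> e / 4"
    proof -
      have "(\<integral>x. w x * cnj (mollify \<epsilon> a x) \<partial>lebesgue) - (\<integral>x. w x * cnj (mollify \<epsilon> c x) \<partial>lebesgue)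
        = (\<integral>x. w x * cnj (mollify \<epsilon> (\<lambda>z. a z - c z) x) \<partial>lebesgue)"
        unfolding cd using i1(1) i2(1) by (simp add: right_diff_distrib)
      then show ?thesis using order_trans[OF mollified_pairing_bound(2)[OF w sd \<epsilon>(1)] bound] by (simp only:)
    qed
    have t3: "norm ((\<integral>x. w x * cnj (a x) \<partial>lebesgue) - (\<integral>x. w x * cnj (c x) \<partial>lebesgue)) \<le> e / 4"
    proof -
      have "(\<integral>x. w x * cnj (a x) \<partial>lebesgue) - (\<integral>x. w x * cnj (c x) \<partial>lebesgue) = (\<integral>x. w x * cnj (a x - c x) \<partial>lebesgue)"
        using pair(1)[OF a] pair(1)[OF sc] by (simp add: right_diff_distrib)
      moreover have "energy (\<lambda>z. cnj (a z - c z)) = energy (\<lambda>z. a z - c z)" by (simp only: complex_mod_cnj)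
      ultimately show ?thesis using pair(3)[OF sd] bound by (simp only:)
    qed
    have t2: "norm ((\<integral>x. w x * cnj (mollify \<epsilon> c x) \<partial>lebesgue) - (\<integral>x. w x * cnj (c x) \<partial>lebesgue)) \<le> e / 4"
    proof -
      have "(\<integral>x. w x * cnj (mollify \<epsilon> c x) \<partial>lebesgue) - (\<integral>x. w x * cnj (c x) \<partial>lebesgue)
        = (\<integral>x. w x * cnj (mollify \<epsilon> c x) - w x * cnj (c x) \<partial>lebesgue)"
        using i2(1) pair(1)[OF sc] by simp
      also have "norm \<dots> \<le> (\<integral>x. d * norm (indicator (cball 0 (R + 1)) x *\<^sub>R w x) \<partial>lebesgue)"
      proof (rule order_trans[OF integral_norm_bound integral_mono])
        show "integrable lebesgue (\<lambda>x. norm (w x * cnj (mollify \<epsilon> c x) - w x * cnj (c x)))"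
          using i2(1) pair(1)[OF sc] by simp
        show "integrable lebesgue (\<lambda>x. d * norm (indicator (cball 0 (R + 1)) x *\<^sub>R w x))"
          by (intro integrable_mult_right wi)
        fix x
        have n: "norm (w x * cnj (mollify \<epsilon> c x) - w x * cnj (c x)) = norm (w x) * norm (mollify \<epsilon> c x - c x)"
          by (metis complex_cnj_diff complex_mod_cnj norm_mult right_diff_distrib)
        show "norm (w x * cnj (mollify \<epsilon> c x) - w x * cnj (c x)) \<le> d * norm (indicator (cball 0 (R + 1)) x *\<^sub>R w x)"
        proof (cases "norm x \<le> R + 1")
          case True
          have "norm (w x) * norm (mollify \<epsilon> c x - c x) \<le> norm (w x) * d"
            by (intro mult_left_mono \<delta> \<epsilon>) auto
          then show ?thesis using True n by (simp add: mult.commute)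
        next
          case False
          have "mollify \<epsilon> c x = 0"
          proof (rule mollify_eq[OF \<epsilon>(1)])
            fix y assume "norm (y - x) \<le> \<epsilon>"
            then have "norm y > R" using False \<epsilon>(3) norm_triangle_ineq2[of x y] by (simp add: norm_minus_commute)
            then show "c y = 0" by (rule c(2))
          qed
          moreover have "c x = 0" using False c(2) by simp
          ultimately show ?thesis using d by simp
        qed
      qed
      also have "\<dots> = d * M" by (simp add: M_def)
      also note d(2)
      finally show ?thesis .
    qed
    have tri: "dist A D \<le> e / 4 + e / 4 + e / 4"
      if "norm (A - B) \<le> e / 4" "norm (B - C) \<le> e / 4" "norm (D - C) \<le> e / 4" for A B C D :: complex
      using that dist_triangle[of A D B] dist_triangle[of B D C]
      by (simp add: dist_norm norm_minus_commute)
    have "dist (\<integral>x. w x * cnj (mollify \<epsilon> a x) \<partial>lebesgue) (\<integral>x. w x * cnj (a x) \<partial>lebesgue) \<le> e / 4 + e / 4 + e / 4"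
      by (rule tri[OF t1 t2 t3])
    then show ?case using e by linarith
  qed
qed
lemma smooth_reflected_mollifier: "smooth (\<lambda>y. of_real (mollifier \<epsilon> (x - y)))"
  using smooth_affine[OF smooth_mollifier[of \<epsilon>], of "-1" x] by (simp add: algebra_simps)

text \<open>The fundamental lemma of the calculus of variations. On a small ball the mollifications of \<open>a\<close> vanish,
  since translates of the mollifier are test functions on \<open>U\<close>; paired with \<open>a\<close> they converge to the
  integral of \<open>\<bar>a\<bar>\<^sup>2\<close> over this ball.\<close>

theorem weak_zero_imp_AE_zero:
  assumes U: "open U" and a: "locally_L2_on U a"
    and zero: "\<And>\<phi>. test_function_on U \<phi> \<Longrightarrow> (\<integral>z. a z * \<phi> z \<partial>lebesgue) = 0"
  shows "AE z in lebesgue. z \<in> U \<longrightarrow> a z = 0"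
proof -
  have loc: "AE x in lebesgue. x \<in> ball z r \<longrightarrow> a x = 0" if r: "r > 0" and sub: "cball z (2 * r) \<subseteq> U" for z r
  proof -
    define w where "w x = indicator (cball z r) x *\<^sub>R a x" for x
    define a' where "a' x = indicator (cball z (2 * r)) x *\<^sub>R a x" for x
    have sub': "cball z r \<subseteq> U" by (rule order_trans[OF subset_cball sub]) (use r in simp)
    have sw: "square_integrable w" "square_integrable a'"
      unfolding w_def a'_def using locally_L2D[OF a] sub sub' by auto
    have "\<forall>\<^sub>F \<epsilon> in at_right 0. \<epsilon> \<in> {0<..<r}"
      using r by (intro eventually_at_right_real) auto
    then have "\<forall>\<^sub>F \<epsilon> in at_right 0. (\<integral>x. w x * cnj (mollify \<epsilon> a' x) \<partial>lebesgue) = 0"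
    proof eventually_elim
      case (elim \<epsilon>)
      have "w x * cnj (mollify \<epsilon> a' x) = 0" for x
      proof (cases "x \<in> cball z r")
        case True
        have t: "test_function_on U (\<lambda>y. of_real (mollifier \<epsilon> (x - y)))"
        proof (rule test_functionI[OF smooth_reflected_mollifier, of "cball x \<epsilon>"])
          have "cball x \<epsilon> \<subseteq> cball z (2 * r)"
          proof
            fix y assume "y \<in> cball x \<epsilon>"
            then show "y \<in> cball z (2 * r)" using True elim dist_triangle[of z y x] by auto
          qed
          then show "cball x \<epsilon> \<subseteq> U" using sub by blast
          show "of_real (mollifier \<epsilon> (x - y)) = (0::complex)" if "y \<notin> cball x \<epsilon>" for y
            using that elim mollifier_zero[of \<epsilon> "x - y"] by (simp add: dist_norm)
        qed simp
        have "mollify \<epsilon> a' x = (\<integral>y. a y * of_real (mollifier \<epsilon> (x - y)) \<partial>lebesgue)"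
          unfolding conv_def
        proof (rule Bochner_Integration.integral_cong)
          fix y
          show "a' y * of_real (mollifier \<epsilon> (x - y)) = a y * of_real (mollifier \<epsilon> (x - y))"
          proof (cases "dist x y \<le> \<epsilon>")
            case T: True
            then have "y \<in> cball z (2 * r)" using True elim dist_triangle[of z y x] by auto
            then show ?thesis by (simp add: a'_def)
          next
            case False
            then show ?thesis using elim mollifier_zero[of \<epsilon> "x - y"] by (simp add: dist_norm)
          qed
        qed simp
        then show ?thesis using zero[OF t] by simp
      qed (simp add: w_def)
      then show ?case by (simp only: Bochner_Integration.integral_zero)
    qed
    then have "((\<lambda>\<epsilon>. \<integral>x. w x * cnj (mollify \<epsilon> a' x) \<partial>lebesgue) \<longlongrightarrow> 0) (at_right 0)"
      by (rule tendsto_eventually)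
    then have "(\<integral>x. w x * cnj (a' x) \<partial>lebesgue) = 0"
      using mollification_weak_limit[OF sw] by (rule tendsto_unique[OF trivial_limit_at_right_real, symmetric])
    also have "(\<lambda>x. w x * cnj (a' x)) = (\<lambda>x. of_real ((norm (w x))\<^sup>2))"
      using r by (auto simp: fun_eq_iff w_def a'_def indicator_def complex_norm_square simp del: of_real_power)
    finally have "(\<integral>x. (norm (w x))\<^sup>2 \<partial>lebesgue) = 0" by (simp del: of_real_power)
    then have "AE x in lebesgue. (norm (w x))\<^sup>2 = 0"
      using sw(1) by (subst (asm) integral_nonneg_eq_0_iff_AE) (auto simp: square_integrable_def)
    then show ?thesis by eventually_elim (auto simp: w_def indicator_def)
  qed
  define F where "F = {ball z r |z r. r > 0 \<and> cball z (2 * r) \<subseteq> U}"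
  obtain F' where F': "F' \<subseteq> F" "countable F'" "\<Union>F' = \<Union>F"
    by (rule Lindelof[of F]) (auto simp: F_def)
  have "\<Union>F = U"
  proof
    show "\<Union>F \<subseteq> U" unfolding F_def
    proof clarify
      fix x z r assume x: "x \<in> ball z r" and r: "0 < r" "cball z (2 * r) \<subseteq> U"
      then have "x \<in> cball z (2 * r)" by auto
      then show "x \<in> U" using r by blast
    qed
    show "U \<subseteq> \<Union>F"
    proof
      fix x assume "x \<in> U"
      then obtain e where e: "e > 0" "cball x e \<subseteq> U" using U open_contains_cball by blast
      then have "ball x (e / 2) \<in> F" unfolding F_def by (auto intro!: exI[of _ x] exI[of _ "e / 2"])
      then show "x \<in> \<Union>F" using e by (auto intro!: bexI[of _ "ball x (e / 2)"])
    qed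
  qed
  have "AE x in lebesgue. \<forall>S\<in>F'. x \<in> S \<longrightarrow> a x = 0"
    unfolding AE_ball_countable[OF F'(2)]
  proof
    fix S assume "S \<in> F'"
    then obtain z r where "S = ball z r" "r > 0" "cball z (2 * r) \<subseteq> U" using F'(1) by (auto simp: F_def)
    then show "AE x in lebesgue. x \<in> S \<longrightarrow> a x = 0" using loc by simp
  qed
  then show ?thesis
    by eventually_elim (use F'(3) \<open>\<Union>F = U\<close> in blast)
qed

text \<open>Only values of \<open>u\<close> within distance \<open>1\<close> of the support of \<open>w\<close> enter once \<open>\<epsilon> < 1\<close>.\<close>

lemma mollification_weak_limit_local:
  assumes w: "square_integrable w" "\<And>z. norm z > R \<Longrightarrow> w z = 0" and u: "locally_L2_on UNIV u"
  shows "((\<lambda>\<epsilon>. \<integral>x. w x * cnj (mollify \<epsilon> u x) \<partial>lebesgue)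
     \<longlongrightarrow> (\<integral>x. w x * cnj (u x) \<partial>lebesgue)) (at_right 0)"
proof -
  define u' where "u' x = indicator (cball 0 (R + 1)) x *\<^sub>R u x" for x
  have su: "square_integrable u'"
    unfolding u'_def by (rule locally_L2D[OF u]) auto
  have lim: "((\<lambda>\<epsilon>. \<integral>x. w x * cnj (mollify \<epsilon> u' x) \<partial>lebesgue)
     \<longlongrightarrow> (\<integral>x. w x * cnj (u' x) \<partial>lebesgue)) (at_right 0)"
    by (rule mollification_weak_limit[OF w(1) su])
  have "\<forall>\<^sub>F \<epsilon> in at_right 0. \<epsilon> \<in> {0<..<1::real}"
    by (intro eventually_at_right_real) auto
  then have ev: "\<forall>\<^sub>F \<epsilon> in at_right 0. (\<integral>x. w x * cnj (mollify \<epsilon> u' x) \<partial>lebesgue)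
      = (\<integral>x. w x * cnj (mollify \<epsilon> u x) \<partial>lebesgue)"
  proof eventually_elim
    case (elim \<epsilon>)
    have "w x * cnj (mollify \<epsilon> u' x) = w x * cnj (mollify \<epsilon> u x)" for x
    proof (cases "norm x > R")
      case False
      have "mollify \<epsilon> u' x = mollify \<epsilon> u x"
        unfolding conv_def
      proof (rule Bochner_Integration.integral_cong)
        fix y
        show "u' y * of_real (mollifier \<epsilon> (x - y)) = u y * of_real (mollifier \<epsilon> (x - y))"
        proof (cases "norm (x - y) \<le> \<epsilon>")
          case True
          then have "norm y \<le> R + 1"
            using False elim norm_triangle_ineq2[of y x] by (simp add: norm_minus_commute)
          then show ?thesis by (simp add: u'_def)
        next
          case False
          then show ?thesis using elim mollifier_zero[of \<epsilon> "x - y"] by simp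
        qed
      qed simp
      then show ?thesis by simp
    qed (simp add: w(2))
    then show ?case by (simp only:)
  qed
  have "(\<lambda>x. w x * cnj (u' x)) = (\<lambda>x. w x * cnj (u x))"
    using w(2) by (auto simp: fun_eq_iff u'_def indicator_def)
  then show ?thesis using Lim_transform_eventually[OF lim ev] by simp
qed

section \<open>The energy inequality\<close>

text \<open>For fixed \<open>x\<close> the function \<open>y \<mapsto> \<rho> (x - y)\<close> is a test function, whose derivatives are those of \<open>\<rho>\<close> with
  the opposite sign.\<close>

lemma conv_weak_derivative:
  assumes \<Gamma>: "weak_wirtinger UNIV \<Gamma> u v" and \<rho>: "smooth \<rho>" "\<And>z. norm z > r \<Longrightarrow> \<rho> z = 0"
  shows "conv \<Gamma> (dz \<rho>) = conv u \<rho>" "conv \<Gamma> (dzbar \<rho>) = conv v \<rho>"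
proof -
  have *: "conv \<Gamma> (dz \<rho>) x = conv u \<rho> x \<and> conv \<Gamma> (dzbar \<rho>) x = conv v \<rho> x" for x
  proof -
    define \<phi> where "\<phi> y = \<rho> (- 1 * y + x)" for y
    have w: "has_wirtinger \<phi> (- 1 * dz \<rho> (- 1 * y + x)) (cnj (- 1) * dzbar \<rho> (- 1 * y + x)) y" for y
      unfolding \<phi>_def by (intro has_wirtinger_affine smooth_wirtinger \<rho>)
    have s: "smooth \<phi>" unfolding \<phi>_def by (intro smooth_affine \<rho>)
    have "test_function_on UNIV \<phi>"
    proof (rule test_functionI[OF s, of "cball x r"])
      fix z assume "z \<notin> cball x r"
      then show "\<phi> z = 0" using \<rho>(2)[of "x - z"] by (simp add: \<phi>_def dist_norm)
    qed auto
    from weak_wirtingerD[OF \<Gamma> this] show ?thesis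
      by (simp add: dz_wirtinger[OF w] dzbar_wirtinger[OF w] conv_def \<phi>_def)
  qed
  then show "conv \<Gamma> (dz \<rho>) = conv u \<rho>" "conv \<Gamma> (dzbar \<rho>) = conv v \<rho>" by auto
qed

text \<open>Continuous functions of class \<open>W\<^sup>1\<^sup>,\<^sup>2\<close>, locally on the plane, with their two weak derivatives.\<close>

definition sobolev_map :: "(complex \<Rightarrow> complex) \<Rightarrow> (complex \<Rightarrow> complex) \<Rightarrow> (complex \<Rightarrow> complex) \<Rightarrow> bool" where
  "sobolev_map \<Gamma> u v \<longleftrightarrow> continuous_on UNIV \<Gamma> \<and> weak_wirtinger UNIV \<Gamma> u v \<and>
     locally_L2_on UNIV u \<and> locally_L2_on UNIV v"

lemma sobolev_mapD:
  assumes "sobolev_map \<Gamma> u v"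
  shows "continuous_on UNIV \<Gamma>" "weak_wirtinger UNIV \<Gamma> u v" "locally_L2_on UNIV u" "locally_L2_on UNIV v"
    and "locally_L2_on UNIV \<Gamma>"
  using assms by (auto simp: sobolev_map_def intro: locally_L2_on_continuous)

lemma sobolev_map_add_cmult:
  assumes "sobolev_map f a b" "sobolev_map f' a' b'"
  shows "sobolev_map (\<lambda>z. f z + c * f' z) (\<lambda>z. a z + c * a' z) (\<lambda>z. b z + c * b' z)"
proof -
  note f = sobolev_mapD[OF assms(1)] and f' = sobolev_mapD[OF assms(2)]
  have cm: "locally_L2_on UNIV (\<lambda>z. c * g z)" if "locally_L2_on UNIV g" for g
    using that square_integrable_bounded_mult[OF _ continuous_on_const[of _ c] order_refl]
    by (simp add: locally_L2_on_iff borel_measurable_times flip: mult_scaleR_right)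
  show ?thesis
    unfolding sobolev_map_def
    by (intro conjI continuous_intros weak_wirtinger_add_cmult locally_L2_on_add cm f f')
qed

lemma sobolev_map_const: "sobolev_map (\<lambda>_. c) (\<lambda>_. 0) (\<lambda>_. 0)"
  unfolding sobolev_map_def
  by (intro conjI weak_wirtinger_C1 locally_L2_on_continuous continuous_on_const open_UNIV has_wirtinger_const)

text \<open>For smooth \<open>\<Gamma>\<close> this is Stokes' theorem: \<open>\<bar>\<partial>\<Gamma>\<bar>\<^sup>2 - \<bar>\<partial>bar \<Gamma>\<bar>\<^sup>2\<close> is the divergence
  \<open>\<partial>bar (cnj \<Gamma> \<partial>\<Gamma>) - \<partial> (cnj \<Gamma> \<partial>bar \<Gamma>)\<close>. In general it suffices to mollify one of the two factors \<open>\<Gamma>\<close>.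
  The derivatives \<open>P\<close> and \<open>Q\<close> of the mollification are smooth, so \<open>\<eta> cnj P\<close> and \<open>\<eta> cnj Q\<close> can serve
  as test functions for \<open>\<Gamma>\<close>. The second derivatives of the mollification cancel by symmetry, and what
  remains is linear in \<open>P\<close> and \<open>Q\<close>, so that weak convergence is enough for the limit.\<close>

theorem energy_identity:
  assumes \<Gamma>: "sobolev_map \<Gamma> u v" and \<eta>: "smooth \<eta>" "\<And>z. norm z > R \<Longrightarrow> \<eta> z = 0"
  shows "(\<integral>z. (\<eta> z * u z) * cnj (u z) \<partial>lebesgue) - (\<integral>z. (\<eta> z * v z) * cnj (v z) \<partial>lebesgue)
     = (\<integral>z. (dzbar \<eta> z * \<Gamma> z) * cnj (v z) \<partial>lebesgue) - (\<integral>z. (dz \<eta> z * \<Gamma> z) * cnj (u z) \<partial>lebesgue)"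
proof -
  note c\<eta> = smooth_continuous[OF \<eta>(1)] smooth_continuous[OF smooth_dz[OF \<eta>(1)]] smooth_continuous[OF smooth_dzbar[OF \<eta>(1)]]
  have off: "dz \<eta> z = 0" "dzbar \<eta> z = 0" if "norm z > R" for z
    using wirtinger_derivs_zero_off_ball[OF \<eta> that] by auto
  note D = sobolev_mapD[OF \<Gamma>]
  have sq: "square_integrable (\<lambda>z. \<eta> z * u z)" "square_integrable (\<lambda>z. \<eta> z * v z)"
    "square_integrable (\<lambda>z. dz \<eta> z * \<Gamma> z)" "square_integrable (\<lambda>z. dzbar \<eta> z * \<Gamma> z)"
    by (rule square_integrable_mult_continuous[OF _ compact_cball[of 0 R] subset_UNIV]; use D c\<eta> \<eta>(2) off in auto)+
  define P where "P \<epsilon> = mollify \<epsilon> u" for \<epsilon>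
  define Q where "Q \<epsilon> = mollify \<epsilon> v" for \<epsilon>
  have limP: "((\<lambda>\<epsilon>. \<integral>x. w x * cnj (P \<epsilon> x) \<partial>lebesgue) \<longlongrightarrow> (\<integral>x. w x * cnj (u x) \<partial>lebesgue)) (at_right 0)"
    and limQ: "((\<lambda>\<epsilon>. \<integral>x. w x * cnj (Q \<epsilon> x) \<partial>lebesgue) \<longlongrightarrow> (\<integral>x. w x * cnj (v x) \<partial>lebesgue)) (at_right 0)"
    if "square_integrable w" "\<And>z. norm z > R \<Longrightarrow> w z = 0" for w
    unfolding P_def Q_def using mollification_weak_limit_local[OF that D(3)] mollification_weak_limit_local[OF that D(4)]
    by auto
  have eq: "(\<integral>z. (\<eta> z * u z) * cnj (P \<epsilon> z) \<partial>lebesgue) - (\<integral>z. (\<eta> z * v z) * cnj (Q \<epsilon> z) \<partial>lebesgue)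
     = (\<integral>z. (dzbar \<eta> z * \<Gamma> z) * cnj (Q \<epsilon> z) \<partial>lebesgue) - (\<integral>z. (dz \<eta> z * \<Gamma> z) * cnj (P \<epsilon> z) \<partial>lebesgue)"
    if \<epsilon>: "\<epsilon> > 0" for \<epsilon>
  proof -
    define \<rho> where "\<rho> = (\<lambda>z. complex_of_real (mollifier \<epsilon> z))"
    have \<rho>: "smooth \<rho>" "\<And>z. norm z > \<epsilon> \<Longrightarrow> \<rho> z = 0"
      using \<epsilon> by (auto simp: \<rho>_def smooth_mollifier mollifier_zero)
    have \<rho>': "dz \<rho> z = 0" "dzbar \<rho> z = 0" if "norm z > \<epsilon>" for z
      using wirtinger_derivs_zero_off_ball[OF \<rho> that] by auto
    have P: "P \<epsilon> = conv \<Gamma> (dz \<rho>)" and Q: "Q \<epsilon> = conv \<Gamma> (dzbar \<rho>)"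
      using conv_weak_derivative[OF D(2) \<rho>] by (simp_all add: P_def Q_def \<rho>_def)
    note li = D(5)
    have sP: "smooth (P \<epsilon>)" and sQ: "smooth (Q \<epsilon>)"
      unfolding P Q by (rule smooth_conv[OF li]; use \<rho> \<rho>' in \<open>blast intro: smooth_dz smooth_dzbar\<close>)+
    have wP: "has_wirtinger (P \<epsilon>) (conv \<Gamma> (dz (dz \<rho>)) x) (conv \<Gamma> (dzbar (dz \<rho>)) x) x" for x
      unfolding P by (rule conv_has_wirtinger[OF li]; use \<rho> \<rho>' in \<open>blast intro: smooth_dz smooth_dzbar\<close>)
    have wQ: "has_wirtinger (Q \<epsilon>) (conv \<Gamma> (dz (dzbar \<rho>)) x) (conv \<Gamma> (dzbar (dzbar \<rho>)) x) x" for x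
      unfolding Q by (rule conv_has_wirtinger[OF li]; use \<rho> \<rho>' in \<open>blast intro: smooth_dz smooth_dzbar\<close>)
    \<comment> \<open>Both are the same mixed second derivative of the mollification.\<close>
    have mixed: "dzbar (P \<epsilon>) x = dz (Q \<epsilon>) x" for x
      unfolding dzbar_wirtinger[OF wP] dz_wirtinger[OF wQ] \<rho>_def dzbar_dz_mollifier ..
    define \<phi>1 where "\<phi>1 z = \<eta> z * cnj (P \<epsilon> z)" for z
    define \<phi>2 where "\<phi>2 z = \<eta> z * cnj (Q \<epsilon> z)" for z
    have s\<phi>: "smooth \<phi>1" "smooth \<phi>2" unfolding \<phi>1_def \<phi>2_def by (intro smooth_intros \<eta> sP sQ)+
    have t: "test_function_on UNIV \<phi>1" "test_function_on UNIV \<phi>2"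
      by (rule test_functionI[OF s\<phi>(1), of "cball 0 R"]; use \<eta>(2) in \<open>simp add: \<phi>1_def\<close>)
         (rule test_functionI[OF s\<phi>(2), of "cball 0 R"]; use \<eta>(2) in \<open>simp add: \<phi>2_def\<close>)
    have d1: "dz \<phi>1 z = dz \<eta> z * cnj (P \<epsilon> z) + \<eta> z * cnj (dzbar (P \<epsilon>) z)" for z
      unfolding \<phi>1_def by (rule dz_wirtinger[OF has_wirtinger_mult[OF smooth_wirtinger[OF \<eta>(1)] has_wirtinger_cnj[OF smooth_wirtinger[OF sP]]]])
    have d2: "dzbar \<phi>2 z = dzbar \<eta> z * cnj (Q \<epsilon> z) + \<eta> z * cnj (dz (Q \<epsilon>) z)" for z
      unfolding \<phi>2_def by (rule dzbar_wirtinger[OF has_wirtinger_mult[OF smooth_wirtinger[OF \<eta>(1)] has_wirtinger_cnj[OF smooth_wirtinger[OF sQ]]]])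
    have cc: "continuous_on UNIV (\<lambda>z. cnj (P \<epsilon> z))" "continuous_on UNIV (\<lambda>z. cnj (Q \<epsilon> z))" "continuous_on UNIV (\<lambda>z. cnj (dz (Q \<epsilon>) z))"
      by (intro continuous_intros smooth_continuous sP sQ smooth_dz)+
    have i: "integrable lebesgue (\<lambda>z. (dz \<eta> z * \<Gamma> z) * cnj (P \<epsilon> z))"
        "integrable lebesgue (\<lambda>z. (dzbar \<eta> z * \<Gamma> z) * cnj (Q \<epsilon> z))"
        "integrable lebesgue (\<lambda>z. (\<eta> z * \<Gamma> z) * cnj (dz (Q \<epsilon>) z))"
      by (rule integrable_continuous_compact_support[where R = R];
          use \<eta>(2) off in \<open>auto intro!: continuous_on_mult c\<eta> cc D\<close>)+
    have "(\<integral>z. \<Gamma> z * dz \<phi>1 z \<partial>lebesgue) = (\<integral>z. (dz \<eta> z * \<Gamma> z) * cnj (P \<epsilon> z) + (\<eta> z * \<Gamma> z) * cnj (dz (Q \<epsilon>) z) \<partial>lebesgue)"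
      unfolding d1 mixed by (simp add: algebra_simps)
    moreover have "(\<integral>z. \<Gamma> z * dzbar \<phi>2 z \<partial>lebesgue) = (\<integral>z. (dzbar \<eta> z * \<Gamma> z) * cnj (Q \<epsilon> z) + (\<eta> z * \<Gamma> z) * cnj (dz (Q \<epsilon>) z) \<partial>lebesgue)"
      unfolding d2 by (simp add: algebra_simps)
    ultimately have "(\<integral>z. \<Gamma> z * dz \<phi>1 z \<partial>lebesgue) - (\<integral>z. \<Gamma> z * dzbar \<phi>2 z \<partial>lebesgue) =
        (\<integral>z. (dz \<eta> z * \<Gamma> z) * cnj (P \<epsilon> z) \<partial>lebesgue) - (\<integral>z. (dzbar \<eta> z * \<Gamma> z) * cnj (Q \<epsilon> z) \<partial>lebesgue)"
      using i by simp
    moreover have "(\<lambda>z. u z * \<phi>1 z) = (\<lambda>z. (\<eta> z * u z) * cnj (P \<epsilon> z))" "(\<lambda>z. v z * \<phi>2 z) = (\<lambda>z. (\<eta> z * v z) * cnj (Q \<epsilon> z))"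
      by (auto simp: \<phi>1_def \<phi>2_def)
    ultimately show ?thesis
      using weak_wirtingerD(1)[OF D(2) t(1)] weak_wirtingerD(2)[OF D(2) t(2)] by (simp add: algebra_simps)
  qed
  have "((\<lambda>\<epsilon>. (\<integral>z. (\<eta> z * u z) * cnj (P \<epsilon> z) \<partial>lebesgue) - (\<integral>z. (\<eta> z * v z) * cnj (Q \<epsilon> z) \<partial>lebesgue)) \<longlongrightarrow>
     (\<integral>z. (\<eta> z * u z) * cnj (u z) \<partial>lebesgue) - (\<integral>z. (\<eta> z * v z) * cnj (v z) \<partial>lebesgue)) (at_right 0)"
    by (intro tendsto_diff limP limQ sq) (simp_all add: \<eta>(2))
  moreover have "\<forall>\<^sub>F \<epsilon> in at_right 0. (\<integral>z. (\<eta> z * u z) * cnj (P \<epsilon> z) \<partial>lebesgue) - (\<integral>z. (\<eta> z * v z) * cnj (Q \<epsilon> z) \<partial>lebesgue)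
     = (\<integral>z. (dzbar \<eta> z * \<Gamma> z) * cnj (Q \<epsilon> z) \<partial>lebesgue) - (\<integral>z. (dz \<eta> z * \<Gamma> z) * cnj (P \<epsilon> z) \<partial>lebesgue)"
    using eventually_at_right_less[of "0::real"] by eventually_elim (rule eq)
  ultimately have 1: "((\<lambda>\<epsilon>. (\<integral>z. (dzbar \<eta> z * \<Gamma> z) * cnj (Q \<epsilon> z) \<partial>lebesgue) - (\<integral>z. (dz \<eta> z * \<Gamma> z) * cnj (P \<epsilon> z) \<partial>lebesgue)) \<longlongrightarrow>
     (\<integral>z. (\<eta> z * u z) * cnj (u z) \<partial>lebesgue) - (\<integral>z. (\<eta> z * v z) * cnj (v z) \<partial>lebesgue)) (at_right 0)"
    by (rule Lim_transform_eventually)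
  have 2: "((\<lambda>\<epsilon>. (\<integral>z. (dzbar \<eta> z * \<Gamma> z) * cnj (Q \<epsilon> z) \<partial>lebesgue) - (\<integral>z. (dz \<eta> z * \<Gamma> z) * cnj (P \<epsilon> z) \<partial>lebesgue)) \<longlongrightarrow>
     (\<integral>z. (dzbar \<eta> z * \<Gamma> z) * cnj (v z) \<partial>lebesgue) - (\<integral>z. (dz \<eta> z * \<Gamma> z) * cnj (u z) \<partial>lebesgue)) (at_right 0)"
    by (intro tendsto_diff limP limQ sq) (simp_all add: off)
  show ?thesis by (rule tendsto_unique[OF _ 1 2]) simp
qed

lemma square_integrable_indicator_cball: "square_integrable (\<lambda>z. indicator (cball 0 R) z)"
  "(\<integral>z. (norm (indicator (cball (0::complex) R) z :: complex))\<^sup>2 \<partial>lebesgue) = measure lebesgue (cball (0::complex) R)"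
proof -
  have e: "(norm (indicator (cball 0 R) z :: complex))\<^sup>2 = indicator (cball 0 R) z" for z :: complex
    by (simp add: indicator_def)
  show "square_integrable (\<lambda>z. indicator (cball 0 R) z)"
    unfolding square_integrable_def e
    by (auto intro!: integrable_real_indicator borel_measurable_indicator simp: emeasure_lborel_cball_finite[simplified])
  show "(\<integral>z. (norm (indicator (cball (0::complex) R) z :: complex))\<^sup>2 \<partial>lebesgue) = measure lebesgue (cball (0::complex) R)"
    unfolding e by simp
qed

text \<open>The identity is used for \<open>\<eta> = \<bar>\<theta>\<bar>\<^sup>2\<close>. With \<open>X\<close> and \<open>Y\<close> the energies of \<open>\<theta> u\<close> and \<open>\<theta> v\<close>, its left-hand side
  is \<open>X - Y = (sqrt X - sqrt Y) (sqrt X + sqrt Y)\<close>, while the right-hand side contains one factor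
  \<open>\<theta>\<close> and one derivative of \<open>\<theta>\<close>, so that it is bounded by a multiple of \<open>sqrt X + sqrt Y\<close>. Cancelling
  this factor leaves an estimate that presupposes no bound on \<open>X\<close> or \<open>Y\<close>.\<close>

theorem energy_inequality:
  assumes \<Gamma>: "sobolev_map \<Gamma> u v"
    and \<theta>: "smooth \<theta>" "\<And>z. norm z > R \<Longrightarrow> \<theta> z = 0"
    and d: "\<And>z. norm (dz \<theta> z) \<le> d" "\<And>z. norm (dzbar \<theta> z) \<le> d"
    and m: "m \<ge> 0" "\<And>z. dz \<theta> z \<noteq> 0 \<or> dzbar \<theta> z \<noteq> 0 \<Longrightarrow> norm (\<Gamma> z) \<le> m"
  shows "sqrt (energy (\<lambda>z. \<theta> z * u z)) \<le> sqrt (energy (\<lambda>z. \<theta> z * v z))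
     + 2 * d * m * sqrt (measure lebesgue (cball (0::complex) R))"
proof -
  have d0: "d \<ge> 0" using d(1) norm_ge_zero order_trans by blast
  define \<eta> where "\<eta> z = \<theta> z * cnj (\<theta> z)" for z
  have s\<eta>: "smooth \<eta>" unfolding \<eta>_def by (intro smooth_intros \<theta>)
  have \<eta>0: "\<eta> z = 0" if "norm z > R" for z using \<theta>(2)[OF that] by (simp add: \<eta>_def)
  have w\<eta>: "has_wirtinger \<eta> (dz \<theta> z * cnj (\<theta> z) + \<theta> z * cnj (dzbar \<theta> z)) (dzbar \<theta> z * cnj (\<theta> z) + \<theta> z * cnj (dz \<theta> z)) z" for z
    unfolding \<eta>_def by (intro has_wirtinger_mult has_wirtinger_cnj smooth_wirtinger \<theta>)
  have bound: "norm (dz \<eta> z * \<Gamma> z * cnj a) \<le> 2 * d * m * (norm (indicator (cball 0 R) z :: complex) * norm (\<theta> z * a))"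
     "norm (dzbar \<eta> z * \<Gamma> z * cnj a) \<le> 2 * d * m * (norm (indicator (cball 0 R) z :: complex) * norm (\<theta> z * a))" for z a
  proof -
    consider "norm z > R" | "dz \<theta> z = 0 \<and> dzbar \<theta> z = 0" | "norm z \<le> R" "norm (\<Gamma> z) \<le> m" using m(2)[of z] by force
    then have "norm (dz \<eta> z * \<Gamma> z * cnj a) \<le> 2 * d * m * (norm (indicator (cball 0 R) z :: complex) * norm (\<theta> z * a)) \<and>
      norm (dzbar \<eta> z * \<Gamma> z * cnj a) \<le> 2 * d * m * (norm (indicator (cball 0 R) z :: complex) * norm (\<theta> z * a))"
    proof cases
      case 1
      then show ?thesis using wirtinger_derivs_zero_off_ball[OF s\<eta> \<eta>0 1] by simp
    next
      case 2
      then show ?thesis using d0 m by (simp add: dz_wirtinger[OF w\<eta>] dzbar_wirtinger[OF w\<eta>])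
    next
      case 3
      have "norm (dz \<eta> z) \<le> d * norm (\<theta> z) + norm (\<theta> z) * d" "norm (dzbar \<eta> z) \<le> d * norm (\<theta> z) + norm (\<theta> z) * d"
        unfolding dz_wirtinger[OF w\<eta>] dzbar_wirtinger[OF w\<eta>]
        by (rule norm_triangle_le, simp only: norm_mult complex_mod_cnj, intro add_mono mult_left_mono mult_right_mono d norm_ge_zero)+
      then have "norm (dz \<eta> z) * norm (\<Gamma> z) * norm a \<le> (d * norm (\<theta> z) + norm (\<theta> z) * d) * m * norm a"
        "norm (dzbar \<eta> z) * norm (\<Gamma> z) * norm a \<le> (d * norm (\<theta> z) + norm (\<theta> z) * d) * m * norm a"
        using 3 d0 m by (auto intro!: mult_right_mono mult_mono)
      then show ?thesis using 3 by (simp add: norm_mult algebra_simps)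
    qed
    then show "norm (dz \<eta> z * \<Gamma> z * cnj a) \<le> 2 * d * m * (norm (indicator (cball 0 R) z :: complex) * norm (\<theta> z * a))"
     "norm (dzbar \<eta> z * \<Gamma> z * cnj a) \<le> 2 * d * m * (norm (indicator (cball 0 R) z :: complex) * norm (\<theta> z * a))" by auto
  qed
  define X where "X = energy (\<lambda>z. \<theta> z * u z)"
  define Y where "Y = energy (\<lambda>z. \<theta> z * v z)"
  define D where "D = 2 * d * m * sqrt (measure lebesgue (cball (0::complex) R))"
  have XY: "X \<ge> 0" "Y \<ge> 0" "D \<ge> 0" using d0 m by (auto simp: X_def Y_def D_def)
  have c\<theta>: "continuous_on UNIV \<theta>" using \<theta>(1) by (rule smooth_continuous)
  have sq: "square_integrable (\<lambda>z. \<theta> z * u z)" "square_integrable (\<lambda>z. \<theta> z * v z)"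
    by (rule square_integrable_mult_continuous[OF _ compact_cball[of 0 R] subset_UNIV];
        use sobolev_mapD[OF \<Gamma>] c\<theta> \<theta>(2) in auto)+
  have err: "norm (\<integral>z. q z * \<Gamma> z * cnj (a z) \<partial>lebesgue) \<le> D * sqrt (energy (\<lambda>z. \<theta> z * a z))"
    if q: "\<And>z a. norm (q z * \<Gamma> z * cnj a) \<le> 2 * d * m * (norm (indicator (cball 0 R) z :: complex) * norm (\<theta> z * a))"
      and a: "square_integrable (\<lambda>z. \<theta> z * a z)" for q a
  proof -
    note cs = cauchy_schwarz_L2[OF square_integrable_indicator_cball(1)[of R] a]
    have "norm (\<integral>z. q z * \<Gamma> z * cnj (a z) \<partial>lebesgue) \<le> (\<integral>z. 2 * d * m * (norm (indicator (cball 0 R) z :: complex) * norm (\<theta> z * a z)) \<partial>lebesgue)"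
      by (rule order_trans[OF integral_norm_bound integral_mono_AE'])
         (use q integrable_norm[OF cs(1)] d0 m in \<open>auto intro!: AE_I2 mult_nonneg_nonneg simp: norm_mult\<close>)
    also have "\<dots> = 2 * d * m * (\<integral>z. norm (indicator (cball 0 R) z :: complex) * norm (\<theta> z * a z) \<partial>lebesgue)" by simp
    also have "\<dots> \<le> 2 * d * m * (sqrt (measure lebesgue (cball (0::complex) R)) * sqrt (energy (\<lambda>z. \<theta> z * a z)))"
      using cs(2) d0 m unfolding square_integrable_indicator_cball(2) by (intro mult_left_mono) auto
    finally show ?thesis by (simp add: D_def mult.assoc)
  qed
  have e: "(\<eta> z * a) * cnj a = of_real ((norm (\<theta> z * a))\<^sup>2)" for z a
    by (simp only: complex_norm_square \<eta>_def) (simp add: mult_ac)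
  have "complex_of_real X - complex_of_real Y = (\<integral>z. (dzbar \<eta> z * \<Gamma> z) * cnj (v z) \<partial>lebesgue) - (\<integral>z. (dz \<eta> z * \<Gamma> z) * cnj (u z) \<partial>lebesgue)"
    using energy_identity[OF \<Gamma> s\<eta> \<eta>0] unfolding e by (simp add: X_def Y_def del: of_real_power)
  then have "\<bar>X - Y\<bar> = norm ((\<integral>z. (dzbar \<eta> z * \<Gamma> z) * cnj (v z) \<partial>lebesgue) - (\<integral>z. (dz \<eta> z * \<Gamma> z) * cnj (u z) \<partial>lebesgue))"
    by (metis norm_of_real of_real_diff)
  also have "\<dots> \<le> D * sqrt Y + D * sqrt X"
    unfolding X_def Y_def by (rule order_trans[OF norm_triangle_ineq4 add_mono[OF err err]]) (use bound sq in auto)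
  finally have le: "X - Y \<le> D * (sqrt X + sqrt Y)" by (simp add: algebra_simps)
  have "sqrt X \<le> sqrt Y + D"
  proof (rule ccontr)
    assume "\<not> sqrt X \<le> sqrt Y + D"
    then have gt: "sqrt X - sqrt Y > D" by simp
    have pos: "sqrt X + sqrt Y > 0" using gt XY by (smt (verit) real_sqrt_ge_zero)
    have "X - Y = (sqrt X - sqrt Y) * (sqrt X + sqrt Y)" using XY by (simp add: algebra_simps)
    also have "\<dots> > D * (sqrt X + sqrt Y)" using gt pos by (rule mult_strict_right_mono)
    finally show False using le by simp
  qed
  then show ?thesis unfolding X_def Y_def D_def .
qed

lemma measure_cball_complex: "R \<ge> 0 \<Longrightarrow> measure lebesgue (cball (z::complex) R) = pi * R\<^sup>2"
  using content_cball[of R z] by (simp add: unit_ball_vol_2)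

text \<open>The cut-offs are dilations of one function, so their gradients are of size \<open>C / R\<close> on a disc of
  area \<open>O(R\<^sup>2)\<close>. This makes the error in \<open>energy_inequality\<close> a constant multiple of the bound \<open>m\<close>
  for \<open>\<Gamma>\<close> on the support of the gradient. That support recedes to infinity, and \<open>\<Gamma> - c\<close>, which has
  the same weak derivatives as \<open>\<Gamma>\<close>, is small there.\<close>

theorem cutoff_family_exists:
  obtains \<theta> :: "real \<Rightarrow> complex \<Rightarrow> complex" where
    "\<And>R. R > 0 \<Longrightarrow> smooth (\<theta> R)" "\<And>R z. R > 0 \<Longrightarrow> norm z \<le> R \<Longrightarrow> \<theta> R z = 1"
    "\<And>R z. R > 0 \<Longrightarrow> norm z > 4 * R \<Longrightarrow> \<theta> R z = 0"
    "\<And>\<Gamma> u v c e. sobolev_map \<Gamma> u v \<Longrightarrow> (\<Gamma> \<longlongrightarrow> c) at_infinity \<Longrightarrow> e > 0 \<Longrightarrow>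
       \<forall>\<^sub>F R in at_top. sqrt (energy (\<lambda>z. \<theta> R z * u z)) \<le> sqrt (energy (\<lambda>z. \<theta> R z * v z)) + e"
proof -
  obtain \<tau> where \<tau>: "smooth \<tau>" "\<And>z. norm z \<le> 1 \<Longrightarrow> \<tau> z = 1" "\<And>z. norm z > 4 \<Longrightarrow> \<tau> z = 0"
    using smooth_cutoff_exists by blast
  have off: "dz \<tau> z = 0" "dzbar \<tau> z = 0" if "norm z > 4" for z
    using wirtinger_derivs_zero_off_ball[OF \<tau>(1,3) that] by auto
  obtain C1 where C1: "C1 > 0" "\<And>z. norm (dz \<tau> z) \<le> C1"
    using continuous_compact_support_bounded[OF smooth_continuous[OF smooth_dz[OF \<tau>(1)]] off(1)] by blast
  obtain C2 where C2: "C2 > 0" "\<And>z. norm (dzbar \<tau> z) \<le> C2"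
    using continuous_compact_support_bounded[OF smooth_continuous[OF smooth_dzbar[OF \<tau>(1)]] off(2)] by blast
  define C where "C = max C1 C2"
  have C: "C > 0" "norm (dz \<tau> z) \<le> C" "norm (dzbar \<tau> z) \<le> C" for z
    using C1 C2 by (auto simp: C_def le_max_iff_disj)
  have inner: "dz \<tau> z = 0" "dzbar \<tau> z = 0" if "norm z < 1" for z
  proof -
    have "has_wirtinger \<tau> 0 0 z"
      by (rule has_wirtinger_transform[OF has_wirtinger_const[of 1], of "ball 0 1"]) (use that \<tau>(2) in auto)
    then show "dz \<tau> z = 0" "dzbar \<tau> z = 0" using dz_wirtinger dzbar_wirtinger by blast+
  qed
  define \<theta> where "\<theta> R z = \<tau> (of_real (1 / R) * z + 0)" for R z
  have w: "has_wirtinger (\<theta> R) (of_real (1 / R) * dz \<tau> (of_real (1 / R) * z + 0))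
     (cnj (of_real (1 / R)) * dzbar \<tau> (of_real (1 / R) * z + 0)) z" for R z
    unfolding \<theta>_def by (intro has_wirtinger_affine smooth_wirtinger \<tau>)
  have nrm: "norm (of_real (1 / R) * z + 0) = norm z / R" if "R > 0" for R and z :: complex
    using that by (simp add: norm_divide)
  have s\<theta>: "smooth (\<theta> R)" for R unfolding \<theta>_def by (intro smooth_affine \<tau>)
  have z\<theta>: "\<theta> R z = 0" if "R > 0" "norm z > 4 * R" for R z
  proof -
    have "norm (of_real (1 / R) * z + 0) > 4" unfolding nrm[OF that(1)] using that by (simp add: field_simps)
    then show ?thesis unfolding \<theta>_def by (rule \<tau>(3))
  qed
  show ?thesis
  proof (rule that[of \<theta>])
    show "smooth (\<theta> R)" for R by (rule s\<theta>)
    show "\<theta> R z = 1" if "R > 0" "norm z \<le> R" for R z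
    proof -
      have "norm (of_real (1 / R) * z + 0) \<le> 1" unfolding nrm[OF that(1)] using that by (simp add: field_simps)
      then show ?thesis unfolding \<theta>_def by (rule \<tau>(2))
    qed
    show "\<theta> R z = 0" if "R > 0" "norm z > 4 * R" for R z by (rule z\<theta>[OF that])
    fix \<Gamma> u v c and e :: real
    assume \<Gamma>: "sobolev_map \<Gamma> u v" and lim: "(\<Gamma> \<longlongrightarrow> c) at_infinity" and e: "e > 0"
    \<comment> \<open>The error term for cut-off radius \<open>4 R\<close> and gradient bound \<open>C / R\<close> is \<open>2 (C / R) m (4 R sqrt \<pi>)\<close>.\<close>
    define m where "m = e / (8 * C * sqrt pi)"
    have m: "m > 0" using e C(1) by (simp add: m_def)
    have "\<forall>\<^sub>F z in at_infinity. dist (\<Gamma> z) c < m" using lim m by (rule tendstoD)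
    then obtain R0 where R0: "\<And>z. norm z \<ge> R0 \<Longrightarrow> norm (\<Gamma> z - c) \<le> m"
      unfolding eventually_at_infinity by (auto simp: dist_norm intro: less_imp_le)
    show "\<forall>\<^sub>F R in at_top. sqrt (energy (\<lambda>z. \<theta> R z * u z)) \<le> sqrt (energy (\<lambda>z. \<theta> R z * v z)) + e"
      using eventually_ge_at_top[of "max R0 1"]
    proof eventually_elim
      case (elim R)
      then have R: "R \<ge> R0" "R > 0" by auto
      have "sqrt (energy (\<lambda>z. \<theta> R z * u z)) \<le> sqrt (energy (\<lambda>z. \<theta> R z * v z))
        + 2 * (C / R) * m * sqrt (measure lebesgue (cball (0::complex) (4 * R)))"
      proof (rule energy_inequality[where \<Gamma> = "\<lambda>z. \<Gamma> z - c"])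
        show "sobolev_map (\<lambda>z. \<Gamma> z - c) u v"
          using sobolev_map_add_cmult[OF \<Gamma> sobolev_map_const[of c], of "- 1"] by simp
        show "norm (dz (\<theta> R) z) \<le> C / R" "norm (dzbar (\<theta> R) z) \<le> C / R" for z
          unfolding dz_wirtinger[OF w] dzbar_wirtinger[OF w] using R C by (auto simp: norm_mult norm_divide divide_right_mono)
        show "norm (\<Gamma> z - c) \<le> m" if "dz (\<theta> R) z \<noteq> 0 \<or> dzbar (\<theta> R) z \<noteq> 0" for z
        proof -
          have "norm (of_real (1 / R) * z + 0) \<ge> 1"
            using that inner[of "of_real (1 / R) * z + 0"] unfolding dz_wirtinger[OF w] dzbar_wirtinger[OF w] by fastforce
          then have "norm z \<ge> R" unfolding nrm[OF R(2)] using R by (simp add: field_simps)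
          then show ?thesis using R0 R by simp
        qed
      qed (use s\<theta> z\<theta> R m in auto)
      also have "2 * (C / R) * m * sqrt (measure lebesgue (cball (0::complex) (4 * R))) = e"
      proof -
        have "sqrt (measure lebesgue (cball (0::complex) (4 * R))) = sqrt pi * (4 * R)"
          using R measure_cball_complex[of "4 * R" 0] by (simp add: real_sqrt_mult)
        then show ?thesis using R C(1) by (simp only:) (simp add: m_def)
      qed
      finally show ?case .
    qed
  qed
qed

section \<open>The Bergman kernel of a disc\<close>

text \<open>A segment from the disc to its exterior meets the circle, where \<open>f\<close> vanishes.\<close>

lemma lipschitz_zero_extension:
  fixes f :: "complex \<Rightarrow> complex"
  assumes f: "L-lipschitz_on (cball 0 r) f" and sph: "\<And>w. norm w = r \<Longrightarrow> f w = 0" and r: "r > 0"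
  shows "L-lipschitz_on UNIV (\<lambda>w. if norm w \<le> r then f w else 0)" (is "lipschitz_on L UNIV ?F")
proof (rule lipschitz_onI)
  show L: "0 \<le> L" using f by (rule lipschitz_on_nonneg)
  have one: "dist (?F x) (?F y) \<le> L * dist x y" if x: "norm x \<le> r" and y: "norm y > r" for x y
  proof -
    have "connected (closed_segment x y)" by simp
    moreover have "closed_segment x y \<inter> ball 0 r \<noteq> {} \<or> norm x = r" using x by force
    ultimately have "norm x = r \<or> closed_segment x y \<inter> frontier (ball 0 r) \<noteq> {}"
      using connected_Int_frontier[of "closed_segment x y" "ball 0 r"] y by fastforce
    then obtain c where c: "c \<in> closed_segment x y" "norm c = r"
      using r by (force simp: frontier_ball)
    have "dist (?F x) (?F y) = dist (f x) (f c)" using x y c sph by simp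
    also have "\<dots> \<le> L * dist x c" by (rule lipschitz_onD[OF f]) (use x c in auto)
    also have "\<dots> \<le> L * dist x y"
      using c L by (intro mult_left_mono) (auto simp: dist_in_closed_segment dist_commute)
    finally show ?thesis .
  qed
  fix x y :: complex
  consider "norm x \<le> r" "norm y \<le> r" | "norm x \<le> r" "norm y > r" | "norm x > r" "norm y \<le> r" | "norm x > r" "norm y > r"
    by linarith
  then show "dist (?F x) (?F y) \<le> L * dist x y"
  proof cases
    case 1
    then show ?thesis using lipschitz_onD[OF f, of x y] by simp
  next
    case 2
    then show ?thesis by (rule one)
  next
    case 3
    then show ?thesis using one[of y x] by (simp only: dist_commute)
  next
    case 4
    then show ?thesis using L by simp
  qed
qed

lemma AE_norm_neq: "AE z in lebesgue. norm (z::complex) \<noteq> r"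
proof -
  have "sphere (0::complex) r \<in> null_sets lebesgue"
    using negligible_sphere[of "0::complex" r] by (simp add: negligible_iff_null_sets)
  then have "AE z in lebesgue. z \<notin> sphere (0::complex) r" by (rule AE_not_in)
  then show ?thesis by eventually_elim simp
qed

text \<open>This is \<open>\<pi>\<close> times the reproducing kernel of the Bergman space of the disc of radius \<open>r\<close>, as a
  function of its second, antiholomorphic variable.\<close>

definition bergman_kernel :: "real \<Rightarrow> complex \<Rightarrow> complex \<Rightarrow> complex" where
  "bergman_kernel r z\<^sub>0 w = (of_real r)\<^sup>2 / ((of_real r)\<^sup>2 - z\<^sub>0 * cnj w)\<^sup>2"

lemma bergman_kernel_denominator:
  assumes "norm z\<^sub>0 < r" "norm w \<le> r"
  shows "(of_real r)\<^sup>2 - z\<^sub>0 * cnj w \<noteq> 0"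
proof
  assume "(of_real r)\<^sup>2 - z\<^sub>0 * cnj w = 0"
  then have "norm ((of_real r)\<^sup>2 :: complex) = norm z\<^sub>0 * norm w"
    by (metis complex_mod_cnj eq_iff_diff_eq_0 norm_mult)
  moreover have "r > 0" using assms(1) norm_ge_zero le_less_trans by blast
  ultimately have "r * r = norm z\<^sub>0 * norm w" by (simp add: norm_power power2_eq_square norm_mult)
  moreover note \<open>r > 0\<close>
  then have "norm z\<^sub>0 * norm w < r * r"
    by (rule le_less_trans[OF mult_left_mono[OF assms(2) norm_ge_zero] mult_strict_right_mono[OF assms(1)]])
  ultimately show False by simp
qed

text \<open>The kernel is the \<open>dzbar\<close>-derivative of \<open>m w = cnj w / (r\<^sup>2 - z\<^sub>0 cnj w)\<close>, which on the circle
  \<open>cnj w = r\<^sup>2 / w\<close> coincides with \<open>1 / (w - z\<^sub>0)\<close>. Therefore \<open>(g - g z\<^sub>0) m\<close> and the holomorphic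
  function \<open>q = (g - g z\<^sub>0) / (w - z\<^sub>0)\<close> agree on the circle. Their difference extends by zero to a
  Lipschitz function with the integrand as its \<open>dzbar\<close>-derivative.\<close>

lemma bergman_kernel_annihilates:
  assumes S: "open S" "cball 0 r \<subseteq> S" and g: "g holomorphic_on S" and z0: "norm z\<^sub>0 < r"
  shows "(\<integral>w. indicator (cball 0 r) w *\<^sub>R ((g w - g z\<^sub>0) * bergman_kernel r z\<^sub>0 w) \<partial>lebesgue) = 0"
proof -
  have r: "r > 0" using z0 norm_ge_zero le_less_trans by blast
  have z0S: "z\<^sub>0 \<in> S" using S z0 by auto
  define q where "q w = (if w = z\<^sub>0 then deriv g z\<^sub>0 else (g w - g z\<^sub>0) / (w - z\<^sub>0))" for w
  have q: "q holomorphic_on S" unfolding q_def by (rule pole_lemma_open[OF g S(1)])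
  define T where "T = {w \<in> S. (of_real r)\<^sup>2 - z\<^sub>0 * cnj w \<noteq> 0}"
  have T: "open T"
  proof -
    have "T = S \<inter> (\<lambda>w. (of_real r)\<^sup>2 - z\<^sub>0 * cnj w) -` (- {0})" by (auto simp: T_def)
    also have "open \<dots>"
      by (rule continuous_open_preimage[OF _ S(1)]) (auto intro!: continuous_intros)
    finally show ?thesis .
  qed
  have cT: "cball 0 r \<subseteq> T"
  proof
    fix w :: complex assume "w \<in> cball 0 r"
    then show "w \<in> T" using S(2) bergman_kernel_denominator[OF z0, of w] unfolding T_def by fastforce
  qed
  define m where "m w = cnj w / ((of_real r)\<^sup>2 - z\<^sub>0 * cnj w)" for w
  define p where "p w = (g w - g z\<^sub>0) * m w + (- 1) * q w" for w
  define a where "a w = deriv g w * m w + (- 1) * deriv q w" for w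
  define b where "b w = (g w - g z\<^sub>0) * bergman_kernel r z\<^sub>0 w" for w
  have wm: "has_wirtinger m 0 (bergman_kernel r z\<^sub>0 w) w" if "w \<in> T" for w
  proof -
    have nz: "(of_real r)\<^sup>2 - cnj z\<^sub>0 * w \<noteq> 0"
      using that complex_cnj_cancel_iff[of "(of_real r)\<^sup>2 - cnj z\<^sub>0 * w" 0] by (simp add: T_def)
    have "((\<lambda>w. w / ((of_real r)\<^sup>2 - cnj z\<^sub>0 * w)) has_field_derivative (of_real r)\<^sup>2 / ((of_real r)\<^sup>2 - cnj z\<^sub>0 * w)\<^sup>2) (at w)"
      using nz by (auto intro!: derivative_eq_intros simp: power2_eq_square algebra_simps)
    from has_wirtinger_cnj[OF has_wirtinger_field_derivative[OF this]]
    show ?thesis by (simp add: m_def[abs_def] bergman_kernel_def)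
  qed
  have wh: "has_wirtinger h (deriv h w) 0 w" if "h holomorphic_on S" "w \<in> T" for h w
    using that S(1) by (intro has_wirtinger_field_derivative holomorphic_derivI[of h S]) (auto simp: T_def)
  have wp: "has_wirtinger p (a w) (b w) w" if w: "w \<in> T" for w
  proof -
    have "has_wirtinger (\<lambda>w. g w - g z\<^sub>0) (deriv g w) 0 w"
      using has_wirtinger_add[OF wh[OF g w] has_wirtinger_const[of "- g z\<^sub>0"]] by simp
    from has_wirtinger_add[OF has_wirtinger_mult[OF this wm[OF w]] has_wirtinger_mult[OF has_wirtinger_const[of "- 1"] wh[OF q w]]]
    show ?thesis by (simp add: p_def[abs_def] a_def b_def)
  qed
  have cm: "continuous_on (cball 0 r) m" and ck: "continuous_on (cball 0 r) (bergman_kernel r z\<^sub>0)"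
    unfolding m_def bergman_kernel_def
    by (intro continuous_intros; use bergman_kernel_denominator[OF z0] in auto)+
  have cg: "continuous_on (cball 0 r) g" "continuous_on (cball 0 r) (deriv g)" "continuous_on (cball 0 r) (deriv q)"
    by (rule continuous_on_subset[OF holomorphic_on_imp_continuous_on S(2)]; use S(1) g q in \<open>blast intro: holomorphic_deriv\<close>)+
  have ca: "continuous_on (cball 0 r) a" and cb: "continuous_on (cball 0 r) b"
    unfolding a_def b_def by (intro continuous_intros cm ck cg)+
  obtain A where A: "A > 0" "\<And>w. w \<in> cball 0 r \<Longrightarrow> norm (a w) \<le> A"
    using compact_imp_bounded[OF compact_continuous_image[OF ca compact_cball]] unfolding bounded_pos by auto
  obtain B where B: "B > 0" "\<And>w. w \<in> cball 0 r \<Longrightarrow> norm (b w) \<le> B"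
    using compact_imp_bounded[OF compact_continuous_image[OF cb compact_cball]] unfolding bounded_pos by auto
  have "(A + B)-lipschitz_on (cball 0 r) p"
    by (rule wirtinger_bounded_imp_lipschitz[OF convex_cball, of 0 r p a b])
       (use A B wp cT in auto)
  moreover have "p w = 0" if w: "norm w = r" for w
  proof -
    have w0: "w \<noteq> 0" "w \<noteq> z\<^sub>0" using w r z0 by auto
    have ww: "(of_real r)\<^sup>2 = w * cnj w" using w complex_norm_square[of w] by simp
    have "m w = cnj w / (cnj w * (w - z\<^sub>0))" unfolding m_def ww by (simp add: algebra_simps)
    also have "\<dots> = 1 / (w - z\<^sub>0)" using w0 by simp
    finally show ?thesis using w0 by (simp add: p_def q_def flip: add_divide_distrib)
  qed
  ultimately have lip: "(A + B)-lipschitz_on UNIV (\<lambda>w. if norm w \<le> r then p w else 0)"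
    using r by (rule lipschitz_zero_extension)
  have ae: "AE w in lebesgue. has_wirtinger (\<lambda>w. if norm w \<le> r then p w else 0)
     (indicator (cball 0 r) w *\<^sub>R a w) (indicator (cball 0 r) w *\<^sub>R b w) w"
    using AE_norm_neq[of r]
  proof eventually_elim
    case (elim w)
    then consider "norm w < r" | "norm w > r" by linarith
    then show ?case
    proof cases
      case 1
      have "has_wirtinger p (a w) (b w) w" by (rule wp) (use 1 cT in auto)
      then have "has_wirtinger (\<lambda>w. if norm w \<le> r then p w else 0) (a w) (b w) w"
        by (rule has_wirtinger_transform[of _ _ _ _ "ball 0 r"]) (use 1 in auto)
      then show ?thesis using 1 by simp
    next
      case 2
      have "has_wirtinger (\<lambda>w. if norm w \<le> r then p w else 0) 0 0 w"
        by (rule wirtinger_zero_off_support[of "cball 0 r"]) (use 2 in auto)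
      then show ?thesis using 2 by simp
    qed
  qed
  show ?thesis
    using lipschitz_wirtinger_integral(4)[OF lip _ ae, of r] by (simp add: b_def)
qed

lemma continuous_on_bergman_kernel: "norm z\<^sub>0 < r \<Longrightarrow> continuous_on (cball 0 r) (bergman_kernel r z\<^sub>0)"
  unfolding bergman_kernel_def by (intro continuous_intros) (use bergman_kernel_denominator in auto)

lemma cnj_bergman_kernel_holomorphic:
  assumes "norm z\<^sub>0 < r"
  obtains S where "open S" "cball 0 r \<subseteq> S" "(\<lambda>w. cnj (bergman_kernel r z\<^sub>0 w)) holomorphic_on S"
proof
  define S where "S = {w. (of_real r)\<^sup>2 - cnj z\<^sub>0 * w \<noteq> 0}"
  have "S = (\<lambda>w. (of_real r)\<^sup>2 - cnj z\<^sub>0 * w) -` (- {0})" by (auto simp: S_def)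
  also have "open \<dots>" by (rule open_vimage) (auto intro!: continuous_intros)
  finally show "open S" .
  show "cball 0 r \<subseteq> S"
  proof
    fix w :: complex assume "w \<in> cball 0 r"
    then show "w \<in> S" using bergman_kernel_denominator[of "cnj z\<^sub>0" r "cnj w"] assms by (simp add: S_def)
  qed
  have "(\<lambda>w. (of_real r)\<^sup>2 / ((of_real r)\<^sup>2 - cnj z\<^sub>0 * w)\<^sup>2) holomorphic_on S"
    by (intro holomorphic_intros) (auto simp: S_def)
  then show "(\<lambda>w. cnj (bergman_kernel r z\<^sub>0 w)) holomorphic_on S" by (simp add: bergman_kernel_def)
qed

lemma indicator_mult_square: "indicator A w *\<^sub>R (x * y :: complex) = (indicator A w *\<^sub>R x) * (indicator A w *\<^sub>R y)"
  by (simp add: indicator_def)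

text \<open>It remains to integrate the kernel itself, and this is \<open>bergman_kernel_annihilates\<close> once more, for
  the conjugate kernel in the place of \<open>g\<close> and for the centre, at which the kernel is constant.\<close>

theorem bergman_reproducing:
  assumes S: "open S" "cball 0 r \<subseteq> S" and g: "g holomorphic_on S" and z0: "norm z\<^sub>0 < r"
  shows "(\<integral>w. indicator (cball 0 r) w *\<^sub>R (g w * bergman_kernel r z\<^sub>0 w) \<partial>lebesgue) = of_real pi * g z\<^sub>0"
proof -
  have r: "r > 0" using z0 norm_ge_zero le_less_trans by blast
  let ?I = "\<lambda>f. \<integral>w. indicator (cball (0::complex) r) w *\<^sub>R (f w :: complex) \<partial>lebesgue"
  have int: "integrable lebesgue (\<lambda>w::complex. indicator (cball 0 r) w *\<^sub>R (f w * h w :: complex))"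
    if "continuous_on (cball 0 r) f" "continuous_on (cball 0 r) h" for f h
    unfolding indicator_mult_square
    by (rule cauchy_schwarz_L2(1)[OF square_integrable_indicator_continuous[OF compact_cball that(1)]
          square_integrable_indicator_continuous[OF compact_cball that(2)]])
  note ck = continuous_on_bergman_kernel[OF z0]
  define g1 where "g1 w = cnj (bergman_kernel r z\<^sub>0 w)" for w
  obtain S1 where S1: "open S1" "cball 0 r \<subseteq> S1" "g1 holomorphic_on S1"
    unfolding g1_def by (rule cnj_bergman_kernel_holomorphic[OF z0])
  have cg1: "continuous_on (cball 0 r) g1"
    unfolding g1_def by (intro continuous_intros ck)
  have "?I (\<lambda>w. (g1 w - g1 0) * bergman_kernel r 0 w) = 0"
    by (rule bergman_kernel_annihilates[OF S1]) (use r in simp)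
  moreover have "(\<lambda>w. indicator (cball 0 r) w *\<^sub>R ((g1 w - g1 0) * bergman_kernel r 0 w)) =
    (\<lambda>w. indicator (cball 0 r) w *\<^sub>R (g1 w * of_real (1 / r\<^sup>2)) - indicator (cball 0 r) w *\<^sub>R (of_real (1 / r\<^sup>2) * of_real (1 / r\<^sup>2)))"
  proof -
    have c: "g1 0 = of_real (1 / r\<^sup>2)" "bergman_kernel r 0 w = of_real (1 / r\<^sup>2)" for w
      using r by (simp_all add: g1_def bergman_kernel_def power2_eq_square)
    show ?thesis unfolding c by (simp only: left_diff_distrib scaleR_diff_right)
  qed
  ultimately have "?I (\<lambda>w. g1 w * of_real (1 / r\<^sup>2)) - ?I (\<lambda>w. of_real (1 / r\<^sup>2) * of_real (1 / r\<^sup>2)) = 0"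
    by (simp only: Bochner_Integration.integral_diff[OF int[OF cg1 continuous_on_const] int[OF continuous_on_const continuous_on_const]])
  moreover have "?I (\<lambda>w. of_real (1 / r\<^sup>2) * of_real (1 / r\<^sup>2)) = complex_of_real (pi * r\<^sup>2 / (r\<^sup>2 * r\<^sup>2))"
  proof -
    have "?I (\<lambda>_. c) = measure lebesgue (cball (0::complex) r) *\<^sub>R c" for c
      by (subst integral_scaleR_left) (auto intro!: integrable_real_indicator simp: emeasure_lborel_cball_finite[simplified])
    then show ?thesis using r measure_cball_complex[of r 0] by (simp add: scaleR_conv_of_real)
  qed
  moreover have "?I (\<lambda>w. g1 w * of_real (1 / r\<^sup>2)) = ?I g1 * of_real (1 / r\<^sup>2)"
    by (simp only: mult_scaleR_left[symmetric] integral_mult_left_zero)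
  ultimately have "?I g1 * of_real (1 / r\<^sup>2) = complex_of_real (pi * r\<^sup>2 / (r\<^sup>2 * r\<^sup>2))"
    by (simp only: right_minus_eq)
  also have "pi * r\<^sup>2 / (r\<^sup>2 * r\<^sup>2) = pi * (1 / r\<^sup>2)" using r by (simp add: field_simps power2_eq_square)
  finally have "?I g1 * of_real (1 / r\<^sup>2) = complex_of_real pi * of_real (1 / r\<^sup>2)"
    by (simp only: of_real_mult)
  moreover have "complex_of_real (1 / r\<^sup>2) \<noteq> 0" using r by simp
  ultimately have "?I g1 = of_real pi" using mult_right_cancel by blast
  moreover have "?I (bergman_kernel r z\<^sub>0) = cnj (?I g1)"
  proof -
    have e: "(\<lambda>w. indicator (cball 0 r) w *\<^sub>R bergman_kernel r z\<^sub>0 w) = (\<lambda>w. cnj (indicator (cball 0 r) w *\<^sub>R g1 w))"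
      by (simp add: g1_def)
    show ?thesis unfolding e by (rule Bochner_Integration.integral_cnj)
  qed
  ultimately have one: "?I (bergman_kernel r z\<^sub>0) = of_real pi" by simp
  have cg: "continuous_on (cball 0 r) g"
    using holomorphic_on_imp_continuous_on[OF g] S(2) continuous_on_subset by blast
  have "?I (\<lambda>w. (g w - g z\<^sub>0) * bergman_kernel r z\<^sub>0 w) = ?I (\<lambda>w. g w * bergman_kernel r z\<^sub>0 w) - ?I (\<lambda>w. g z\<^sub>0 * bergman_kernel r z\<^sub>0 w)"
    using int[OF cg ck] int[OF continuous_on_const ck]
    by (subst Bochner_Integration.integral_diff[symmetric]) (simp_all add: algebra_simps)
  moreover have "?I (\<lambda>w. g z\<^sub>0 * bergman_kernel r z\<^sub>0 w) = g z\<^sub>0 * ?I (bergman_kernel r z\<^sub>0)"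
    by (simp only: mult_scaleR_right[symmetric] integral_mult_right_zero)
  ultimately show ?thesis using bergman_kernel_annihilates[OF S g z0] one by simp
qed

text \<open>The kernel reproduces its own conjugate.\<close>

lemma energy_bergman_kernel:
  assumes "norm z\<^sub>0 < r"
  shows "energy (\<lambda>w. indicator (cball 0 r) w *\<^sub>R bergman_kernel r z\<^sub>0 w) = pi * r\<^sup>2 / (r\<^sup>2 - (norm z\<^sub>0)\<^sup>2)\<^sup>2"
proof -
  obtain S where S: "open S" "cball 0 r \<subseteq> S" "(\<lambda>w. cnj (bergman_kernel r z\<^sub>0 w)) holomorphic_on S"
    by (rule cnj_bergman_kernel_holomorphic[OF assms])
  have "complex_of_real (energy (\<lambda>w. indicator (cball 0 r) w *\<^sub>R bergman_kernel r z\<^sub>0 w))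
     = (\<integral>w. indicator (cball 0 r) w *\<^sub>R (cnj (bergman_kernel r z\<^sub>0 w) * bergman_kernel r z\<^sub>0 w) \<partial>lebesgue)"
    unfolding integral_complex_of_real[symmetric]
  proof (rule Bochner_Integration.integral_cong)
    fix w
    show "complex_of_real ((norm (indicator (cball 0 r) w *\<^sub>R bergman_kernel r z\<^sub>0 w))\<^sup>2) =
      indicator (cball 0 r) w *\<^sub>R (cnj (bergman_kernel r z\<^sub>0 w) * bergman_kernel r z\<^sub>0 w)"
      by (cases "w \<in> cball 0 r") (simp_all add: complex_norm_square mult.commute del: of_real_power)
  qed simp
  also have "\<dots> = of_real pi * cnj (bergman_kernel r z\<^sub>0 z\<^sub>0)" by (rule bergman_reproducing[OF S assms])
  also have "\<dots> = complex_of_real (pi * r\<^sup>2 / (r\<^sup>2 - (norm z\<^sub>0)\<^sup>2)\<^sup>2)"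
  proof -
    have e: "cnj z\<^sub>0 * z\<^sub>0 = of_real ((norm z\<^sub>0)\<^sup>2)" by (simp only: complex_norm_square mult.commute)
    have "cnj (bergman_kernel r z\<^sub>0 z\<^sub>0) = (of_real r)\<^sup>2 / ((of_real r)\<^sup>2 - cnj z\<^sub>0 * z\<^sub>0)\<^sup>2"
      by (simp add: bergman_kernel_def)
    then show ?thesis unfolding e by simp
  qed
  finally show ?thesis by (simp only: of_real_eq_iff)
qed

theorem bergman_bound:
  assumes S: "open S" "cball 0 r \<subseteq> S" and g: "g holomorphic_on S" and z0: "norm z\<^sub>0 < r"
    and A: "energy (\<lambda>w. indicator (cball 0 r) w *\<^sub>R g w) \<le> A"
  shows "norm (g z\<^sub>0) \<le> sqrt (A / pi) * (r / (r\<^sup>2 - (norm z\<^sub>0)\<^sup>2))"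
proof -
  have r: "r > 0" using z0 norm_ge_zero le_less_trans by blast
  have d: "r\<^sup>2 - (norm z\<^sub>0)\<^sup>2 > 0" using z0 by (simp add: power_strict_mono)
  have cg: "continuous_on (cball 0 r) g"
    using holomorphic_on_imp_continuous_on[OF g] S(2) continuous_on_subset by blast
  note sq = square_integrable_indicator_continuous[OF compact_cball cg]
    square_integrable_indicator_continuous[OF compact_cball continuous_on_bergman_kernel[OF z0]]
  have "norm (g z\<^sub>0) * pi = norm (\<integral>w. indicator (cball 0 r) w *\<^sub>R (g w * bergman_kernel r z\<^sub>0 w) \<partial>lebesgue)"
    unfolding bergman_reproducing[OF S g z0] by (simp add: norm_mult)
  also have "\<dots> \<le> sqrt (energy (\<lambda>w. indicator (cball 0 r) w *\<^sub>R g w)) * sqrt (pi * r\<^sup>2 / (r\<^sup>2 - (norm z\<^sub>0)\<^sup>2)\<^sup>2)"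
    unfolding indicator_mult_square energy_bergman_kernel[OF z0, symmetric]
    by (rule cauchy_schwarz_L2(3)[OF sq])
  also have "\<dots> \<le> sqrt A * sqrt (pi * r\<^sup>2 / (r\<^sup>2 - (norm z\<^sub>0)\<^sup>2)\<^sup>2)"
    using A by (intro mult_right_mono) auto
  also have "\<dots> = sqrt A * (sqrt pi * (r / (r\<^sup>2 - (norm z\<^sub>0)\<^sup>2)))"
    using r d unfolding real_sqrt_mult real_sqrt_divide real_sqrt_abs
    by (simp only: abs_of_pos times_divide_eq_right)
  finally have "norm (g z\<^sub>0) \<le> sqrt A * (sqrt pi * (r / (r\<^sup>2 - (norm z\<^sub>0)\<^sup>2))) / pi"
    by (rule mult_imp_le_div_pos[OF pi_gt_zero])
  also have "\<dots> = sqrt (A / pi) * (r / (r\<^sup>2 - (norm z\<^sub>0)\<^sup>2))"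
  proof -
    have "sqrt A * (sqrt pi * x) / pi = sqrt (A / pi) * x" for x
    proof -
      have "sqrt A * (sqrt pi * x) / (sqrt pi * sqrt pi) = sqrt A / sqrt pi * x"
        by (simp add: field_simps del: real_sqrt_mult_self)
      then show ?thesis by (simp add: real_sqrt_divide)
    qed
    then show ?thesis .
  qed
  finally show ?thesis .
qed

text \<open>On the closed discs of radius \<open>r < 1\<close> this is \<open>bergman_bound\<close>; then \<open>r\<close> tends to \<open>1\<close>.\<close>

lemma bergman_bound_unit_disc:
  assumes g: "g holomorphic_on ball 0 1" and z0: "norm z\<^sub>0 < 1"
    and sq: "square_integrable (\<lambda>z. indicator (ball 0 1) z *\<^sub>R g z)"
    and A: "energy (\<lambda>z. indicator (ball 0 1) z *\<^sub>R g z) \<le> A"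
  shows "norm (g z\<^sub>0) \<le> sqrt (A / pi) / (1 - (norm z\<^sub>0)\<^sup>2)"
proof -
  have le: "norm (g z\<^sub>0) \<le> sqrt (A / pi) * (r / (r\<^sup>2 - (norm z\<^sub>0)\<^sup>2))" if r: "norm z\<^sub>0 < r" "r < 1" for r
  proof (rule bergman_bound[OF open_ball _ g r(1)])
    show sub: "cball 0 r \<subseteq> ball (0::complex) 1" using r by auto
    have c: "continuous_on (cball 0 r) g"
      using holomorphic_on_imp_continuous_on[OF g] sub continuous_on_subset by blast
    have "energy (\<lambda>w. indicator (cball 0 r) w *\<^sub>R g w) \<le> energy (\<lambda>z. indicator (ball 0 1) z *\<^sub>R g z)"
    proof (rule integral_mono)
      show "integrable lebesgue (\<lambda>w. (norm (indicator (cball 0 r) w *\<^sub>R g w))\<^sup>2)"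
        using square_integrable_indicator_continuous[OF compact_cball c] by (simp add: square_integrable_def)
      show "(norm (indicator (cball 0 r) w *\<^sub>R g w))\<^sup>2 \<le> (norm (indicator (ball 0 1) w *\<^sub>R g w))\<^sup>2" for w
        using sub by (cases "w \<in> cball 0 r") auto
    qed (use sq in \<open>simp add: square_integrable_def\<close>)
    then show "energy (\<lambda>w. indicator (cball 0 r) w *\<^sub>R g w) \<le> A" using A by linarith
  qed
  have "((\<lambda>r. sqrt (A / pi) * (r / (r\<^sup>2 - (norm z\<^sub>0)\<^sup>2))) \<longlongrightarrow> sqrt (A / pi) * (1 / (1\<^sup>2 - (norm z\<^sub>0)\<^sup>2))) (at_left 1)"
    using z0 by (intro tendsto_intros) (simp add: abs_square_eq_1)
  moreover have "\<forall>\<^sub>F r in at_left 1. r \<in> {norm z\<^sub>0<..<1}"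
    using z0 by (rule eventually_at_left_real)
  then have "\<forall>\<^sub>F r in at_left 1. norm (g z\<^sub>0) \<le> sqrt (A / pi) * (r / (r\<^sup>2 - (norm z\<^sub>0)\<^sup>2))"
    by eventually_elim (use le in auto)
  ultimately have "norm (g z\<^sub>0) \<le> sqrt (A / pi) * (1 / (1\<^sup>2 - (norm z\<^sub>0)\<^sup>2))"
    by (rule tendsto_lowerbound) simp
  then show ?thesis by simp
qed

section \<open>Maps of the Riemann sphere\<close>

lemma finite_part_continuous_on:
  assumes F: "continuous_map riemann_sphere riemann_sphere F" and fin: "\<And>z. z \<in> U \<Longrightarrow> F (Some z) \<noteq> None"
  shows "continuous_on U (\<lambda>z. the (F (Some z)))"
  unfolding continuous_openin_preimage_eq
proof (intro allI impI)
  fix T :: "complex set" assume T: "open T"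
  have "continuous_map euclidean riemann_sphere (F \<circ> Some)"
    by (rule continuous_map_compose[OF continuous_map_Some F])
  moreover have "openin riemann_sphere (Some ` T)" using T by simp
  ultimately have "openin euclidean {z \<in> topspace euclidean. (F \<circ> Some) z \<in> Some ` T}"
    by (rule openin_continuous_map_preimage)
  then have "open {z. F (Some z) \<in> Some ` T}" by simp
  moreover have "U \<inter> (\<lambda>z. the (F (Some z))) -` T = U \<inter> {z. F (Some z) \<in> Some ` T}"
    using fin by force
  ultimately show "openin (top_of_set U) (U \<inter> (\<lambda>z. the (F (Some z))) -` T)"
    by (simp add: openin_open_Int)
qed

lemma finite_part_tendsto_at_infinity:
  assumes F: "continuous_map riemann_sphere riemann_sphere F" and c: "F None = Some c"
  shows "((\<lambda>z. the (F (Some z))) \<longlongrightarrow> c) at_infinity"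
proof (rule topological_tendstoI)
  fix T assume T: "open T" "c \<in> T"
  have "openin riemann_sphere (Some ` T)" using T by simp
  then have "openin riemann_sphere {x \<in> topspace riemann_sphere. F x \<in> Some ` T}"
    by (rule openin_continuous_map_preimage[OF F])
  moreover have "None \<in> {x \<in> topspace riemann_sphere. F x \<in> Some ` T}" using T c by simp
  ultimately obtain C where C: "compactin euclidean C"
    "{x \<in> topspace riemann_sphere. F x \<in> Some ` T} = insert None (Some ` (topspace euclidean - C))"
    unfolding openin_Alexandroff_compactification by blast
  then have "bounded C" by (simp add: compact_imp_bounded)
  then obtain B where B: "\<And>z. z \<in> C \<Longrightarrow> norm z \<le> B" unfolding bounded_iff by blast
  have "the (F (Some z)) \<in> T" if "norm z \<ge> B + 1" for z
  proof -
    have "z \<notin> C" using that B[of z] by force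
    then have "Some z \<in> insert None (Some ` (topspace euclidean - C))" by simp
    then have "F (Some z) \<in> Some ` T" unfolding C(2)[symmetric] by simp
    then show ?thesis by auto
  qed
  then show "\<forall>\<^sub>F z in at_infinity. the (F (Some z)) \<in> T"
    unfolding eventually_at_infinity by blast
qed

section \<open>The comparison function\<close>

text \<open>Outside the disc this is the polar part \<open>1 / (z - q)\<close> for real \<open>q\<close>; inside, it is the antiholomorphic
  function with the same values on the circle.\<close>

definition comparison :: "complex \<Rightarrow> complex \<Rightarrow> complex" where
  "comparison q z = (if norm z \<le> 1 then cnj z / (1 - q * cnj z) else 1 / (z - cnj q))"

text \<open>Both branches agree on the circle. This map is non-expanding, and \<open>comparison q\<close> is a Moebius
  transformation of it, which settles the regularity of \<open>comparison q\<close> across the circle.\<close>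

definition fold_disc :: "complex \<Rightarrow> complex" where
  "fold_disc z = (if norm z \<le> 1 then cnj z else 1 / z)"

lemma norm_fold_disc: "norm (fold_disc z) \<le> 1"
  by (auto simp: fold_disc_def norm_divide divide_le_eq)

lemma fold_disc_lipschitz: "dist (fold_disc x) (fold_disc y) \<le> dist x y"
proof -
  have out: "dist (fold_disc x) (fold_disc y) \<le> dist x y" if "norm x \<ge> 1" "norm y \<ge> 1" for x y
  proof -
    have f: "fold_disc w = 1 / w" if "norm w \<ge> 1" for w
    proof (cases "norm w = 1")
      case True
      then have "w * cnj w = 1" using complex_norm_square[of w] by simp
      then show ?thesis using True by (simp add: fold_disc_def) (metis nonzero_eq_divide_eq mult.commute mult_zero_left zero_neq_one)
    qed (use that in \<open>simp add: fold_disc_def\<close>)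
    have nz: "x \<noteq> 0" "y \<noteq> 0" using that by auto
    have "1 / x - 1 / y = (y - x) / (x * y)" using nz by (simp add: field_simps)
    then have "norm (1 / x - 1 / y) = norm (x - y) / (norm x * norm y)"
      by (simp add: norm_divide norm_mult norm_minus_commute)
    also have "\<dots> \<le> norm (x - y) / 1"
      using that mult_mono[of 1 "norm x" 1 "norm y"] by (intro divide_left_mono) auto
    finally show ?thesis using f that by (simp add: dist_norm)
  qed
  have mixed: "dist (fold_disc x) (fold_disc y) \<le> dist x y" if "norm x < 1" "norm y \<ge> 1" for x y
  proof -
    have "closed_segment x y \<inter> frontier (ball 0 1) \<noteq> {}"
      using connected_Int_frontier[of "closed_segment x y" "ball 0 1"] that by fastforce
    then obtain c where c: "c \<in> closed_segment x y" "norm c = 1" by (force simp: frontier_ball)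
    have "dist (fold_disc x) (fold_disc y) \<le> dist (fold_disc x) (fold_disc c) + dist (fold_disc c) (fold_disc y)"
      by (rule dist_triangle)
    also have "dist (fold_disc x) (fold_disc c) = dist x c"
      using that c by (simp add: fold_disc_def dist_norm flip: complex_cnj_diff)
    also have "dist (fold_disc c) (fold_disc y) \<le> dist c y" using c that by (intro out) auto
    also have "dist x c + dist c y = dist x y"
      using c(1) between_mem_segment[of x y c] between[of x y c] by simp
    finally show ?thesis by simp
  qed
  consider "norm x < 1" "norm y < 1" | "norm x < 1" "norm y \<ge> 1" | "norm x \<ge> 1" "norm y < 1" | "norm x \<ge> 1" "norm y \<ge> 1"
    by linarith
  then show ?thesis
  proof cases
    case 1
    then show ?thesis by (simp add: fold_disc_def dist_norm flip: complex_cnj_diff)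
  next
    case 3
    then show ?thesis using mixed[of y x] by (simp add: dist_commute)
  qed (use out mixed in auto)
qed

lemma one_minus_mult_bound:
  fixes q w :: complex
  assumes "norm q < 1" "norm w \<le> 1"
  shows "norm (1 - q * w) \<ge> 1 - norm q" "1 - q * w \<noteq> 0"
proof -
  have "norm (q * w) \<le> norm q" using assms by (simp add: norm_mult mult_left_le)
  then show 1: "norm (1 - q * w) \<ge> 1 - norm q" using norm_triangle_ineq2[of 1 "q * w"] by simp
  show "1 - q * w \<noteq> 0" using 1 assms by auto
qed

lemma comparison_fold: "norm q < 1 \<Longrightarrow> Im q = 0 \<Longrightarrow> comparison q z = fold_disc z / (1 - q * fold_disc z)"
proof -
  assume q: "norm q < 1" "Im q = 0"
  have cq: "cnj q = q" using q by (simp add: complex_eq_iff)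
  show ?thesis
  proof (cases "norm z \<le> 1")
    case False
    then have "z \<noteq> 0" by auto
    then show ?thesis using False by (simp add: comparison_def fold_disc_def cq divide_simps)
  qed (simp add: comparison_def fold_disc_def)
qed

lemma comparison_lipschitz_bounded:
  assumes q: "norm q < 1" "Im q = 0"
  shows "(1 / (1 - norm q)\<^sup>2)-lipschitz_on UNIV (comparison q)" "norm (comparison q z) \<le> 1 / (1 - norm q)"
proof -
  note b = one_minus_mult_bound[OF q(1) norm_fold_disc]
  have q1: "1 - norm q > 0" using q by simp
  show "(1 / (1 - norm q)\<^sup>2)-lipschitz_on UNIV (comparison q)"
  proof (rule lipschitz_onI)
    fix x y
    let ?x = "fold_disc x" and ?y = "fold_disc y"
    have "comparison q x - comparison q y = (?x - ?y) / ((1 - q * ?x) * (1 - q * ?y))"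
      unfolding comparison_fold[OF q] using b(2)[of x] b(2)[of y] by (simp add: field_simps)
    then have "norm (comparison q x - comparison q y) = norm (?x - ?y) / (norm (1 - q * ?x) * norm (1 - q * ?y))"
      by (simp add: norm_divide norm_mult)
    also have "\<dots> \<le> dist x y / ((1 - norm q) * (1 - norm q))"
    proof (rule frac_le)
      show "norm (?x - ?y) \<le> dist x y" using fold_disc_lipschitz[of x y] by (simp add: dist_norm)
      show "(1 - norm q) * (1 - norm q) \<le> norm (1 - q * ?x) * norm (1 - q * ?y)"
        using b(1)[of x] b(1)[of y] q1 by (intro mult_mono) auto
    qed (use q1 in auto)
    finally show "dist (comparison q x) (comparison q y) \<le> 1 / (1 - norm q)\<^sup>2 * dist x y"
      by (simp add: dist_norm power2_eq_square)
  qed simp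
  show "norm (comparison q z) \<le> 1 / (1 - norm q)"
    unfolding comparison_fold[OF q] norm_divide using b(1)[of z] q1 norm_fold_disc[of z]
    by (intro frac_le) auto
qed

lemma comparison_has_wirtinger:
  assumes q: "norm q < 1"
  shows "norm z < 1 \<Longrightarrow> has_wirtinger (comparison q) 0 (bergman_kernel 1 q z) z"
    "norm z > 1 \<Longrightarrow> has_wirtinger (comparison q) (- 1 / (z - cnj q)\<^sup>2) 0 z"
proof -
  assume z: "norm z < 1"
  have nz: "1 - cnj q * z \<noteq> 0" using one_minus_mult_bound(2)[of "cnj q" z] q z by simp
  have "((\<lambda>w. w / (1 - cnj q * w)) has_field_derivative 1 / (1 - cnj q * z)\<^sup>2) (at z)"
    using nz by (auto intro!: derivative_eq_intros simp: power2_eq_square algebra_simps)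
  from has_wirtinger_cnj[OF has_wirtinger_field_derivative[OF this]]
  have "has_wirtinger (\<lambda>w. cnj w / (1 - q * cnj w)) 0 (bergman_kernel 1 q z) z" by (simp add: bergman_kernel_def)
  then show "has_wirtinger (comparison q) 0 (bergman_kernel 1 q z) z"
    by (rule has_wirtinger_transform[of _ _ _ _ "ball 0 1"]) (use z in \<open>auto simp: comparison_def\<close>)
next
  assume z: "norm z > 1"
  then have nz: "z - cnj q \<noteq> 0" using q by auto
  have "((\<lambda>w. 1 / (w - cnj q)) has_field_derivative - 1 / (z - cnj q)\<^sup>2) (at z)"
    using nz by (auto intro!: derivative_eq_intros simp: power2_eq_square)
  from has_wirtinger_field_derivative[OF this]
  show "has_wirtinger (comparison q) (- 1 / (z - cnj q)\<^sup>2) 0 z"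
    by (rule has_wirtinger_transform[of _ _ _ _ "- cball 0 1"]) (use z in \<open>auto simp: comparison_def\<close>)
qed

section \<open>The area theorem\<close>

text \<open>For \<open>e = 0\<close> the hypotheses say \<open>a \<le> w \<le> k\<^sup>2 s\<close> and \<open>a + s \<le> Q + w\<close>, whence
  \<open>(1 - k\<^sup>2) s \<le> Q - a\<close> and \<open>(1 - k\<^sup>2) a \<le> k\<^sup>2 (Q - a)\<close>. With errors, the argument needs a bound for
  \<open>s\<close> that is independent of \<open>e\<close>; it follows from \<open>k < 1\<close>.\<close>

lemma area_arithmetic:
  fixes a Q k :: real
  assumes k: "0 \<le> k" "k < 1" and aQ: "a \<ge> 0" "Q \<ge> 0"
    and ex: "\<And>e. 0 < e \<Longrightarrow> \<exists>s w. s \<ge> 0 \<and> w \<ge> 0 \<and> w \<le> k\<^sup>2 * s \<and> sqrt a \<le> sqrt w + e \<and> sqrt (a + s) \<le> sqrt (Q + w) + e"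
  shows "a \<le> k\<^sup>2 * Q"
proof (rule field_le_epsilon)
  fix \<epsilon> :: real assume \<epsilon>: "\<epsilon> > 0"
  define B where "B = (sqrt Q + 1) / (1 - k)"
  have B0: "B \<ge> 0" using k aQ by (simp add: B_def)
  define M where "M = 2 * (sqrt Q + k * B) + 1"
  have M: "M \<ge> 1" using k aQ B0 by (simp add: M_def)
  define e where "e = min 1 (\<epsilon> / M)"
  have e: "0 < e" "e \<le> 1" "e * M \<le> \<epsilon>" using \<epsilon> M by (auto simp: e_def min_def field_simps)
  obtain s w where sw: "s \<ge> 0" "w \<ge> 0" "w \<le> k\<^sup>2 * s" "sqrt a \<le> sqrt w + e" "sqrt (a + s) \<le> sqrt (Q + w) + e"
    using ex[OF e(1)] by blast
  have w: "sqrt w \<le> k * sqrt s"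
    using real_sqrt_le_mono[OF sw(3)] k sw by (simp add: real_sqrt_mult)
  have Qw: "sqrt (Q + w) \<le> sqrt Q + sqrt w" using aQ sw by (intro sqrt_add_le_add_sqrt) auto
  have "sqrt s \<le> sqrt (a + s)" using aQ by simp
  then have "sqrt s \<le> sqrt Q + k * sqrt s + 1" using sw(5) Qw w e by linarith
  then have sB: "sqrt s \<le> B" using k by (simp add: B_def field_simps)
  then have wB: "sqrt w \<le> k * B" using w k by (meson mult_left_mono order_trans)
  have sq: "x \<le> y + e * M" if "x \<ge> 0" "y \<ge> 0" "sqrt x \<le> sqrt y + e" "sqrt y \<le> sqrt Q + k * B" for x y
  proof -
    have "x \<le> (sqrt y + e)\<^sup>2" using that e by (metis real_sqrt_ge_zero real_sqrt_pow2 power_mono)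
    also have "\<dots> = y + e * (2 * sqrt y + e)" using that by (simp add: power2_sum algebra_simps power2_eq_square)
    also have "\<dots> \<le> y + e * M"
      using that e by (intro add_left_mono mult_left_mono) (auto simp: M_def)
    finally show ?thesis .
  qed
  have 1: "a \<le> k\<^sup>2 * s + e * M"
    using sq[of a w] aQ sw wB by (smt (verit) real_sqrt_ge_zero)
  have 2: "a + s \<le> Q + k\<^sup>2 * s + e * M"
    using sq[of "a + s" "Q + w"] aQ sw wB Qw by linarith
  have k2: "0 \<le> k\<^sup>2" "k\<^sup>2 < 1" using k by (auto simp: power_less_one_iff abs_square_less_1)
  have "(1 - k\<^sup>2) * a \<le> (1 - k\<^sup>2) * (k\<^sup>2 * s + e * M)" using 1 k2 by (intro mult_left_mono) auto
  also have "\<dots> = k\<^sup>2 * ((1 - k\<^sup>2) * s) + (1 - k\<^sup>2) * (e * M)" by (simp add: algebra_simps)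
  also have "\<dots> \<le> k\<^sup>2 * (Q - a + e * M) + (1 - k\<^sup>2) * (e * M)"
    using 2 k2 by (intro add_right_mono mult_left_mono) (auto simp: algebra_simps)
  also have "\<dots> = k\<^sup>2 * Q - k\<^sup>2 * a + e * M" by (simp add: algebra_simps)
  finally have "a \<le> k\<^sup>2 * Q + e * M" by (simp add: algebra_simps)
  then show "a \<le> k\<^sup>2 * Q + \<epsilon>" using e by linarith
qed

text \<open>The homeomorphism is finite away from \<open>q\<close>, also at infinity, and this makes its restriction to the
  plane converge there.\<close>

lemma quasiconformal_plane_map:
  assumes F: "quasiconformal k F" and q: "F (Some q) = None"
  obtains c g h where "continuous_on (- {q}) (\<lambda>z. the (F (Some z)))"
    "((\<lambda>z. the (F (Some z))) \<longlongrightarrow> c) at_infinity"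
    "locally_L2_on (- {q}) g" "locally_L2_on (- {q}) h"
    "weak_wirtinger (- {q}) (\<lambda>z. the (F (Some z))) g h"
    "AE z in lebesgue. norm (h z) \<le> k * norm (g z)"
proof -
  have hm: "homeomorphic_map riemann_sphere riemann_sphere F" using F by (simp add: quasiconformal_def)
  then have cont: "continuous_map riemann_sphere riemann_sphere F"
    by (rule homeomorphic_imp_continuous_map)
  have "inj_on F (topspace riemann_sphere)"
    using hm by (simp add: homeomorphic_eq_everything_map)
  moreover have "topspace riemann_sphere = UNIV" using UNIV_option_conv by auto
  ultimately have inj: "inj F" by (simp only:)
  have fin: "F x \<noteq> None" if "x \<noteq> Some q" for x
    using inj_eq[OF inj, of x "Some q"] q that by auto
  then obtain c where c: "F None = Some c" by blast
  have U: "{z. F (Some z) \<noteq> None} = - {q}" using fin q by auto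
  obtain g h where gh: "locally_L2_on (- {q}) g" "locally_L2_on (- {q}) h"
    "has_distrib_deriv_on dz (- {q}) (\<lambda>z. the (F (Some z))) g"
    "has_distrib_deriv_on dzbar (- {q}) (\<lambda>z. the (F (Some z))) h"
    "AE z in lebesgue. z \<in> - {q} \<longrightarrow> norm (h z) \<le> k * norm (g z)"
    using F unfolding quasiconformal_def Let_def U by blast
  have nq: "AE z in lebesgue. z \<noteq> q" using AE_not_in[of "{q}" lebesgue] by simp
  show ?thesis
  proof (rule that)
    show "continuous_on (- {q}) (\<lambda>z. the (F (Some z)))"
      by (rule finite_part_continuous_on[OF cont]) (use fin in auto)
    show "((\<lambda>z. the (F (Some z))) \<longlongrightarrow> c) at_infinity"
      by (rule finite_part_tendsto_at_infinity[OF cont c])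
    show "AE z in lebesgue. norm (h z) \<le> k * norm (g z)"
      using gh(5) nq by eventually_elim auto
  qed (use gh in \<open>auto simp: weak_wirtinger_def\<close>)
qed

lemma holomorphic_weak_wirtinger_unique:
  assumes U: "open U" and f: "f holomorphic_on U" "\<And>z. z \<in> U \<Longrightarrow> G z = f z"
    and weak: "weak_wirtinger U G g h" and L2: "locally_L2_on U g" "locally_L2_on U h"
  shows "AE z in lebesgue. z \<in> U \<longrightarrow> g z = deriv f z \<and> h z = 0"
proof -
  have cd: "continuous_on U (deriv f)"
    by (intro holomorphic_on_imp_continuous_on holomorphic_deriv f U)
  have "has_wirtinger G (deriv f z) 0 z" if "z \<in> U" for z
    by (rule has_wirtinger_transform[OF has_wirtinger_field_derivative[OF holomorphic_derivI[OF f(1) U that]] U that])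
       (use f in simp)
  then have w: "weak_wirtinger U G (deriv f) (\<lambda>_. 0)"
    by (rule weak_wirtinger_C1[OF U]) (auto intro: cd)
  have Gc: "continuous_on U G"
    using holomorphic_on_imp_continuous_on[OF f(1)] f(2) by (simp cong: continuous_on_cong)
  note L2G = locally_L2_on_continuous[OF U Gc] and L2f = locally_L2_on_continuous[OF U cd]
  have "weak_wirtinger U (\<lambda>z. G z + (- 1) * G z) (\<lambda>z. g z + (- 1) * deriv f z) (\<lambda>z. h z + (- 1) * 0)"
    by (rule weak_wirtinger_add_cmult[OF weak w L2G L2G L2(1) L2f L2(2) locally_L2_on_continuous[OF U continuous_on_const]])
  then have d: "(\<integral>z. (g z + (- 1) * deriv f z) * \<phi> z \<partial>lebesgue) = 0" "(\<integral>z. h z * \<phi> z \<partial>lebesgue) = 0"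
    if "test_function_on U \<phi>" for \<phi>
    using weak_wirtingerD[OF _ that] by force+
  have "locally_L2_on U (\<lambda>z. g z + (- 1) * deriv f z)"
    by (intro locally_L2_on_add L2 locally_L2_on_continuous[OF U] continuous_intros cd)
  then have "AE z in lebesgue. z \<in> U \<longrightarrow> g z + (- 1) * deriv f z = 0"
    by (rule weak_zero_imp_AE_zero[OF U _ d(1)])
  moreover have "AE z in lebesgue. z \<in> U \<longrightarrow> h z = 0"
    by (rule weak_zero_imp_AE_zero[OF U L2(2) d(2)])
  ultimately show ?thesis by eventually_elim auto
qed

lemma weak_wirtinger_fill_puncture:
  assumes V: "open V" "q \<in> V" and w: "weak_wirtinger (- {q}) f a b" "weak_wirtinger V f a b"
    and L2: "locally_L2_on UNIV f" "locally_L2_on UNIV a" "locally_L2_on UNIV b"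
  shows "weak_wirtinger UNIV f a b"
proof -
  obtain s where s: "s > 0" "cball q s \<subseteq> V" using open_contains_cball V by blast
  obtain \<tau> where \<tau>: "smooth \<tau>" "\<And>z. norm z \<le> 1 \<Longrightarrow> \<tau> z = 1" "\<And>z. norm z > 4 \<Longrightarrow> \<tau> z = 0"
    using smooth_cutoff_exists by blast
  \<comment> \<open>Equal to \<open>1\<close> within distance \<open>s / 4\<close> of \<open>q\<close>, and supported within distance \<open>s\<close>.\<close>
  define \<kappa> where "\<kappa> z = \<tau> (of_real (4 / s) * z + - of_real (4 / s) * q)" for z
  have nrm: "norm (of_real (4 / s) * z + - of_real (4 / s) * q) = 4 / s * dist q z" for z
  proof -
    have "of_real (4 / s) * z + - of_real (4 / s) * q = of_real (4 / s) * (z - q)"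
      by (simp only: distrib_left mult_minus_left mult_minus_right diff_conv_add_uminus)
    then show ?thesis using s by (simp only: norm_mult norm_of_real dist_norm norm_minus_commute[of q]) simp
  qed
  show ?thesis
  proof (rule weak_wirtinger_glue[OF w])
    show "smooth \<kappa>" unfolding \<kappa>_def by (intro smooth_affine \<tau>)
    show "cball q s \<subseteq> V" by (rule s)
    show "\<kappa> z = 0" if "z \<notin> cball q s" for z
      unfolding \<kappa>_def by (rule \<tau>(3), unfold nrm) (use that s in \<open>simp add: field_simps\<close>)
    show "closed (- ball q (s / 4))" by auto
    show "- ball q (s / 4) \<subseteq> - {q}" using s by auto
    show "\<kappa> z = 1" if "z \<notin> - ball q (s / 4)" for z
      unfolding \<kappa>_def by (rule \<tau>(2), unfold nrm) (use that s in \<open>simp add: field_simps\<close>)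
  qed (use L2 in auto)
qed

lemma eventually_outside_unit_disc: "\<forall>\<^sub>F z in at_infinity. norm (z::complex) > 1"
  by (auto simp: eventually_at_infinity intro!: exI[of _ 2])

lemma simple_pole_tendsto_at_infinity: "((\<lambda>z::complex. 1 / (z - q)) \<longlongrightarrow> 0) at_infinity"
proof -
  have "filterlim (\<lambda>z. z - q) at_infinity at_infinity"
    using tendsto_add_filterlim_at_infinity'[OF filterlim_ident tendsto_const[of "- q"]] by simp
  from tendsto_inverse_0[THEN filterlim_compose, OF this] show ?thesis by (simp add: inverse_eq_divide)
qed

text \<open>The function is \<open>F - 1 / (z - q)\<close>. Off the pole it has the weak derivatives of \<open>F\<close>, up to those of the polar
  part. In the disc, where it is holomorphic, these agree almost everywhere with its classical
  derivatives, by \<open>holomorphic_weak_wirtinger_unique\<close>. As the disc is a neighbourhood of the pole, the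
  weak derivatives extend across it.\<close>

lemma simple_pole_subtracted:
  assumes q: "norm q < 1" and F: "quasiconformal k F" "F (Some q) = None"
    and S: "S holomorphic_on ball 0 1" "\<And>z. z \<in> ball 0 1 - {q} \<Longrightarrow> F (Some z) = Some (S z + 1 / (z - q))"
  obtains G u v c where "sobolev_map G u v" "(G \<longlongrightarrow> c) at_infinity"
    "\<And>z. z \<in> ball 0 1 \<Longrightarrow> u z = deriv S z \<and> v z = 0"
    "AE z in lebesgue. norm z > 1 \<longrightarrow> norm (v z) \<le> k * norm (u z - 1 / (z - q)\<^sup>2)"
proof -
  define E where "E z = the (F (Some z))" for z
  define G where "G z = (if z \<in> ball 0 1 then S z else E z - 1 / (z - q))" for z
  obtain c g h where Ec: "continuous_on (- {q}) E" and Elim: "(E \<longlongrightarrow> c) at_infinity"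
    and L2gh: "locally_L2_on (- {q}) g" "locally_L2_on (- {q}) h"
    and Ew: "weak_wirtinger (- {q}) E g h" and qc: "AE z in lebesgue. norm (h z) \<le> k * norm (g z)"
    unfolding E_def by (rule quasiconformal_plane_map[OF F]) blast
  have ES: "E z = S z + 1 / (z - q)" if "z \<in> ball 0 1 - {q}" for z
    using S(2)[OF that] by (simp add: E_def)
  have GE: "G z = E z + (- 1) * (1 / (z - q))" if "z \<noteq> q" for z
    using ES[of z] that by (simp add: G_def)
  have qB: "q \<in> ball 0 1" using q by simp
  have Sc: "continuous_on (ball 0 1) S" and dSc: "continuous_on (ball 0 1) (deriv S)"
    by (intro holomorphic_on_imp_continuous_on holomorphic_deriv S open_ball)+
  have pc: "continuous_on (- {q}) (\<lambda>z. 1 / (z - q))" "continuous_on (- {q}) (\<lambda>z. 1 / (z - q)\<^sup>2)"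
    by (intro continuous_intros; simp)+
  have oq: "open (- {q})" by auto

  define u where "u z = (if z \<in> ball 0 1 then deriv S z else g z + 1 / (z - q)\<^sup>2)" for z
  define v where "v z = (if z \<in> ball 0 1 then 0 else h z)" for z
  have gh_disc: "AE z in lebesgue. z \<in> ball 0 1 - {q} \<longrightarrow> g z = deriv (\<lambda>z. S z + 1 / (z - q)) z \<and> h z = 0"
  proof (rule holomorphic_weak_wirtinger_unique)
    show o: "open (ball 0 1 - {q})" by auto
    show "(\<lambda>z. S z + 1 / (z - q)) holomorphic_on ball 0 1 - {q}"
      by (intro holomorphic_intros holomorphic_on_subset[OF S(1)]) auto
    show "weak_wirtinger (ball 0 1 - {q}) E g h" by (rule weak_wirtinger_subset[OF Ew]) auto
    show "locally_L2_on (ball 0 1 - {q}) g" "locally_L2_on (ball 0 1 - {q}) h"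
      by (rule locally_L2_on_subset[OF L2gh(1)] locally_L2_on_subset[OF L2gh(2)]; use o in auto)+
  qed (use ES in auto)
  have nq: "AE z in lebesgue. z \<noteq> q" using AE_not_in[of "{q}" lebesgue] by simp
  have ugh: "AE z in lebesgue. g z + 1 / (z - q)\<^sup>2 = u z \<and> h z = v z"
    using gh_disc nq
  proof eventually_elim
    case (elim z)
    show ?case
    proof (cases "z \<in> ball 0 1")
      case True
      have "((\<lambda>z. S z + 1 / (z - q)) has_field_derivative deriv S z - 1 / (z - q)\<^sup>2) (at z)"
        using True elim by (auto intro!: derivative_eq_intros holomorphic_derivI[OF S(1)] simp: power2_eq_square)
      then have "deriv (\<lambda>z. S z + 1 / (z - q)) z = deriv S z - 1 / (z - q)\<^sup>2" by (rule DERIV_imp_deriv)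
      then show ?thesis using True elim by (simp add: u_def v_def)
    qed (simp add: u_def v_def)
  qed
  have L2g': "locally_L2_on (- {q}) (\<lambda>z. g z + 1 / (z - q)\<^sup>2)"
    by (intro locally_L2_on_add L2gh locally_L2_on_continuous oq pc)
  have uB: "continuous_on (ball 0 1) u" by (rule continuous_on_eq[OF dSc]) (simp add: u_def)
  have vB: "continuous_on (ball 0 1) v" by (rule continuous_on_eq[OF continuous_on_const[of _ 0]]) (simp add: v_def)
  have ug: "AE z in lebesgue. g z + 1 / (z - q)\<^sup>2 = u z" and vh: "AE z in lebesgue. h z = v z"
    using ugh by (eventually_elim, simp)+
  have L2u: "locally_L2_on UNIV u"
    by (rule locally_L2_fill_puncture[OF locally_L2_on_cong_AE[OF L2g'] locally_L2_on_continuous[OF open_ball uB] open_ball qB])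
       (use ug in eventually_elim, simp)
  have L2v: "locally_L2_on UNIV v"
    by (rule locally_L2_fill_puncture[OF locally_L2_on_cong_AE[OF L2gh(2)] locally_L2_on_continuous[OF open_ball vB] open_ball qB])
       (use vh in eventually_elim, simp)
  have Gc: "continuous_on UNIV G"
  proof -
    have "continuous_on (ball 0 1 \<union> - {q}) G"
    proof (rule continuous_on_open_Un[OF open_ball oq])
      show "continuous_on (ball 0 1) G" by (rule continuous_on_eq[OF Sc]) (simp add: G_def)
      have "continuous_on (- {q}) (\<lambda>z. E z + (- 1) * (1 / (z - q)))" by (intro continuous_intros Ec pc)
      then show "continuous_on (- {q}) G" by (rule continuous_on_eq) (use GE in auto)
    qed
    moreover have "ball 0 1 \<union> - {q} = UNIV" using qB by auto
    ultimately show ?thesis by simp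
  qed
  have GwB: "weak_wirtinger (ball 0 1) G u v"
  proof (rule weak_wirtinger_C1[OF open_ball _ uB vB])
    fix z :: complex assume z: "z \<in> ball 0 1"
    have "has_wirtinger S (deriv S z) 0 z"
      by (rule has_wirtinger_field_derivative[OF holomorphic_derivI[OF S(1) open_ball z]])
    then have "has_wirtinger G (deriv S z) 0 z"
      by (rule has_wirtinger_transform[OF _ open_ball z]) (simp add: G_def)
    then show "has_wirtinger G (u z) (v z) z" using z by (simp add: u_def v_def)
  qed
  have GwP: "weak_wirtinger (- {q}) G u v"
  proof -
    have "weak_wirtinger (- {q}) (\<lambda>z. 1 / (z - q)) (\<lambda>z. - (1 / (z - q)\<^sup>2)) (\<lambda>_. 0)"
    proof (rule weak_wirtinger_C1[OF oq])
      fix z assume "z \<in> - {q}"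
      then have "((\<lambda>z. 1 / (z - q)) has_field_derivative - (1 / (z - q)\<^sup>2)) (at z)"
        by (auto intro!: derivative_eq_intros simp: power2_eq_square)
      then show "has_wirtinger (\<lambda>z. 1 / (z - q)) (- (1 / (z - q)\<^sup>2)) 0 z"
        by (rule has_wirtinger_field_derivative)
    qed (intro continuous_intros pc)+
    then have "weak_wirtinger (- {q}) (\<lambda>z. E z + (- 1) * (1 / (z - q))) (\<lambda>z. g z + (- 1) * - (1 / (z - q)\<^sup>2)) (\<lambda>z. h z + (- 1) * 0)"
      by (intro weak_wirtinger_add_cmult[OF Ew] L2gh locally_L2_on_continuous oq continuous_intros Ec pc)
    then have "weak_wirtinger (- {q}) (\<lambda>z. E z + (- 1) * (1 / (z - q))) (\<lambda>z. g z + 1 / (z - q)\<^sup>2) h" by simp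
    then show ?thesis
      by (rule weak_wirtinger_cong[OF _ L2g' L2gh(2)]) (use GE in simp, use ugh in eventually_elim, simp)
  qed
  have Gw: "weak_wirtinger UNIV G u v"
    by (rule weak_wirtinger_fill_puncture[OF open_ball qB GwP GwB locally_L2_on_continuous[OF open_UNIV Gc] L2u L2v])
  show ?thesis
  proof (rule that)
    show "sobolev_map G u v" using Gc Gw L2u L2v by (simp add: sobolev_map_def)
    show "(G \<longlongrightarrow> c) at_infinity"
    proof (rule Lim_transform_eventually)
      show "((\<lambda>z. E z - 1 / (z - q)) \<longlongrightarrow> c) at_infinity"
        using tendsto_diff[OF Elim simple_pole_tendsto_at_infinity] by simp
      show "\<forall>\<^sub>F z in at_infinity. E z - 1 / (z - q) = G z"
        using eventually_outside_unit_disc by eventually_elim (simp add: G_def)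
    qed
    show "u z = deriv S z \<and> v z = 0" if "z \<in> ball 0 1" for z using that by (simp add: u_def v_def)
    show "AE z in lebesgue. norm z > 1 \<longrightarrow> norm (v z) \<le> k * norm (u z - 1 / (z - q)\<^sup>2)"
      using qc by eventually_elim (simp add: u_def v_def)
  qed
qed

lemma comparison_sobolev:
  assumes q: "norm q < 1" "Im q = 0"
  shows "sobolev_map (comparison q) (\<lambda>z. indicator {z. 1 \<le> norm z} z *\<^sub>R (- 1 / (z - q)\<^sup>2))
     (\<lambda>z. indicator (cball 0 1) z *\<^sub>R bergman_kernel 1 q z)" (is "sobolev_map _ ?a ?b")
    and "(comparison q \<longlongrightarrow> 0) at_infinity"
proof -
  have cq: "cnj q = q" using q by (simp add: complex_eq_iff)
  note Klip = comparison_lipschitz_bounded[OF q]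
  show "sobolev_map (comparison q) ?a ?b"
    unfolding sobolev_map_def
  proof (intro conjI)
    show "continuous_on UNIV (comparison q)" by (rule lipschitz_on_continuous_on[OF Klip(1)])
    show "weak_wirtinger UNIV (comparison q) ?a ?b"
    proof (rule weak_wirtinger_lipschitz[OF Klip])
      show "AE z in lebesgue. has_wirtinger (comparison q) (?a z) (?b z) z"
        using AE_norm_neq[of 1]
      proof eventually_elim
        case (elim z)
        then consider "norm z < 1" | "norm z > 1" by linarith
        then show ?case by cases (use comparison_has_wirtinger[OF q(1), of z] in \<open>auto simp: cq\<close>)
      qed
    qed
    have "z - q \<noteq> 0" if "1 \<le> norm z" for z using that q by auto
    then show "locally_L2_on UNIV ?a"
      by (intro locally_L2_closed_piece continuous_intros closed_Collect_le) auto
    show "locally_L2_on UNIV ?b"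
      by (rule locally_L2_closed_piece[OF closed_cball continuous_on_bergman_kernel[OF q(1)]])
  qed
  have "\<forall>\<^sub>F z in at_infinity. 1 / (z - q) = comparison q z"
    using eventually_outside_unit_disc by eventually_elim (simp add: comparison_def cq)
  then show "(comparison q \<longlongrightarrow> 0) at_infinity"
    by (rule Lim_transform_eventually[OF simple_pole_tendsto_at_infinity])
qed

lemma energy_split_circle:
  assumes "square_integrable f"
  shows "energy f = energy (\<lambda>z. indicator (ball 0 1) z *\<^sub>R f z) + energy (\<lambda>z. indicator (- cball 0 1) z *\<^sub>R f z)"
proof -
  have sq: "square_integrable (\<lambda>z. indicator (ball 0 1) z *\<^sub>R f z)" "square_integrable (\<lambda>z. indicator (- cball 0 1) z *\<^sub>R f z)"
    by (rule square_integrable_indicator[OF assms]; simp)+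
  then have i: "integrable lebesgue (\<lambda>z. (norm (indicator (ball 0 1) z *\<^sub>R f z))\<^sup>2)"
    "integrable lebesgue (\<lambda>z. (norm (indicator (- cball 0 1) z *\<^sub>R f z))\<^sup>2)"
    by (simp_all only: square_integrable_def)
  have "energy f = (\<integral>z. (norm (indicator (ball 0 1) z *\<^sub>R f z))\<^sup>2 + (norm (indicator (- cball 0 1) z *\<^sub>R f z))\<^sup>2 \<partial>lebesgue)"
  proof (rule integral_cong_AE)
    show "AE z in lebesgue. (norm (f z))\<^sup>2 = (norm (indicator (ball 0 1) z *\<^sub>R f z))\<^sup>2 + (norm (indicator (- cball 0 1) z *\<^sub>R f z))\<^sup>2"
      using AE_norm_neq[of 1] by eventually_elim (auto simp: indicator_def)
    show "(\<lambda>z. (norm (f z))\<^sup>2) \<in> borel_measurable lebesgue" using assms by (auto simp: square_integrable_def)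
  qed (rule borel_measurable_integrable[OF Bochner_Integration.integrable_add[OF i]])
  also have "\<dots> = energy (\<lambda>z. indicator (ball 0 1) z *\<^sub>R f z) + energy (\<lambda>z. indicator (- cball 0 1) z *\<^sub>R f z)"
    by (rule Bochner_Integration.integral_add[OF i])
  finally show ?thesis .
qed

lemma energy_le:
  assumes "square_integrable f" "square_integrable g" "AE z in lebesgue. norm (g z) \<le> k * norm (f z)"
  shows "energy g \<le> k\<^sup>2 * energy f"
proof -
  have "energy g \<le> (\<integral>z. k\<^sup>2 * (norm (f z))\<^sup>2 \<partial>lebesgue)"
  proof (rule integral_mono_AE)
    show "AE z in lebesgue. (norm (g z))\<^sup>2 \<le> k\<^sup>2 * (norm (f z))\<^sup>2"
      using assms(3) by eventually_elim (metis norm_ge_zero power_mono power_mult_distrib)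
  qed (use assms in \<open>auto simp: square_integrable_def\<close>)
  then show ?thesis by simp
qed

text \<open>The two inequalities \<open>A \<le> w\<close> and \<open>A + s \<le> Q + w\<close> of the introduction, up to an error \<open>e\<close>. The cut-off
  has radius at least \<open>1\<close>, so that it does not affect the integrals over the disc. Outside the disc
  \<open>u1\<close> is \<open>u - 1 / (z - q)\<^sup>2\<close>, the quantity in the quasiconformality condition.\<close>

theorem area_theorem:
  assumes k: "0 \<le> k" "k < 1" and q: "norm q < 1" "Im q = 0"
    and G: "sobolev_map G u v" "(G \<longlongrightarrow> c) at_infinity"
    and disc: "\<And>z. z \<in> ball 0 1 \<Longrightarrow> v z = 0"
    and qc: "AE z in lebesgue. norm z > 1 \<longrightarrow> norm (v z) \<le> k * norm (u z - 1 / (z - q)\<^sup>2)"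
  shows "energy (\<lambda>z. indicator (ball 0 1) z *\<^sub>R u z) \<le> k\<^sup>2 * (pi / (1 - (norm q)\<^sup>2)\<^sup>2)" (is "?A \<le> k\<^sup>2 * ?Q")
proof -
  define a where "a z = indicator {z. 1 \<le> norm z} z *\<^sub>R (- 1 / (z - q)\<^sup>2)" for z
  define b where "b z = indicator (cball 0 1) z *\<^sub>R bergman_kernel 1 q z" for z
  define u1 v1 where "u1 z = u z + 1 * a z" and "v1 z = v z + 1 * b z" for z
  have G1: "sobolev_map (\<lambda>z. G z + 1 * comparison q z) u1 v1"
    unfolding u1_def v1_def a_def b_def by (rule sobolev_map_add_cmult[OF G(1) comparison_sobolev(1)[OF q]])
  have G1lim: "((\<lambda>z. G z + 1 * comparison q z) \<longlongrightarrow> c) at_infinity"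
    using tendsto_add[OF G(2) comparison_sobolev(2)[OF q]] by simp
  have Q: "energy (\<lambda>z. indicator (ball 0 1) z *\<^sub>R bergman_kernel 1 q z) = ?Q"
  proof -
    note sq = square_integrable_indicator_continuous[OF compact_cball continuous_on_bergman_kernel[OF q(1)]]
    have "indicator (- cball 0 1) z *\<^sub>R (indicator (cball 0 1) z *\<^sub>R bergman_kernel 1 q z) = 0"
      "indicator (ball 0 1) z *\<^sub>R (indicator (cball 0 1) z *\<^sub>R bergman_kernel 1 q z) = indicator (ball 0 1) z *\<^sub>R bergman_kernel 1 q z" for z
      by (auto simp: indicator_def)
    then show ?thesis
      using energy_split_circle[OF sq] energy_bergman_kernel[OF q(1)] by (simp only:) simp
  qed
  obtain \<theta> :: "real \<Rightarrow> complex \<Rightarrow> complex" where \<theta>: "\<And>R. R > 0 \<Longrightarrow> smooth (\<theta> R)"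
    "\<And>R z. R > 0 \<Longrightarrow> norm z \<le> R \<Longrightarrow> \<theta> R z = 1"
    "\<And>R z. R > 0 \<Longrightarrow> norm z > 4 * R \<Longrightarrow> \<theta> R z = 0"
    and decay: "\<And>\<Gamma> u v c e. sobolev_map \<Gamma> u v \<Longrightarrow> (\<Gamma> \<longlongrightarrow> c) at_infinity \<Longrightarrow> e > 0 \<Longrightarrow>
       \<forall>\<^sub>F R in at_top. sqrt (energy (\<lambda>z. \<theta> R z * u z)) \<le> sqrt (energy (\<lambda>z. \<theta> R z * v z)) + e"
  proof (rule cutoff_family_exists, goal_cases)
    case (1 \<theta>)
    show ?case by (rule 1(1)) (fact 1)+
  qed
  show ?thesis
  proof (rule area_arithmetic[OF k])
    fix e :: real assume e: "0 < e"
    have "\<forall>\<^sub>F R in at_top. sqrt (energy (\<lambda>z. \<theta> R z * u z)) \<le> sqrt (energy (\<lambda>z. \<theta> R z * v z)) + e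
       \<and> sqrt (energy (\<lambda>z. \<theta> R z * u1 z)) \<le> sqrt (energy (\<lambda>z. \<theta> R z * v1 z)) + e \<and> R \<ge> 1"
      by (intro eventually_conj decay[OF G e] decay[OF G1 G1lim e] eventually_ge_at_top)
    then obtain R where E0: "sqrt (energy (\<lambda>z. \<theta> R z * u z)) \<le> sqrt (energy (\<lambda>z. \<theta> R z * v z)) + e"
      and E1: "sqrt (energy (\<lambda>z. \<theta> R z * u1 z)) \<le> sqrt (energy (\<lambda>z. \<theta> R z * v1 z)) + e"
      and R: "R \<ge> 1"
      using eventually_happens'[OF trivial_limit_at_top_linorder] by blast
    have R0: "R > 0" using R by simp
    have c\<theta>: "continuous_on UNIV (\<theta> R)" by (rule smooth_continuous[OF \<theta>(1)[OF R0]])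
    have sqm: "square_integrable (\<lambda>z. \<theta> R z * f z)" if "locally_L2_on UNIV f" for f
      by (rule square_integrable_mult_continuous[OF that compact_cball[of 0 "4 * R"] subset_UNIV c\<theta>]) (use \<theta>(3)[OF R0] in auto)
    have \<theta>1: "\<theta> R z = 1" if "norm z \<le> 1" for z using \<theta>(2)[OF R0, of z] that R by simp
    note sq = sobolev_mapD(3,4)[OF G(1), THEN sqm] sobolev_mapD(3,4)[OF G1, THEN sqm]
    let ?out = "\<lambda>f z. indicator (- cball 0 1) z *\<^sub>R (\<theta> R z * f z :: complex)"
    define s w where "s = energy (?out u1)" and "w = energy (?out v)"
    have in_disc: "indicator (ball 0 1) z *\<^sub>R (\<theta> R z * u z) = indicator (ball 0 1) z *\<^sub>R u z"
      "indicator (ball 0 1) z *\<^sub>R (\<theta> R z * u1 z) = indicator (ball 0 1) z *\<^sub>R u z"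
      "indicator (ball 0 1) z *\<^sub>R (\<theta> R z * v z) = 0"
      "indicator (ball 0 1) z *\<^sub>R (\<theta> R z * v1 z) = indicator (ball 0 1) z *\<^sub>R bergman_kernel 1 q z" for z
      by (auto simp: indicator_def u1_def v1_def a_def b_def \<theta>1 disc)
    have v1_out: "?out v1 z = ?out v z" for z by (auto simp: indicator_def v1_def b_def)
    have "w \<le> k\<^sup>2 * s"
      unfolding w_def s_def
    proof (rule energy_le)
      show "AE z in lebesgue. norm (?out v z) \<le> k * norm (?out u1 z)"
        using qc
      proof eventually_elim
        case (elim z)
        then have "norm (\<theta> R z) * norm (v z) \<le> norm (\<theta> R z) * (k * norm (u1 z))" if "norm z > 1"
          using that by (intro mult_left_mono) (auto simp: u1_def a_def)
        then show ?case by (auto simp: indicator_def norm_mult mult_ac)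
      qed
    qed (intro square_integrable_indicator sq; simp)+
    moreover have "sqrt ?A \<le> sqrt w + e"
    proof -
      have X: "sqrt ?A \<le> sqrt (energy (\<lambda>z. \<theta> R z * u z))"
        unfolding energy_split_circle[OF sq(1)] in_disc by simp
      have Y: "energy (\<lambda>z. \<theta> R z * v z) = w"
        unfolding energy_split_circle[OF sq(2)] in_disc w_def by simp
      show ?thesis by (rule order_trans[OF X E0[unfolded Y]])
    qed
    moreover have "sqrt (?A + s) \<le> sqrt (?Q + w) + e"
      using E1 unfolding energy_split_circle[OF sq(3)] energy_split_circle[OF sq(4)] in_disc v1_out Q s_def w_def .
    moreover have "s \<ge> 0" "w \<ge> 0" by (auto simp: s_def w_def)
    ultimately show "\<exists>s w. s \<ge> 0 \<and> w \<ge> 0 \<and> w \<le> k\<^sup>2 * s \<and> sqrt ?A \<le> sqrt w + e \<and> sqrt (?A + s) \<le> sqrt (?Q + w) + e"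
      by blast
  qed auto
qed

theorem dirichlet_integral_bound:
  assumes k: "0 \<le> k" "k < 1" and q: "norm q < 1" "Im q = 0"
    and F: "quasiconformal k F" "F (Some q) = None"
    and S: "S holomorphic_on ball 0 1" "\<And>z. z \<in> ball 0 1 - {q} \<Longrightarrow> F (Some z) = Some (S z + 1 / (z - q))"
  shows "square_integrable (\<lambda>z. indicator (ball 0 1) z *\<^sub>R deriv S z)"
    and "energy (\<lambda>z. indicator (ball 0 1) z *\<^sub>R deriv S z) \<le> k\<^sup>2 * (pi / (1 - (norm q)\<^sup>2)\<^sup>2)"
proof -
  obtain G u v c where G: "sobolev_map G u v" "(G \<longlongrightarrow> c) at_infinity"
    and disc: "\<And>z. z \<in> ball 0 1 \<Longrightarrow> u z = deriv S z \<and> v z = 0"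
    and qc: "AE z in lebesgue. norm z > 1 \<longrightarrow> norm (v z) \<le> k * norm (u z - 1 / (z - q)\<^sup>2)"
  proof (rule simple_pole_subtracted[OF q(1) F S], goal_cases)
    case (2 G u v c)
    show ?case by (rule 2(1)) (fact 2)+
  qed auto
  have eq: "indicator (ball 0 1) z *\<^sub>R u z = indicator (ball 0 1) z *\<^sub>R deriv S z" for z
    using disc by (auto simp: indicator_def)
  have "square_integrable (\<lambda>z. indicator (ball 0 1) z *\<^sub>R (indicator (cball 0 1) z *\<^sub>R u z))"
    by (rule square_integrable_indicator[OF locally_L2D[OF sobolev_mapD(3)[OF G(1)] compact_cball subset_UNIV]]) simp
  also have "(\<lambda>z. indicator (ball 0 1) z *\<^sub>R (indicator (cball 0 1) z *\<^sub>R u z)) = (\<lambda>z. indicator (ball 0 1) z *\<^sub>R deriv S z)"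
    using disc by (auto simp: fun_eq_iff indicator_def)
  finally show "square_integrable (\<lambda>z. indicator (ball 0 1) z *\<^sub>R deriv S z)" .
  have "energy (\<lambda>z. indicator (ball 0 1) z *\<^sub>R u z) \<le> k\<^sup>2 * (pi / (1 - (norm q)\<^sup>2)\<^sup>2)"
    by (rule area_theorem[OF k q G _ qc]) (use disc in blast)
  then show "energy (\<lambda>z. indicator (ball 0 1) z *\<^sub>R deriv S z) \<le> k\<^sup>2 * (pi / (1 - (norm q)\<^sup>2)\<^sup>2)"
    unfolding eq .
qed

section \<open>The pointwise bound\<close>

text \<open>At \<open>q\<close> the series converges as well, because it does so at a point of larger modulus.\<close>

lemma power_series_holomorphic_punctured:
  fixes b :: "nat \<Rightarrow> complex"
  assumes "\<And>w. w \<in> ball 0 1 - {q} \<Longrightarrow> (\<lambda>n. b n * w ^ n) sums h w"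
  obtains S where "S holomorphic_on ball 0 1" "\<And>w. w \<in> ball 0 1 - {q} \<Longrightarrow> h w = S w"
proof -
  define S where "S = (\<lambda>w. \<Sum>n. b n * w ^ n)"
  have summ: "summable (\<lambda>n. b n * w ^ n)" if w: "norm w < 1" for w
  proof -
    obtain r where r: "norm w < r" "r < 1" using dense[OF w] by blast
    have "infinite {r<..<1::real}" using r by simp
    then have "\<not> {r<..<1} \<subseteq> {Re q}" by (meson finite.emptyI finite.insertI finite_subset)
    then obtain s where s: "s \<in> {r<..<1}" "complex_of_real s \<noteq> q" by force
    have "0 \<le> s" using s r le_less_trans[OF norm_ge_zero[of w] r(1)] by simp
    then have ns: "norm (complex_of_real s) = s" by simp
    then have "complex_of_real s \<in> ball 0 1 - {q}" using s by simp
    then have "summable (\<lambda>n. b n * complex_of_real s ^ n)" using assms sums_summable by blast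
    then show ?thesis by (rule powser_inside) (use r s ns in auto)
  qed
  have "S holomorphic_on ball 0 1"
    by (rule power_series_holomorphic[where a = b]) (use summ in \<open>simp add: S_def summable_sums\<close>)
  moreover have "h w = S w" if "w \<in> ball 0 1 - {q}" for w
    using sums_unique[OF assms[OF that]] by (simp add: S_def)
  ultimately show ?thesis using that by blast
qed

theorem corollary2:
  fixes p k :: real and f :: "complex \<Rightarrow> complex" and b :: "nat \<Rightarrow> complex"
  assumes "0 \<le> p" "p < 1" and "0 \<le> k" "k < 1"
    and "f \<in> Sigma_qc k p"
    and "\<And>z. z \<in> ball 0 1 - {of_real p} \<Longrightarrow>
           (\<lambda>n. b n * z ^ n) sums (f z - 1 / (z - of_real p))"
  shows "\<forall>z \<in> ball 0 1.
           norm (remove_sings (\<lambda>w. deriv f w + 1 / (w - of_real p)\<^sup>2) z)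
             \<le> k / ((1 - p\<^sup>2) * (1 - (norm z)\<^sup>2))"
proof
  fix z :: complex assume z: "z \<in> ball 0 1"
  define q where "q = complex_of_real p"
  have q: "norm q < 1" "Im q = 0" "q \<in> ball 0 1" "norm q = p" using assms by (auto simp: q_def)
  obtain F where F: "quasiconformal k F" "\<And>z. z \<in> ball 0 1 \<Longrightarrow> F (Some z) = sphere_map f z"
    and f: "is_pole f q" "inj_on (sphere_map f) (ball 0 1)"
    using assms(5) by (auto simp: Sigma_qc_def Sigma_class_def q_def)
  have Fq: "F (Some q) = None" using F(2)[OF q(3)] f by (simp add: sphere_map_def)
  obtain S where S: "S holomorphic_on ball 0 1" "\<And>w. w \<in> ball 0 1 - {q} \<Longrightarrow> f w - 1 / (w - q) = S w"
    using power_series_holomorphic_punctured[of q b "\<lambda>w. f w - 1 / (w - q)"] assms(6) unfolding q_def by blast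
  have Ff: "F (Some w) = Some (S w + 1 / (w - q))" if w: "w \<in> ball 0 1 - {q}" for w
  proof -
    have "sphere_map f w \<noteq> sphere_map f q" using inj_onD[OF f(2), of w q] w q by auto
    then have "sphere_map f w = Some (f w)" using f(1) by (auto simp: sphere_map_def split: if_splits)
    then show ?thesis using F(2)[of w] w S(2)[OF w] by (simp add: diff_eq_eq)
  qed
  note D = dirichlet_integral_bound[OF assms(3,4) q(1,2) F(1) Fq S(1) Ff]
  have "norm (deriv S z) \<le> sqrt (k\<^sup>2 * (pi / (1 - (norm q)\<^sup>2)\<^sup>2) / pi) / (1 - (norm z)\<^sup>2)"
    by (rule bergman_bound_unit_disc[OF holomorphic_deriv[OF S(1) open_ball] _ D]) (use z in simp)
  also have "sqrt (k\<^sup>2 * (pi / (1 - (norm q)\<^sup>2)\<^sup>2) / pi) = k / (1 - p\<^sup>2)"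
  proof -
    have "p\<^sup>2 < 1" using assms(1,2) by (simp add: abs_square_less_1)
    moreover have "k\<^sup>2 * (pi / (1 - (norm q)\<^sup>2)\<^sup>2) / pi = (k / (1 - p\<^sup>2))\<^sup>2" by (simp add: q(4) power_divide)
    ultimately show ?thesis using assms(3) by simp
  qed
  finally have bound: "norm (deriv S z) \<le> k / ((1 - p\<^sup>2) * (1 - (norm z)\<^sup>2))" by simp
  have h_eq: "deriv S w = deriv f w + 1 / (w - q)\<^sup>2" if w: "w \<in> ball 0 1 - {q}" for w
  proof -
    have "((\<lambda>w. S w + 1 / (w - q)) has_field_derivative deriv S w - 1 / (w - q)\<^sup>2) (at w)"
      using w by (auto intro!: derivative_eq_intros holomorphic_derivI[OF S(1)] simp: power2_eq_square)
    then have "(f has_field_derivative deriv S w - 1 / (w - q)\<^sup>2) (at w)"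
      by (rule has_field_derivative_transform_within_open[where S = "ball 0 1 - {q}"])
         (use w S(2) in \<open>auto simp: algebra_simps\<close>)
    then show ?thesis by (simp add: DERIV_imp_deriv)
  qed
  have "isCont (deriv S) z"
    using z holomorphic_on_imp_continuous_on[OF holomorphic_deriv[OF S(1) open_ball]]
    by (simp add: continuous_on_eq_continuous_at)
  then have "deriv S \<midarrow>z\<rightarrow> deriv S z" by (simp add: isCont_def)
  moreover have "\<forall>\<^sub>F w in at z. deriv S w = deriv f w + 1 / (w - q)\<^sup>2"
  proof -
    have "\<forall>\<^sub>F w in at z. w \<in> ball 0 1 - {z}" using z by (intro eventually_at_in_open) auto
    moreover have "\<forall>\<^sub>F w in at z. w \<noteq> q" by (rule eventually_neq_at_within)
    ultimately show ?thesis by eventually_elim (use h_eq in auto)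
  qed
  ultimately have "(\<lambda>w. deriv f w + 1 / (w - q)\<^sup>2) \<midarrow>z\<rightarrow> deriv S z" by (rule Lim_transform_eventually)
  then have "remove_sings (\<lambda>w. deriv f w + 1 / (w - q)\<^sup>2) z = deriv S z" by (rule remove_sings_eqI)
  then show "norm (remove_sings (\<lambda>w. deriv f w + 1 / (w - of_real p)\<^sup>2) z) \<le> k / ((1 - p\<^sup>2) * (1 - (norm z)\<^sup>2))"
    using bound by (simp add: q_def)
qed

end
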